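(* Let $\gamma\ge 1$ and fix $T'\ge 0$. Let $(h,u,v)\in C^1([0,T']\times\mathbb{R})$ be a classical solution of $$\partial_t h+h^2\partial_\xi u=0,\qquad \partial_t u+\partial_\xi\big(h^\gamma/\gamma\big)-v=0,\qquad \partial_t v+u=0,$$ with initial data $(h,u,v)(0,\xi)=(h_0,u_0,v_0)(\xi)$ satisfying $\inf_{\xi}h_0>0$ and $(h_0-1,u_0,v_0)\in C_0^1(\mathbb{R})$. If $$\inf_{\xi}\min_{1\le i\le 2} Z_i(T',\xi)\le -\sqrt{2\omega_0^\sharp},$$ then the solution must develop a singularity at some finite time $T^\sharp>T'$ in the following sense: on $[0,T^\sharp)$ the solution exists as a classical solution and $$\inf_{0\le t<T^\sharp,\ \xi\in\mathbb{R}} h(t,\xi)>0,\qquad \sup_{0\le t<T^\sharp,\ \xi\in\mathbb{R}}\max\{h(t,\xi),|u(t,\xi)|,|v(t,\xi)|\}<\infty,$$ $$\sup_{0\le t<T^\sharp,\ \xi\in\mathbb{R}}\max_{1\le j\le 2}Z_j(t,\xi)<\infty,\qquad \lim_{t\nearrow T^\sharp}\inf_{\xi\in\mathbb{R}}\min_{1\le j\le 2}Z_j(t,\xi)=-\infty.$$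
   Context: $C_0^1(\mathbb{R})$ denotes compactly supported $C^1$ functions. A classical solution is a $C^1$ solution with $h>0$. The weighted gradients of Riemann invariants are $Z_j=\sqrt{h}\,\big[\partial_\xi u+(-1)^j h^{\frac{\gamma-3}{2}}\partial_\xi h\big]$ for $j=1,2$. The initial potential vorticity is $\omega_0(\xi)=\frac{1}{h_0(\xi)}+v_0'(\xi)$, and $\omega_0^\sharp:=\sup_\xi \omega_0(\xi)$. *)

theory Defs
  imports "HOL-Analysis.Analysis"
begin

definition dxi :: "(real \<Rightarrow> real \<Rightarrow> real) \<Rightarrow> real \<Rightarrow> real \<Rightarrow> real" where
  "dxi f t x = deriv (\<lambda>y. f t y) x"

definition C01 :: "(real \<Rightarrow> real) \<Rightarrow> bool" where
  "C01 f \<longleftrightarrow> (\<forall>x. f differentiable (at x)) \<and> continuous_on UNIV (deriv f)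
     \<and> bounded {x. f x \<noteq> 0}"

text \<open>Classical (C^1, h > 0) solution on the time interval I \<times> R of
  h_t + h^2 u_xi = 0,  u_t + (h^gamma/gamma)_xi - v = 0,  v_t + u = 0.
  The time derivatives are taken within I (one-sided at endpoints); (h^gamma/gamma)_xi
  is written out as h^(gamma-1) h_xi.\<close>
definition classical_solution ::
  "real \<Rightarrow> real set \<Rightarrow> (real \<Rightarrow> real \<Rightarrow> real) \<Rightarrow> (real \<Rightarrow> real \<Rightarrow> real) \<Rightarrow> (real \<Rightarrow> real \<Rightarrow> real) \<Rightarrow> bool"
  where
  "classical_solution \<gamma> I h u v \<longleftrightarrow>
     (\<forall>t\<in>I. \<forall>x. h t x > 0) \<and>
     (\<forall>f\<in>{h, u, v}.
        continuous_on (I \<times> UNIV) (\<lambda>(t, x). f t x) \<and>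
        (\<forall>t\<in>I. \<forall>x. (\<lambda>y. f t y) differentiable (at x)) \<and>
        continuous_on (I \<times> UNIV) (\<lambda>(t, x). dxi f t x)) \<and>
     (\<forall>t\<in>I. \<forall>x.
        ((\<lambda>s. h s x) has_real_derivative (- (h t x)\<^sup>2 * dxi u t x)) (at t within I) \<and>
        ((\<lambda>s. u s x) has_real_derivative (v t x - h t x powr (\<gamma> - 1) * dxi h t x)) (at t within I) \<and>
        ((\<lambda>s. v s x) has_real_derivative (- u t x)) (at t within I))"

text \<open>Weighted gradients of Riemann invariants, j = 1, 2.\<close>
definition Zw :: "real \<Rightarrow> (real \<Rightarrow> real \<Rightarrow> real) \<Rightarrow> (real \<Rightarrow> real \<Rightarrow> real) \<Rightarrow> nat \<Rightarrow> real \<Rightarrow> real \<Rightarrow> real" where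
  "Zw \<gamma> h u j t x = sqrt (h t x) * (dxi u t x + (-1) ^ j * h t x powr ((\<gamma> - 3) / 2) * dxi h t x)"

definition omega0 :: "(real \<Rightarrow> real) \<Rightarrow> (real \<Rightarrow> real) \<Rightarrow> real \<Rightarrow> real" where
  "omega0 h0 v0 x = 1 / h0 x + deriv v0 x"

definition omega0_sharp :: "(real \<Rightarrow> real) \<Rightarrow> (real \<Rightarrow> real) \<Rightarrow> real" where
  "omega0_sharp h0 v0 = (SUP x. omega0 h0 v0 x)"

end

(*
  With K' = h^((gamma - 3) / 2) the Riemann invariants u + K(h), u - K(h) travel with speeds +c, -c,
  c = h^((gamma + 1) / 2), and have source v; the potential vorticity 1/h + v_x is conserved. Along
  its own characteristic each weighted gradient obeys the Riccati equation
    Z_j' = sqrt h (omega_0 - 1/h - (gamma + 1)/4 Z_j^2 + (gamma - 1)/4 Z_1 Z_2).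
  At a positive maximum of Z_1, Z_2, or at a negative minimum, Z_1 Z_2 <= Z_j^2, so the right-hand side
  is at most sqrt h (omega_0 - 1/h - Z_j^2 / 2). Hence Z is bounded above; a minimum at or below
  - sqrt (2 sup omega_0) decreases for ever and reaches minus infinity in finite time, because
  (h^(-1/2))_t = (Z_1 + Z_2) / 4 makes h^(-1/2) grow at most linearly. As long as Z is
  bounded below all C^1 norms are controlled, and the solution continues for a time depending only on
  these norms. Such a continuation is obtained from a contraction for the Riemann invariants jointly
  with the characteristics through every point; a second contraction yields the candidate
  for the x-derivatives.
*)
theory Submission
  imports Defs
begin

section \<open>Contraction and parametric integrals\<close>

text \<open>The solution is only \<open>C^1\<close>, so neither the Riccati equations nor the
  conservation of vorticity can be read off by differentiating the system in \<open>x\<close>; both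
  come from difference quotients along characteristics. An infimum over the whole line must also
  become a point at which a maximum principle applies: finite speed of propagation confines the
  perturbation of the rest state to a compact slab, so first contacts exist.

  The weight \<open>sqrt h\<close> is essential. Without it the coefficients of \<open>Z_j^2\<close>
  and \<open>Z_1 Z_2\<close> would cancel when both gradients agree; its derivative lowers the mixed
  coefficient from (\<gamma> + 1)/4 to (\<gamma> - 1)/4 and leaves -1/2 at an extremum.

  The threshold is borderline: at - sqrt (2 sup omega_0) the term omega_0 - Z_j^2 / 2 may vanish,
  and only - 1/h gives strict decrease. One unit of time turns this into a definite gap, after which
  the quadratic term wins.

  The blow-up time is the limit of a chain of extensions, each using more than half of the time
  still available. If the gradients stayed bounded below, every link would have at least a fixed
  length.\<close>

lemma geometric_cauchy_limit:
  fixes x :: "nat \<Rightarrow> real"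
  assumes step: "\<And>n. \<bar>x (Suc n) - x n\<bar> \<le> C / 2 ^ n"
  shows "x \<longlonglongrightarrow> lim x" and "\<bar>x n - lim x\<bar> \<le> 2 * C / 2 ^ n"
proof -
  have tail: "\<bar>x (n + k) - x n\<bar> \<le> 2 * C / 2 ^ n - 2 * C / 2 ^ (n + k)" for n k
  proof (induction k)
    case (Suc k)
    have "2 * C / 2 ^ n - 2 * C / 2 ^ (n + k) + C / 2 ^ (n + k) = 2 * C / 2 ^ n - 2 * C / 2 ^ (n + Suc k)"
      by (simp add: field_simps)
    with Suc step[of "n + k"] show ?case by simp
  qed simp
  have C0: "C \<ge> 0" using step[of 0] by simp
  have tail2: "\<bar>x (n + k) - x n\<bar> \<le> 2 * C / 2 ^ n" for n k
    using tail[of n k] C0 by (smt (verit) divide_nonneg_nonneg zero_le_power)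
  have z: "(\<lambda>n. 2 * C / 2 ^ n) \<longlonglongrightarrow> 0"
    using tendsto_mult_right_zero[OF LIMSEQ_realpow_zero[of "1/2"], of "2*C"]
    by (simp add: power_divide field_simps)
  have "Cauchy x"
  proof (rule CauchyI')
    fix e :: real assume "e > 0"
    then obtain N where N: "2 * C / 2 ^ N < e / 2"
      using order_tendstoD(2)[OF z, of "e/2"] by (auto simp: eventually_sequentially)
    have "norm (x m - x n) < e" if "m \<ge> N" "n > m" for m n
      using tail2[of N "m - N"] tail2[of N "n - N"] that N by simp
    then show "\<exists>M. \<forall>m\<ge>M. \<forall>n>m. dist (x m) (x n) < e"
      by (auto simp: dist_norm intro!: exI[of _ N])
  qed
  then show L: "x \<longlonglongrightarrow> lim x"
    using Cauchy_convergent_iff convergent_LIMSEQ_iff by blast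
  have "(\<lambda>k. \<bar>x n - x (n + k)\<bar>) \<longlonglongrightarrow> \<bar>x n - lim x\<bar>"
    using L by (intro tendsto_intros) (simp add: LIMSEQ_ignore_initial_segment add.commute)
  then show "\<bar>x n - lim x\<bar> \<le> 2 * C / 2 ^ n"
    using tail2[of n] by (intro LIMSEQ_le_const2) (auto simp: abs_minus_commute)
qed

text \<open>The weight \<open>\<eta>\<close> is needed because \<open>G\<close> will depend on its first argument through initial data
  whose Lipschitz constant is not small.\<close>
lemma pair_contraction:
  fixes F :: "('i \<Rightarrow> 'a \<Rightarrow> real) \<Rightarrow> ('i \<Rightarrow> 'b \<Rightarrow> real) \<Rightarrow> 'i \<Rightarrow> 'a \<Rightarrow> real"
    and G :: "('i \<Rightarrow> 'a \<Rightarrow> real) \<Rightarrow> ('i \<Rightarrow> 'b \<Rightarrow> real) \<Rightarrow> 'i \<Rightarrow> 'b \<Rightarrow> real"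
  assumes \<eta>: "\<eta> > 0" and init: "P X0 U0"
    and d0: "\<And>i a. a \<in> A \<Longrightarrow> \<bar>F X0 U0 i a - X0 i a\<bar> \<le> C * \<eta>"
            "\<And>i b. b \<in> B \<Longrightarrow> \<bar>G X0 U0 i b - U0 i b\<bar> \<le> C"
    and maps: "\<And>X U. P X U \<Longrightarrow> P (F X U) (G X U)"
    and lim: "\<And>Xs Us X U. (\<And>n. P (Xs n) (Us n)) \<Longrightarrow>
                (\<And>i. uniform_limit A (\<lambda>n. Xs n i) (X i) sequentially) \<Longrightarrow>
                (\<And>i. uniform_limit B (\<lambda>n. Us n i) (U i) sequentially) \<Longrightarrow> P X U"
    and contr: "\<And>X U X' U' d. P X U \<Longrightarrow> P X' U' \<Longrightarrow> d \<ge> 0 \<Longrightarrow>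
        (\<And>i a. a \<in> A \<Longrightarrow> \<bar>X i a - X' i a\<bar> \<le> d * \<eta>) \<Longrightarrow> (\<And>i b. b \<in> B \<Longrightarrow> \<bar>U i b - U' i b\<bar> \<le> d) \<Longrightarrow>
        (\<forall>i. (\<forall>a\<in>A. \<bar>F X U i a - F X' U' i a\<bar> \<le> d / 2 * \<eta>) \<and> (\<forall>b\<in>B. \<bar>G X U i b - G X' U' i b\<bar> \<le> d / 2))"
    and ne: "B \<noteq> {}"
  shows "\<exists>X U. P X U \<and> (\<forall>i. (\<forall>a\<in>A. F X U i a = X i a) \<and> (\<forall>b\<in>B. G X U i b = U i b))"
proof -
  define Q where "Q n = ((\<lambda>(X, U). (F X U, G X U)) ^^ n) (X0, U0)" for n
  define Xs where "Xs n = fst (Q n)" for n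
  define Us where "Us n = snd (Q n)" for n
  have s0: "Xs 0 = X0" "Us 0 = U0" by (simp_all add: Xs_def Us_def Q_def)
  have sS: "Xs (Suc n) = F (Xs n) (Us n)" "Us (Suc n) = G (Xs n) (Us n)" for n
    by (simp_all add: Xs_def Us_def Q_def case_prod_beta)
  have Pn: "P (Xs n) (Us n)" for n
    by (induction n) (use init maps in \<open>auto simp: s0 sS\<close>)
  have C0: "C \<ge> 0"
    using ne d0(2) by (metis abs_ge_zero ex_in_conv order_trans)
  have diff: "(\<forall>i. (\<forall>a\<in>A. \<bar>Xs (Suc n) i a - Xs n i a\<bar> \<le> C / 2 ^ n * \<eta>) \<and> (\<forall>b\<in>B. \<bar>Us (Suc n) i b - Us n i b\<bar> \<le> C / 2 ^ n))" for n
  proof (induction n)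
    case 0 then show ?case using d0 by (simp add: s0 sS)
  next
    case (Suc n)
    have "(\<forall>i. (\<forall>a\<in>A. \<bar>F (Xs (Suc n)) (Us (Suc n)) i a - F (Xs n) (Us n) i a\<bar> \<le> (C / 2 ^ n) / 2 * \<eta>)
      \<and> (\<forall>b\<in>B. \<bar>G (Xs (Suc n)) (Us (Suc n)) i b - G (Xs n) (Us n) i b\<bar> \<le> (C / 2 ^ n) / 2))"
      using Suc C0 by (intro contr Pn) auto
    then show ?case by (simp add: sS(1)[of "Suc n"] sS(2)[of "Suc n"] sS(1)[of n, symmetric] sS(2)[of n, symmetric] mult.commute)
  qed
  define X where "X i a = lim (\<lambda>n. Xs n i a)" for i a
  define U where "U i b = lim (\<lambda>n. Us n i b)" for i b
  have dX: "\<bar>Xs n i a - X i a\<bar> \<le> 2 * C / 2 ^ n * \<eta>" if "a \<in> A" for n i a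
    using geometric_cauchy_limit(2)[of "\<lambda>n. Xs n i a" "C * \<eta>" n] diff that by (simp add: X_def mult_ac)
  have dU: "\<bar>Us n i b - U i b\<bar> \<le> 2 * C / 2 ^ n" if "b \<in> B" for n i b
    using geometric_cauchy_limit(2)[of "\<lambda>n. Us n i b" "C" n] diff that by (simp add: U_def)
  have z: "(\<lambda>n. K / 2 ^ n) \<longlonglongrightarrow> 0" for K :: real
    using tendsto_mult_right_zero[OF LIMSEQ_realpow_zero[of "1/2"], of K]
    by (simp add: power_divide field_simps)
  have uX: "uniform_limit A (\<lambda>n. Xs n i) (X i) sequentially" for i
  proof (rule uniform_limitI)
    fix e :: real assume "e > 0"
    from order_tendstoD(2)[OF z[of "2 * C * \<eta>"] this]
    show "\<forall>\<^sub>F n in sequentially. \<forall>x\<in>A. dist (Xs n i x) (X i x) < e"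
      by eventually_elim (use dX in \<open>fastforce simp: dist_norm intro: le_less_trans\<close>)
  qed
  have uU: "uniform_limit B (\<lambda>n. Us n i) (U i) sequentially" for i
  proof (rule uniform_limitI)
    fix e :: real assume "e > 0"
    from order_tendstoD(2)[OF z[of "2 * C"] this]
    show "\<forall>\<^sub>F n in sequentially. \<forall>x\<in>B. dist (Us n i x) (U i x) < e"
      by eventually_elim (use dU in \<open>fastforce simp: dist_norm intro: le_less_trans\<close>)
  qed
  have PXU: "P X U" by (rule lim[OF Pn uX uU])
  \<comment> \<open>The contraction is applied to the limit pair itself, so \<open>P X U\<close> had
    to be secured first. As \<open>F\<close> of an iterate is the next iterate, both
    \<open>F X U\<close> and \<open>X\<close> lie within a geometric error of it.\<close>
  have cl: "(\<forall>i. (\<forall>a\<in>A. \<bar>F (Xs n) (Us n) i a - F X U i a\<bar> \<le> (2 * C / 2 ^ n) / 2 * \<eta>)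
      \<and> (\<forall>b\<in>B. \<bar>G (Xs n) (Us n) i b - G X U i b\<bar> \<le> (2 * C / 2 ^ n) / 2))" for n
    using C0 dX dU by (intro contr Pn PXU) auto
  have "F X U i a = X i a" if "a \<in> A" for i a
  proof -
    have "\<bar>F X U i a - X i a\<bar> \<le> 2 * C * \<eta> / 2 ^ n" for n
    proof -
      have "\<bar>F (Xs n) (Us n) i a - F X U i a\<bar> \<le> C * \<eta> / 2 ^ n" using cl[of n] that by simp
      moreover have "\<bar>F (Xs n) (Us n) i a - X i a\<bar> \<le> C * \<eta> / 2 ^ n"
        using dX[OF that, of "Suc n" i] unfolding sS(1) by simp
      moreover have "2 * C * \<eta> / 2 ^ n = C * \<eta> / 2 ^ n + C * \<eta> / 2 ^ n" by simp
      ultimately show ?thesis by linarith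
    qed
    then have "\<bar>F X U i a - X i a\<bar> \<le> 0"
      using LIMSEQ_le_const[OF z[of "2 * C * \<eta>"]] by blast
    then show ?thesis by simp
  qed
  moreover have "G X U i b = U i b" if "b \<in> B" for i b
  proof -
    have "\<bar>G X U i b - U i b\<bar> \<le> 2 * C / 2 ^ n" for n
    proof -
      have "\<bar>G (Xs n) (Us n) i b - G X U i b\<bar> \<le> C / 2 ^ n" using cl[of n] that by simp
      moreover have "\<bar>G (Xs n) (Us n) i b - U i b\<bar> \<le> C / 2 ^ n"
        using dU[OF that, of "Suc n" i] unfolding sS(2) by simp
      moreover have "2 * C / 2 ^ n = C / 2 ^ n + C / 2 ^ n" by simp
      ultimately show ?thesis by linarith
    qed
    then have "\<bar>G X U i b - U i b\<bar> \<le> 0"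
      using LIMSEQ_le_const[OF z[of "2 * C"]] by blast
    then show ?thesis by simp
  qed
  ultimately show ?thesis using PXU by blast
qed

text \<open>Moves the endpoints of an integral into its integrand, where continuity in parameters
  can be applied; \<open>s = t\<close> is included.\<close>

lemma integral_affine_unit:
  fixes g :: "real \<Rightarrow> real"
  assumes "s \<le> t" and g: "continuous_on {s..t} g"
  shows "integral {s..t} g = (t - s) * integral {0..1} (\<lambda>\<theta>. g (s + (t - s) * \<theta>))"
proof -
  define G where "G x = integral {s..x} g" for x
  have img: "(\<lambda>\<theta>. s + (t - s) * \<theta>) ` {0..1} \<subseteq> {s..t}"
  proof safe
    fix \<theta> :: real assume "\<theta> \<in> {0..1}"
    then have "(t - s) * \<theta> \<le> (t - s) * 1" "0 \<le> (t - s) * \<theta>"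
      using assms by (intro mult_left_mono mult_nonneg_nonneg; simp)+
    then show "s + (t - s) * \<theta> \<in> {s..t}" by auto
  qed
  have "((\<lambda>\<theta>. G (s + (t - s) * \<theta>)) has_vector_derivative (t - s) * g (s + (t - s) * \<theta>)) (at \<theta> within {0..1})"
    if "\<theta> \<in> {0..1}" for \<theta>
  proof -
    have "(G has_real_derivative g (s + (t - s) * \<theta>)) (at (s + (t - s) * \<theta>) within (\<lambda>\<theta>. s + (t - s) * \<theta>) ` {0..1})"
      using integral_has_real_derivative[OF g, of "s + (t - s) * \<theta>"] img that
      unfolding G_def by (blast intro: DERIV_subset)
    moreover have "((\<lambda>\<theta>. s + (t - s) * \<theta>) has_real_derivative (t - s)) (at \<theta> within {0..1})"
      by (auto intro!: derivative_eq_intros)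
    ultimately have "(G \<circ> (\<lambda>\<theta>. s + (t - s) * \<theta>) has_real_derivative g (s + (t - s) * \<theta>) * (t - s)) (at \<theta> within {0..1})"
      by (rule DERIV_image_chain)
    then show ?thesis by (simp add: has_real_derivative_iff_has_vector_derivative o_def mult.commute)
  qed
  then have "((\<lambda>\<theta>. (t - s) * g (s + (t - s) * \<theta>)) has_integral G (s + (t - s) * 1) - G (s + (t - s) * 0)) {0..1}"
    by (intro fundamental_theorem_of_calculus) auto
  from integral_unique[OF this]
  have "integral {0..1} (\<lambda>\<theta>. (t - s) * g (s + (t - s) * \<theta>)) = integral {s..t} g"
    unfolding G_def by simp
  then show ?thesis by simp
qed

text \<open>Domain of backward characteristics: \<open>s\<close> is the running time,
  \<open>(t, x)\<close> the point at which the curve ends.\<close>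

definition time_simplex :: "real \<Rightarrow> (real \<times> real \<times> real) set" where
  "time_simplex \<delta> = {(s, t, x). 0 \<le> s \<and> s \<le> t \<and> t \<le> \<delta>}"

text \<open>The substitution \<open>\<sigma> = s + (t - s) * \<theta>\<close> stays in the simplex
  for every \<open>\<theta>\<close> in the unit interval, which reduces the claim to an integral
  with fixed endpoints.\<close>

lemma continuous_on_integral_time_simplex:
  fixes g :: "real \<times> real \<times> real \<Rightarrow> real"
  assumes g: "continuous_on (time_simplex \<delta>) g"
  shows "continuous_on (time_simplex \<delta>) (\<lambda>(s, t, x). integral {s..t} (\<lambda>\<sigma>. g (\<sigma>, t, x)))"
proof -
  have sl: "continuous_on {s..t} (\<lambda>\<sigma>. g (\<sigma>, t, x))" if "(s, t, x) \<in> time_simplex \<delta>" for s t x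
    by (rule continuous_on_compose2[OF g]) (use that in \<open>auto simp: time_simplex_def intro!: continuous_intros\<close>)
  have "continuous_on (time_simplex \<delta> \<times> cbox 0 (1::real))
     (\<lambda>(p, \<theta>). g (fst p + (fst (snd p) - fst p) * \<theta>, fst (snd p), snd (snd p)))"
    unfolding case_prod_beta
  proof (rule continuous_on_compose2[OF g], goal_cases)
    case 1 show ?case by (intro continuous_intros)
  next
    case 2
    have "0 \<le> s + (t - s) * \<theta>" "s + (t - s) * \<theta> \<le> t" if "0 \<le> s" "s \<le> t" "0 \<le> \<theta>" "\<theta> \<le> 1" for s t \<theta> :: real
      using mult_left_mono[of \<theta> 1 "t - s"] mult_nonneg_nonneg[of "t - s" \<theta>] that by auto
    then show ?case by (auto simp: time_simplex_def cbox_interval)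
  qed
  from integral_continuous_on_param[OF this]
  have "continuous_on (time_simplex \<delta>) (\<lambda>p. (fst (snd p) - fst p) *
      integral {0..1} (\<lambda>\<theta>. g (fst p + (fst (snd p) - fst p) * \<theta>, fst (snd p), snd (snd p))))"
    by (intro continuous_intros) (simp add: cbox_interval)
  then show ?thesis
    by (rule continuous_on_eq)
      (auto simp: integral_affine_unit[OF _ sl] time_simplex_def intro!: integral_affine_unit[OF _ sl, symmetric])
qed

section \<open>Local existence for the diagonal system\<close>

lemma integral_diff_bound:
  fixes f g :: "real \<Rightarrow> real"
  assumes "s \<le> t" "t - s \<le> \<delta>" "continuous_on {s..t} f" "continuous_on {s..t} g"
    and b: "\<And>\<sigma>. \<sigma> \<in> {s..t} \<Longrightarrow> \<bar>f \<sigma> - g \<sigma>\<bar> \<le> b"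
  shows "\<bar>integral {s..t} f - integral {s..t} g\<bar> \<le> \<delta> * b"
proof -
  have "integral {s..t} f - integral {s..t} g = integral {s..t} (\<lambda>\<sigma>. f \<sigma> - g \<sigma>)"
    using assms by (simp add: integral_diff integrable_continuous_real)
  also have "norm \<dots> \<le> b * (t - s)"
    using assms by (intro integral_bound continuous_intros) auto
  finally have 1: "\<bar>integral {s..t} f - integral {s..t} g\<bar> \<le> b * (t - s)" by simp
  have "b \<ge> 0" using b[of s] assms(1) by auto
  then have "b * (t - s) \<le> b * \<delta>" using assms by (intro mult_left_mono) auto
  with 1 show ?thesis by (simp add: mult.commute)
qed

lemma integral_abs_bound:
  fixes f :: "real \<Rightarrow> real"
  assumes "s \<le> t" "t - s \<le> \<delta>" "continuous_on {s..t} f" "\<And>\<sigma>. \<sigma> \<in> {s..t} \<Longrightarrow> \<bar>f \<sigma>\<bar> \<le> b"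
  shows "\<bar>integral {s..t} f\<bar> \<le> \<delta> * b"
  using integral_diff_bound[of s t \<delta> f "\<lambda>_. 0" b] assms by simp

text \<open>\<open>Rp\<close>, \<open>Rm\<close>, \<open>Vc\<close> index the unknowns \<open>u + K h\<close>, \<open>u - K h\<close>, \<open>v\<close>, transported with speeds
  \<open>c\<close>, \<open>- c\<close>, \<open>0\<close>; then \<open>mid\<close> recovers \<open>K h\<close>.\<close>
datatype comp = Rp | Rm | Vc

fun sg :: "comp \<Rightarrow> real" where "sg Rp = 1" | "sg Rm = -1" | "sg Vc = 0"

definition mid :: "(comp \<Rightarrow> real) \<Rightarrow> real" where "mid y = (y Rp - y Rm) / 2"

fun src :: "comp \<Rightarrow> (comp \<Rightarrow> real) \<Rightarrow> real" where
  "src Rp y = y Vc" | "src Rm y = y Vc" | "src Vc y = - (y Rp + y Rm) / 2"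

lemma abs_sg_mult_le: "\<bar>sg i * a\<bar> \<le> \<bar>a\<bar>" by (cases i) auto

lemma sg_diff_leI:
  assumes "\<bar>x - y\<bar> \<le> d" "\<bar>a - b\<bar> \<le> e" "d + e \<le> k"
  shows "\<bar>(x - sg i * a) - (y - sg i * b)\<bar> \<le> k"
  using assms by (cases i) auto

lemma add_diff_leI:
  fixes a b x y :: real
  assumes "\<bar>x - y\<bar> \<le> d" "\<bar>a - b\<bar> \<le> e" "d + e \<le> k"
  shows "\<bar>(x + a) - (y + b)\<bar> \<le> k"
  using assms by linarith

lemma mid_diff: "mid y - mid z = mid (\<lambda>j. y j - z j)"
  by (simp add: mid_def field_simps)

lemma src_diff: "src i y - src i z = src i (\<lambda>j. y j - z j)"
  by (cases i) (simp_all add: field_simps)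

lemma abs_mid_le: assumes "\<And>j. \<bar>y j\<bar> \<le> d" shows "\<bar>mid y\<bar> \<le> d"
  using assms[of Rp] assms[of Rm] by (simp add: mid_def)

lemma abs_src_le: assumes "\<And>j. \<bar>y j\<bar> \<le> d" shows "\<bar>src i y\<bar> \<le> d"
  using assms[of Rp] assms[of Rm] assms[of Vc] by (cases i) (simp_all add: abs_le_iff)

lemma mid_lip: assumes "\<And>j. \<bar>y j - z j\<bar> \<le> d" shows "\<bar>mid y - mid z\<bar> \<le> d"
  unfolding mid_diff by (rule abs_mid_le) (rule assms)

lemma src_lip: assumes "\<And>j. \<bar>y j - z j\<bar> \<le> d" shows "\<bar>src i y - src i z\<bar> \<le> d"
  unfolding src_diff by (rule abs_src_le) (rule assms)

lemma continuous_on_mid [continuous_intros]: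
  "(\<And>j. continuous_on A (U j)) \<Longrightarrow> continuous_on A (\<lambda>p. mid (\<lambda>j. U j p))"
  unfolding mid_def by (intro continuous_intros) auto

lemma continuous_on_src [continuous_intros]:
  "(\<And>j. continuous_on A (U j)) \<Longrightarrow> continuous_on A (\<lambda>p. src i (\<lambda>j. U j p))"
  by (cases i) (auto intro!: continuous_intros)

lemma uniform_limit_continuous_on:
  assumes "\<And>n. continuous_on A (f n)" "uniform_limit A f l sequentially"
  shows "continuous_on A l"
  by (rule uniform_limit_theorem[OF _ assms(2)]) (use assms(1) in auto)

lemma uniform_limit_le:
  fixes f :: "nat \<Rightarrow> 'a \<Rightarrow> real"
  assumes "uniform_limit A f l sequentially" "a \<in> A" "\<And>n. \<bar>f n a\<bar> \<le> b"
  shows "\<bar>l a\<bar> \<le> b"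
proof -
  have "(\<lambda>n. \<bar>f n a\<bar>) \<longlonglongrightarrow> \<bar>l a\<bar>"
    using tendsto_uniform_limitI[OF assms(1,2)] by (intro tendsto_intros)
  then show ?thesis by (rule LIMSEQ_le_const2) (use assms(3) in auto)
qed

lemma uniform_limit_diff_le:
  fixes f :: "nat \<Rightarrow> 'a \<Rightarrow> real"
  assumes "uniform_limit A f l sequentially" "a \<in> A" "b \<in> A" "\<And>n. \<bar>f n a - f n b\<bar> \<le> d"
  shows "\<bar>l a - l b\<bar> \<le> d"
proof -
  have "(\<lambda>n. \<bar>f n a - f n b\<bar>) \<longlonglongrightarrow> \<bar>l a - l b\<bar>"
    using tendsto_uniform_limitI[OF assms(1,2)] tendsto_uniform_limitI[OF assms(1,3)]
    by (intro tendsto_intros)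
  then show ?thesis by (rule LIMSEQ_le_const2) (use assms(4) in auto)
qed

text \<open>\<open>U0_unif\<close> is differentiability uniform in \<open>x\<close>, because the
  defect of the difference quotients will be estimated on the whole strip at once.
  \<open>\<delta>1\<close> controls the source integrals, \<open>\<delta>2\<close> the displacement
  of characteristics against the steepness of the data, \<open>\<delta>3\<close> the growth of the
  sup norm.\<close>

locale riemann_system =
  fixes c dc :: "real \<Rightarrow> real" and K B L0 \<delta> :: real and U0 DU0 :: "comp \<Rightarrow> real \<Rightarrow> real"
  assumes c_deriv: "\<And>r. (c has_real_derivative dc r) (at r)"
    and dc_le: "\<And>r. \<bar>dc r\<bar> \<le> K"
    and dc_lip: "\<And>r r'. \<bar>dc r - dc r'\<bar> \<le> K * \<bar>r - r'\<bar>"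
    and U0_le: "\<And>i x. \<bar>U0 i x\<bar> \<le> B"
    and U0_lip: "\<And>i x y. \<bar>U0 i x - U0 i y\<bar> \<le> L0 * \<bar>x - y\<bar>"
    and DU0_le: "\<And>i x. \<bar>DU0 i x\<bar> \<le> L0"
    and DU0_cont: "\<And>i. continuous_on UNIV (DU0 i)"
    and U0_unif: "\<And>i e. e > 0 \<Longrightarrow> \<exists>\<rho>>0. \<forall>x d. \<bar>d\<bar> \<le> \<rho> \<longrightarrow> \<bar>U0 i (x + d) - U0 i x - d * DU0 i x\<bar> \<le> e * \<bar>d\<bar>"
    and L0_pos: "L0 > 0" and B_nonneg: "B \<ge> 0"
    and \<delta>_pos: "\<delta> > 0" and \<delta>1: "\<delta> \<le> 1 / 12" and \<delta>2: "24 * L0 * K * \<delta> \<le> 1" and \<delta>3: "\<delta> * (B + 1) \<le> 1"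
begin

text \<open>With this weight, moving a characteristic by \<open>d * \<eta>\<close> changes
  \<open>U0\<close> by at most \<open>d / 4\<close>, and a function with Lipschitz constant
  \<open>4 * L0\<close> by at most \<open>d\<close>.\<close>

definition "\<eta> = 1 / (4 * L0)"

lemma \<eta>_pos: "\<eta> > 0" using L0_pos by (simp add: \<eta>_def)

lemma L0_\<eta>: "L0 * \<eta> = 1 / 4" using L0_pos by (simp add: \<eta>_def)

lemma K_nonneg: "K \<ge> 0" using dc_le[of 0] by linarith

lemma \<delta>K: "\<delta> * K \<le> \<eta> / 6"
  using \<delta>2 L0_pos by (simp add: \<eta>_def field_simps)

lemma \<delta>KL: "\<delta> * K * L0 \<le> 1 / 24"
  using \<delta>2 by (simp add: field_simps)

lemma c_lip: "\<bar>c a - c b\<bar> \<le> K * \<bar>a - b\<bar>"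
proof -
  have "norm (c a - c b) \<le> K * norm (a - b)"
    by (rule field_differentiable_bound[of UNIV c dc K])
      (use dc_le c_deriv in auto)
  then show ?thesis by simp
qed

text \<open>A Taylor remainder of second order from a Lipschitz derivative: on the segment,
  \<open>c r - dc a * r\<close> has derivative at most \<open>K * \<bar>b - a\<bar>\<close>.\<close>

lemma c_quad: "\<bar>c b - c a - dc a * (b - a)\<bar> \<le> K * (b - a)\<^sup>2"
proof -
  have "norm ((c b - dc a * b) - (c a - dc a * a)) \<le> (K * \<bar>b - a\<bar>) * norm (b - a)"
  proof (rule field_differentiable_bound[of "closed_segment a b" _ "\<lambda>r. dc r - dc a"])
    fix r assume r: "r \<in> closed_segment a b"
    show "((\<lambda>r. c r - dc a * r) has_field_derivative dc r - dc a) (at r within closed_segment a b)"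
      by (rule DERIV_subset[of _ _ _ UNIV]) (auto intro!: derivative_eq_intros c_deriv)
    have "\<bar>r - a\<bar> \<le> \<bar>b - a\<bar>" using segment_bound1[OF r] by simp
    then show "norm (dc r - dc a) \<le> K * \<bar>b - a\<bar>"
      using dc_lip[of r a] mult_left_mono[of "\<bar>r - a\<bar>" "\<bar>b - a\<bar>" K] K_nonneg by simp
  qed auto
  moreover have "(c b - dc a * b) - (c a - dc a * a) = c b - c a - dc a * (b - a)" by (simp add: algebra_simps)
  moreover have "(K * \<bar>b - a\<bar>) * norm (b - a) = K * (b - a)\<^sup>2"
    by (simp add: power2_eq_square mult.assoc flip: abs_mult)
  ultimately show ?thesis by (metis real_norm_def)
qed

lemma c_cont: "continuous_on A c"
  using c_deriv by (meson DERIV_isCont continuous_at_imp_continuous_on)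

lemma dc_cont: "continuous_on A dc"
  by (rule lipschitz_on_continuous_on[of K])
    (auto simp: lipschitz_on_def dist_real_def dc_lip K_nonneg)

lemma U0_deriv: "(U0 i has_real_derivative DU0 i x) (at x)"
  unfolding has_field_derivative_def has_derivative_at_alt
proof (intro conjI allI impI bounded_linear_mult_right)
  fix e :: real assume "e > 0"
  with U0_unif obtain \<rho> where \<rho>: "\<rho> > 0" "\<And>x d. \<bar>d\<bar> \<le> \<rho> \<Longrightarrow> \<bar>U0 i (x + d) - U0 i x - d * DU0 i x\<bar> \<le> e * \<bar>d\<bar>"
    by blast
  show "\<exists>d>0. \<forall>y. norm (y - x) < d \<longrightarrow> norm (U0 i y - U0 i x - DU0 i x * (y - x)) \<le> e * norm (y - x)"
    using \<rho>(1) \<rho>(2)[of "y - x" x for y] by (intro exI[of _ \<rho>]) (auto simp: mult.commute)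
qed

lemma U0_cont: "continuous_on A (U0 i)"
  using U0_deriv by (meson DERIV_isCont continuous_at_imp_continuous_on)

section \<open>Integral equations for the characteristics and the Riemann invariants\<close>

definition strip :: "(real \<times> real) set" where "strip = {0..\<delta>} \<times> UNIV"

abbreviation simp\<delta> where "simp\<delta> \<equiv> time_simplex \<delta>"

text \<open>At a fixed point of \<open>(FX, FU)\<close>, \<open>X i (s, t, x)\<close> is the position at time \<open>s\<close> of the
  \<open>i\<close>-characteristic through \<open>(t, x)\<close>.\<close>
definition FX :: "(comp \<Rightarrow> real \<times> real \<times> real \<Rightarrow> real) \<Rightarrow> (comp \<Rightarrow> real \<times> real \<Rightarrow> real) \<Rightarrow> comp \<Rightarrow> real \<times> real \<times> real \<Rightarrow> real"
  where "FX X U i = (\<lambda>(s, t, x). x - sg i * integral {s..t} (\<lambda>\<sigma>. c (mid (\<lambda>j. U j (\<sigma>, X i (\<sigma>, t, x))))))"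

definition FU :: "(comp \<Rightarrow> real \<times> real \<times> real \<Rightarrow> real) \<Rightarrow> (comp \<Rightarrow> real \<times> real \<Rightarrow> real) \<Rightarrow> comp \<Rightarrow> real \<times> real \<Rightarrow> real"
  where "FU X U i = (\<lambda>(t, x). U0 i (X i (0, t, x)) + integral {0..t} (\<lambda>\<sigma>. src i (\<lambda>j. U j (\<sigma>, X i (\<sigma>, t, x)))))"

text \<open>Lipschitz bounds, unlike differentiability, pass to uniform limits, so the fixed point
  is at first only Lipschitz in \<open>x\<close>. The constants leave room: with \<open>2\<close>
  for \<open>X\<close>, the data contribute \<open>2 * L0\<close> and the source less than
  \<open>L0\<close> to the constant of \<open>FU\<close>, below the allowed
  \<open>4 * L0\<close>.\<close>

definition adm :: "(comp \<Rightarrow> real \<times> real \<times> real \<Rightarrow> real) \<Rightarrow> (comp \<Rightarrow> real \<times> real \<Rightarrow> real) \<Rightarrow> bool" where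
  "adm X U \<longleftrightarrow> (\<forall>i. continuous_on simp\<delta> (X i)) \<and> (\<forall>i. continuous_on strip (U i)) \<and>
     (\<forall>i. \<forall>p\<in>strip. \<bar>U i p\<bar> \<le> B + 1) \<and>
     (\<forall>i t x y. t \<in> {0..\<delta>} \<longrightarrow> \<bar>U i (t, x) - U i (t, y)\<bar> \<le> 4 * L0 * \<bar>x - y\<bar>) \<and>
     (\<forall>i s t x y. (s, t, x) \<in> simp\<delta> \<longrightarrow> \<bar>X i (s, t, x) - X i (s, t, y)\<bar> \<le> 2 * \<bar>x - y\<bar>)"

lemma admD:
  assumes "adm X U"
  shows "continuous_on simp\<delta> (X i)" "continuous_on strip (U i)"
    "p \<in> strip \<Longrightarrow> \<bar>U i p\<bar> \<le> B + 1"
    "t \<in> {0..\<delta>} \<Longrightarrow> \<bar>U i (t, x) - U i (t, y)\<bar> \<le> 4 * L0 * \<bar>x - y\<bar>"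
    "(s, t, x) \<in> simp\<delta> \<Longrightarrow> \<bar>X i (s, t, x) - X i (s, t, y)\<bar> \<le> 2 * \<bar>x - y\<bar>"
  using assms unfolding adm_def by blast+

lemma mem_simplex: "(s, t, x) \<in> simp\<delta> \<longleftrightarrow> 0 \<le> s \<and> s \<le> t \<and> t \<le> \<delta>"
  by (simp add: time_simplex_def)

lemma mem_strip: "(t, x) \<in> strip \<longleftrightarrow> 0 \<le> t \<and> t \<le> \<delta>"
  by (simp add: strip_def)

lemma along_cont:
  assumes X: "continuous_on simp\<delta> X" and U: "continuous_on strip U"
  shows "continuous_on simp\<delta> (\<lambda>p. U (fst p, X p))"
  by (rule continuous_on_compose2[OF U])
    (auto intro!: continuous_intros X simp: mem_simplex mem_strip)

lemma slice_cont:
  fixes g :: "real \<times> real \<times> real \<Rightarrow> real"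
  assumes g: "continuous_on simp\<delta> g" and "0 \<le> s" "s \<le> t'" "t' \<le> t" "t \<le> \<delta>"
  shows "continuous_on {s..t'} (\<lambda>\<sigma>. g (\<sigma>, t, x))"
  by (rule continuous_on_compose2[OF g]) (use assms in \<open>auto simp: mem_simplex intro!: continuous_intros\<close>)

lemma continuous_on_initial: 
  assumes "continuous_on simp\<delta> g" 
  shows "continuous_on strip (\<lambda>(t, x). g (0, t, x))"
  unfolding case_prod_beta
  by (rule continuous_on_compose2[OF assms]) (auto intro!: continuous_intros simp: mem_simplex mem_strip)

lemma speed_cont:
  assumes "continuous_on simp\<delta> (X i)" "\<And>j. continuous_on strip (U j)"
  shows "continuous_on simp\<delta> (\<lambda>p. c (mid (\<lambda>j. U j (fst p, X i p))))"
  by (rule continuous_on_compose2[OF c_cont[of UNIV]])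
    (auto intro!: continuous_intros along_cont assms)

lemma src_cont:
  assumes "continuous_on simp\<delta> (X i)" "\<And>j. continuous_on strip (U j)"
  shows "continuous_on simp\<delta> (\<lambda>p. src i (\<lambda>j. U j (fst p, X i p)))"
  by (intro continuous_intros along_cont assms)

lemma FX_cont:
  assumes "continuous_on simp\<delta> (X i)" "\<And>j. continuous_on strip (U j)"
  shows "continuous_on simp\<delta> (FX X U i)"
proof -
  have "continuous_on simp\<delta> (\<lambda>p. snd (snd p) - sg i * (case p of (s, t, x) \<Rightarrow> integral {s..t} (\<lambda>\<sigma>. c (mid (\<lambda>j. U j (\<sigma>, X i (\<sigma>, t, x)))))))"
    using continuous_on_integral_time_simplex[OF speed_cont[of X i U, OF assms]]
    by (intro continuous_intros) (simp_all)
  then show ?thesis unfolding FX_def by (simp add: case_prod_beta)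
qed

lemma FU_cont:
  assumes X: "continuous_on simp\<delta> (X i)" and U: "\<And>j. continuous_on strip (U j)"
  shows "continuous_on strip (FU X U i)"
proof -
  have "continuous_on strip (\<lambda>p. U0 i (case p of (t, x) \<Rightarrow> X i (0, t, x)) + (case p of (t, x) \<Rightarrow> integral {0..t} (\<lambda>\<sigma>. src i (\<lambda>j. U j (\<sigma>, X i (\<sigma>, t, x))))))"
    using continuous_on_initial[OF continuous_on_integral_time_simplex[OF src_cont[of X i U, OF assms]]] continuous_on_initial[OF X]
    by (intro continuous_intros continuous_on_compose2[OF U0_cont[of UNIV]]) (simp_all)
  then show ?thesis unfolding FU_def by (simp add: case_prod_beta)
qed

lemma along_diff:
  assumes U: "\<And>x y. \<bar>U (t, x) - U (t, y)\<bar> \<le> 4 * L0 * \<bar>x - y\<bar>"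
    and d: "\<bar>x - y\<bar> \<le> d * \<eta>" "\<bar>U (t, y) - U' (t, y)\<bar> \<le> e"
  shows "\<bar>U (t, x) - U' (t, y)\<bar> \<le> d + e"
proof -
  have "4 * L0 * \<bar>x - y\<bar> \<le> 4 * L0 * (d * \<eta>)" using d L0_pos by (intro mult_left_mono) auto
  also have "\<dots> = d" using L0_\<eta> by (simp add: algebra_simps)
  finally show ?thesis using U[of x y] d(2) by linarith
qed

lemma adm_maps:
  assumes "adm X U" shows "adm (FX X U) (FU X U)"
proof -
  note X = admD(1)[OF assms] and U = admD(2)[OF assms] and Ub = admD(3)[OF assms]
    and Ul = admD(4)[OF assms] and Xl = admD(5)[OF assms]
  have UX: "\<bar>U j (\<sigma>, X i (\<sigma>, t, x)) - U j (\<sigma>, X i (\<sigma>, t, y))\<bar> \<le> 8 * L0 * \<bar>x - y\<bar>"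
    if "0 \<le> \<sigma>" "\<sigma> \<le> t" "t \<le> \<delta>" for i j \<sigma> t x y
  proof -
    have "4 * L0 * \<bar>X i (\<sigma>, t, x) - X i (\<sigma>, t, y)\<bar> \<le> 4 * L0 * (2 * \<bar>x - y\<bar>)"
      using Xl[of \<sigma> t x i y] that L0_pos by (intro mult_left_mono) (auto simp: mem_simplex)
    with Ul[of \<sigma> j "X i (\<sigma>, t, x)" "X i (\<sigma>, t, y)"] that show ?thesis by auto
  qed
  have "\<bar>FU X U i p\<bar> \<le> B + 1" if ps: "p \<in> strip" for i p
  proof -
    obtain t x where p: "p = (t, x)" "0 \<le> t" "t \<le> \<delta>" using ps by (cases p) (auto simp: mem_strip)
    have "\<bar>integral {0..t} (\<lambda>\<sigma>. src i (\<lambda>j. U j (\<sigma>, X i (\<sigma>, t, x))))\<bar> \<le> \<delta> * (B + 1)"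
      using p slice_cont[OF src_cont[of X i U, OF X U], of 0 t t x]
      by (intro integral_abs_bound abs_src_le Ub) (auto simp: mem_strip)
    then show ?thesis using U0_le[of i "X i (0, t, x)"] \<delta>3 by (simp add: p FU_def)
  qed
  moreover have "\<bar>FU X U i (t, x) - FU X U i (t, y)\<bar> \<le> 4 * L0 * \<bar>x - y\<bar>" if "t \<in> {0..\<delta>}" for i t x y
  proof -
    have 1: "\<bar>integral {0..t} (\<lambda>\<sigma>. src i (\<lambda>j. U j (\<sigma>, X i (\<sigma>, t, x)))) -
           integral {0..t} (\<lambda>\<sigma>. src i (\<lambda>j. U j (\<sigma>, X i (\<sigma>, t, y))))\<bar> \<le> \<delta> * (8 * L0 * \<bar>x - y\<bar>)"
      using that slice_cont[OF src_cont[of X i U, OF X U], of 0 t t]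
      by (intro integral_diff_bound src_lip UX) (auto simp: mem_strip)
    have 2: "\<delta> * (8 * L0 * \<bar>x - y\<bar>) \<le> 1 / 12 * (8 * L0 * \<bar>x - y\<bar>)"
      using \<delta>1 L0_pos by (intro mult_right_mono) auto
    have 3: "L0 * \<bar>X i (0, t, x) - X i (0, t, y)\<bar> \<le> L0 * (2 * \<bar>x - y\<bar>)"
      using Xl[of 0 t x i y] that L0_pos by (intro mult_left_mono) (auto simp: mem_simplex)
    have 4: "0 \<le> L0 * \<bar>x - y\<bar>" using L0_pos by simp
    show ?thesis unfolding FU_def prod.case
      by (rule add_diff_leI[OF order_trans[OF U0_lip 3] order_trans[OF 1 2]]) (use 4 in simp)
  qed
  moreover have "\<bar>FX X U i (s, t, x) - FX X U i (s, t, y)\<bar> \<le> 2 * \<bar>x - y\<bar>" if st: "(s, t, x) \<in> simp\<delta>" for i s t x y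
  proof -
    have c8: "\<bar>c (mid (\<lambda>j. U j (\<sigma>, X i (\<sigma>, t, x)))) - c (mid (\<lambda>j. U j (\<sigma>, X i (\<sigma>, t, y))))\<bar> \<le> K * (8 * L0 * \<bar>x - y\<bar>)"
      if "\<sigma> \<in> {s..t}" for \<sigma>
    proof -
      have "\<bar>mid (\<lambda>j. U j (\<sigma>, X i (\<sigma>, t, x))) - mid (\<lambda>j. U j (\<sigma>, X i (\<sigma>, t, y)))\<bar> \<le> 8 * L0 * \<bar>x - y\<bar>"
        using that st by (intro mid_lip UX) (auto simp: mem_simplex)
      then show ?thesis by (intro order_trans[OF c_lip] mult_left_mono K_nonneg)
    qed
    have 1: "\<bar>integral {s..t} (\<lambda>\<sigma>. c (mid (\<lambda>j. U j (\<sigma>, X i (\<sigma>, t, x))))) -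
           integral {s..t} (\<lambda>\<sigma>. c (mid (\<lambda>j. U j (\<sigma>, X i (\<sigma>, t, y)))))\<bar> \<le> \<delta> * (K * (8 * L0 * \<bar>x - y\<bar>))"
      using st slice_cont[OF speed_cont[of X i U, OF X U], of s t t] c8
      by (intro integral_diff_bound) (auto simp: mem_simplex)
    have 2: "\<delta> * (K * (8 * L0 * \<bar>x - y\<bar>)) \<le> \<bar>x - y\<bar>"
      using mult_right_mono[OF \<delta>KL, of "8 * \<bar>x - y\<bar>"] by (simp add: algebra_simps)
    show ?thesis unfolding FX_def prod.case by (rule sg_diff_leI[OF order_refl 1]) (use 2 in simp)
  qed
  ultimately show ?thesis
    unfolding adm_def using FX_cont[where X = X and U = U, OF X U] FU_cont[where X = X and U = U, OF X U] by blast
qed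

text \<open>Along the curves the two solutions differ by at most \<open>2 * d\<close>: one
  \<open>d\<close> from the positions through \<open>\<eta>\<close>, one from the values. Time
  integration leaves \<open>d / 3 * \<eta>\<close> for \<open>FX\<close>; for \<open>FU\<close> it
  leaves \<open>d / 6\<close>, to which the initial data add \<open>d / 4\<close>.\<close>

lemma adm_contr:
  assumes XU: "adm X U" and XU': "adm X' U'" and d0: "d \<ge> 0"
    and dX: "\<And>i a. a \<in> simp\<delta> \<Longrightarrow> \<bar>X i a - X' i a\<bar> \<le> d * \<eta>"
    and dU: "\<And>i b. b \<in> strip \<Longrightarrow> \<bar>U i b - U' i b\<bar> \<le> d"
  shows "(\<forall>i. (\<forall>a\<in>simp\<delta>. \<bar>FX X U i a - FX X' U' i a\<bar> \<le> d / 2 * \<eta>) \<and> (\<forall>b\<in>strip. \<bar>FU X U i b - FU X' U' i b\<bar> \<le> d / 2))"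
proof -
  note X = admD(1)[OF XU] and U = admD(2)[OF XU] and Ul = admD(4)[OF XU]
    and X' = admD(1)[OF XU'] and U' = admD(2)[OF XU']
  have al: "\<bar>U j (\<sigma>, X i (\<sigma>, t, x)) - U' j (\<sigma>, X' i (\<sigma>, t, x))\<bar> \<le> d + d"
    if "0 \<le> \<sigma>" "\<sigma> \<le> t" "t \<le> \<delta>" for i j \<sigma> t x
    using that by (intro along_diff Ul dX dU) (auto simp: mem_simplex mem_strip)
  have "\<bar>FX X U i (s, t, x) - FX X' U' i (s, t, x)\<bar> \<le> d / 2 * \<eta>" if st: "(s, t, x) \<in> simp\<delta>" for i s t x
  proof -
    have c8: "\<bar>c (mid (\<lambda>j. U j (\<sigma>, X i (\<sigma>, t, x)))) - c (mid (\<lambda>j. U' j (\<sigma>, X' i (\<sigma>, t, x))))\<bar> \<le> K * (d + d)"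
      if "\<sigma> \<in> {s..t}" for \<sigma>
    proof -
      have "\<bar>mid (\<lambda>j. U j (\<sigma>, X i (\<sigma>, t, x))) - mid (\<lambda>j. U' j (\<sigma>, X' i (\<sigma>, t, x)))\<bar> \<le> d + d"
        using that st by (intro mid_lip al) (auto simp: mem_simplex)
      then show ?thesis by (intro order_trans[OF c_lip] mult_left_mono K_nonneg)
    qed
    have 1: "\<bar>integral {s..t} (\<lambda>\<sigma>. c (mid (\<lambda>j. U j (\<sigma>, X i (\<sigma>, t, x))))) -
           integral {s..t} (\<lambda>\<sigma>. c (mid (\<lambda>j. U' j (\<sigma>, X' i (\<sigma>, t, x)))))\<bar> \<le> \<delta> * (K * (d + d))"
      using st slice_cont[OF speed_cont[of X i U, OF X U], of s t t]
        slice_cont[OF speed_cont[of X' i U', OF X' U'], of s t t] c8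
      by (intro integral_diff_bound) (auto simp: mem_simplex)
    have 2: "\<delta> * (K * (d + d)) \<le> d / 3 * \<eta>"
      using mult_right_mono[OF \<delta>K, of "2 * d"] d0 by (simp add: algebra_simps)
    have 3: "d / 3 * \<eta> \<le> d / 2 * \<eta>" using d0 \<eta>_pos by (intro mult_right_mono) auto
    show ?thesis unfolding FX_def prod.case by (rule sg_diff_leI[OF order_refl 1]) (use 2 3 in simp)
  qed
  moreover have "\<bar>FU X U i (t, x) - FU X' U' i (t, x)\<bar> \<le> d / 2" if t: "(t, x) \<in> strip" for i t x
  proof -
    have 1: "\<bar>integral {0..t} (\<lambda>\<sigma>. src i (\<lambda>j. U j (\<sigma>, X i (\<sigma>, t, x)))) -
           integral {0..t} (\<lambda>\<sigma>. src i (\<lambda>j. U' j (\<sigma>, X' i (\<sigma>, t, x))))\<bar> \<le> \<delta> * (d + d)"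
      using t slice_cont[OF src_cont[of X i U, OF X U], of 0 t t]
        slice_cont[OF src_cont[of X' i U', OF X' U'], of 0 t t]
      by (intro integral_diff_bound src_lip al) (auto simp: mem_strip)
    have 2: "\<delta> * (d + d) \<le> 1 / 12 * (d + d)"
      using \<delta>1 d0 by (intro mult_right_mono) auto
    have "L0 * \<bar>X i (0, t, x) - X' i (0, t, x)\<bar> \<le> L0 * (d * \<eta>)"
      using dX[of "(0, t, x)" i] t L0_pos by (intro mult_left_mono) (auto simp: mem_simplex mem_strip)
    also have "\<dots> = d / 4" using L0_\<eta> by (simp add: algebra_simps)
    finally have 3: "L0 * \<bar>X i (0, t, x) - X' i (0, t, x)\<bar> \<le> d / 4" .
    show ?thesis unfolding FU_def prod.case
      by (rule add_diff_leI[OF order_trans[OF U0_lip 3] order_trans[OF 1 2]]) (use d0 in simp)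
  qed
  ultimately show ?thesis by auto
qed

lemma adm_limit:
  assumes P: "\<And>n. adm (Xs n) (Us n)"
    and X: "\<And>i. uniform_limit simp\<delta> (\<lambda>n. Xs n i) (X i) sequentially"
    and U: "\<And>i. uniform_limit strip (\<lambda>n. Us n i) (U i) sequentially"
  shows "adm X U"
  unfolding adm_def
proof (intro conjI allI ballI impI)
  show "continuous_on simp\<delta> (X i)" for i
    by (rule uniform_limit_continuous_on[OF _ X]) (use P adm_def in blast)
  show "continuous_on strip (U i)" for i
    by (rule uniform_limit_continuous_on[OF _ U]) (use P adm_def in blast)
  show "\<bar>U i p\<bar> \<le> B + 1" if "p \<in> strip" for i p
    by (rule uniform_limit_le[OF U that]) (use P that adm_def in blast)
  show "\<bar>U i (t, x) - U i (t, y)\<bar> \<le> 4 * L0 * \<bar>x - y\<bar>" if "t \<in> {0..\<delta>}" for i t x y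
    by (rule uniform_limit_diff_le[OF U]) (use P that in \<open>auto simp: adm_def mem_strip\<close>)
  show "\<bar>X i (s, t, x) - X i (s, t, y)\<bar> \<le> 2 * \<bar>x - y\<bar>" if "(s, t, x) \<in> simp\<delta>" for i s t x y
    by (rule uniform_limit_diff_le[OF X]) (use P that in \<open>auto simp: adm_def mem_simplex\<close>)
qed

lemma adm_init: "adm (\<lambda>i p. snd (snd p)) (\<lambda>i p. U0 i (snd p))"
  unfolding adm_def
proof (intro conjI allI ballI impI)
  show "continuous_on simp\<delta> (\<lambda>p. snd (snd p))" by (intro continuous_intros)
  show "continuous_on strip (\<lambda>p. U0 i (snd p))" for i
    by (intro continuous_intros continuous_on_compose2[OF U0_cont[of UNIV]]) auto
  show "\<bar>U0 i (snd p)\<bar> \<le> B + 1" for i and p :: "real \<times> real" using U0_le[of i "snd p"] by linarith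
  show "\<bar>U0 i (snd (t, x)) - U0 i (snd (t, y))\<bar> \<le> 4 * L0 * \<bar>x - y\<bar>" for i and t :: real and x y
  proof -
    have "0 \<le> L0 * \<bar>x - y\<bar>" using L0_pos by simp
    then show ?thesis using U0_lip[of i x y] by simp
  qed
qed auto

text \<open>Bound for the propagation speed on the range that \<open>adm\<close> permits.\<close>

definition "\<Lambda> = \<bar>c 0\<bar> + K * (B + 1)"

lemma c_le: assumes "\<And>j. \<bar>y j\<bar> \<le> B + 1" shows "\<bar>c (mid y)\<bar> \<le> \<Lambda>"
proof -
  have "K * \<bar>mid y\<bar> \<le> K * (B + 1)" by (intro mult_left_mono K_nonneg abs_mid_le assms)
  with c_lip[of "mid y" 0] show ?thesis by (simp add: \<Lambda>_def)
qed

lemma fixed_point: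
  "\<exists>X U. adm X U \<and> (\<forall>i. (\<forall>a\<in>simp\<delta>. FX X U i a = X i a) \<and> (\<forall>b\<in>strip. FU X U i b = U i b))"
proof (rule pair_contraction[OF \<eta>_pos adm_init _ _ adm_maps adm_limit adm_contr])
  \<comment> \<open>The first summand is the largest first move of \<open>X\<close> in units of
    \<open>\<eta>\<close>; the \<open>1\<close> covers the first move of \<open>U\<close>, which is
    at most \<open>\<delta> * (B + 1)\<close>.\<close>
  let ?C = "\<delta> * \<Lambda> / \<eta> + 1"
  have L: "\<Lambda> \<ge> 0" using B_nonneg K_nonneg by (simp add: \<Lambda>_def)
  show "\<bar>FX (\<lambda>i p. snd (snd p)) (\<lambda>i p. U0 i (snd p)) i a - snd (snd a)\<bar> \<le> ?C * \<eta>" if "a \<in> simp\<delta>" for i a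
  proof -
    obtain s t x where a: "a = (s, t, x)" by (cases a)
    have "\<bar>integral {s..t} (\<lambda>\<sigma>. c (mid (\<lambda>j. U0 j x)))\<bar> \<le> \<delta> * \<Lambda>"
      using that a U0_le by (intro integral_abs_bound c_le) (auto simp: mem_simplex intro: add_increasing2)
    then show ?thesis
      using \<eta>_pos abs_sg_mult_le[of i "integral {s..t} (\<lambda>\<sigma>. c (mid (\<lambda>j. U0 j x)))"]
      by (simp add: FX_def a distrib_right)
  qed
  show "\<bar>FU (\<lambda>i p. snd (snd p)) (\<lambda>i p. U0 i (snd p)) i b - U0 i (snd b)\<bar> \<le> ?C" if "b \<in> strip" for i b
  proof -
    obtain t x where b: "b = (t, x)" by (cases b)
    have "\<bar>integral {0..t} (\<lambda>\<sigma>. src i (\<lambda>j. U0 j x))\<bar> \<le> \<delta> * (B + 1)"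
      using that b U0_le by (intro integral_abs_bound abs_src_le) (auto simp: mem_strip intro: add_increasing2)
    moreover have "0 \<le> \<delta> * \<Lambda> / \<eta>" using \<delta>_pos \<eta>_pos L by simp
    ultimately show ?thesis using \<delta>3 unfolding FU_def b by simp
  qed
  show "strip \<noteq> {}" using \<delta>_pos by (auto simp: strip_def)
qed auto

end

section \<open>The linearised integral equations and the flow property\<close>

locale riemann_fixed = riemann_system +
  fixes X :: "comp \<Rightarrow> real \<times> real \<times> real \<Rightarrow> real" and U :: "comp \<Rightarrow> real \<times> real \<Rightarrow> real"
  assumes XU: "adm X U"
    and X_fix: "\<And>i a. a \<in> simp\<delta> \<Longrightarrow> FX X U i a = X i a"
    and U_fix: "\<And>i b. b \<in> strip \<Longrightarrow> FU X U i b = U i b"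
begin

lemmas X_cont = admD(1)[OF XU]
lemmas U_cont = admD(2)[OF XU]
lemmas U_le = admD(3)[OF XU]
lemmas U_lip = admD(4)[OF XU]
lemmas X_lip = admD(5)[OF XU]

lemma X_eq: "(s, t, x) \<in> simp\<delta> \<Longrightarrow>
    X i (s, t, x) = x - sg i * integral {s..t} (\<lambda>\<sigma>. c (mid (\<lambda>j. U j (\<sigma>, X i (\<sigma>, t, x)))))"
  using X_fix[of "(s, t, x)" i] by (simp add: FX_def)

lemma U_eq: "(t, x) \<in> strip \<Longrightarrow>
    U i (t, x) = U0 i (X i (0, t, x)) + integral {0..t} (\<lambda>\<sigma>. src i (\<lambda>j. U j (\<sigma>, X i (\<sigma>, t, x))))"
  using U_fix[of "(t, x)" i] by (simp add: FU_def)

lemma speed_slice: "0 \<le> s \<Longrightarrow> s \<le> t' \<Longrightarrow> t' \<le> t \<Longrightarrow> t \<le> \<delta> \<Longrightarrow>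
    continuous_on {s..t'} (\<lambda>\<sigma>. c (mid (\<lambda>j. U j (\<sigma>, X i (\<sigma>, t, x)))))"
  using slice_cont[OF speed_cont[where X = X and U = U and i = i, OF X_cont U_cont]] by simp

lemma src_slice: "0 \<le> s \<Longrightarrow> s \<le> t' \<Longrightarrow> t' \<le> t \<Longrightarrow> t \<le> \<delta> \<Longrightarrow>
    continuous_on {s..t'} (\<lambda>\<sigma>. src i (\<lambda>j. U j (\<sigma>, X i (\<sigma>, t, x))))"
  using slice_cont[OF src_cont[where X = X and U = U and i = i, OF X_cont U_cont]] by simp

text \<open>The formal \<open>x\<close>-derivatives of \<open>FX\<close> and \<open>FU\<close>; their fixed point \<open>(P, W)\<close> will turn out to be
  the \<open>x\<close>-derivative of \<open>(X, U)\<close>.\<close>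
definition FP :: "(comp \<Rightarrow> real \<times> real \<times> real \<Rightarrow> real) \<Rightarrow> (comp \<Rightarrow> real \<times> real \<Rightarrow> real) \<Rightarrow> comp \<Rightarrow> real \<times> real \<times> real \<Rightarrow> real"
  where "FP P W i = (\<lambda>(s, t, x). 1 - sg i * integral {s..t} (\<lambda>\<sigma>. dc (mid (\<lambda>j. U j (\<sigma>, X i (\<sigma>, t, x)))) *
     (mid (\<lambda>j. W j (\<sigma>, X i (\<sigma>, t, x))) * P i (\<sigma>, t, x))))"

definition FW :: "(comp \<Rightarrow> real \<times> real \<times> real \<Rightarrow> real) \<Rightarrow> (comp \<Rightarrow> real \<times> real \<Rightarrow> real) \<Rightarrow> comp \<Rightarrow> real \<times> real \<Rightarrow> real"
  where "FW P W i = (\<lambda>(t, x). DU0 i (X i (0, t, x)) * P i (0, t, x) +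
     integral {0..t} (\<lambda>\<sigma>. src i (\<lambda>j. W j (\<sigma>, X i (\<sigma>, t, x))) * P i (\<sigma>, t, x)))"

text \<open>The bounds are the Lipschitz constants of \<open>adm\<close>, as they must be for
  derivatives. Mere continuity is enough here: \<open>X\<close> and \<open>U\<close> are frozen, so
  two candidates are always compared at the same position.\<close>

definition adm' :: "(comp \<Rightarrow> real \<times> real \<times> real \<Rightarrow> real) \<Rightarrow> (comp \<Rightarrow> real \<times> real \<Rightarrow> real) \<Rightarrow> bool" where
  "adm' P W \<longleftrightarrow> (\<forall>i. continuous_on simp\<delta> (P i)) \<and> (\<forall>i. continuous_on strip (W i)) \<and>
     (\<forall>i. \<forall>p\<in>simp\<delta>. \<bar>P i p\<bar> \<le> 2) \<and> (\<forall>i. \<forall>p\<in>strip. \<bar>W i p\<bar> \<le> 4 * L0)"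

lemma adm'D:
  assumes "adm' P W"
  shows "continuous_on simp\<delta> (P i)" "continuous_on strip (W i)"
    "a \<in> simp\<delta> \<Longrightarrow> \<bar>P i a\<bar> \<le> 2" "p \<in> strip \<Longrightarrow> \<bar>W i p\<bar> \<le> 4 * L0"
  using assms unfolding adm'_def by blast+

lemma P_int_cont:
  assumes "continuous_on simp\<delta> (P i)" "\<And>j. continuous_on strip (W j)"
  shows "continuous_on simp\<delta> (\<lambda>p. dc (mid (\<lambda>j. U j (fst p, X i p))) * (mid (\<lambda>j. W j (fst p, X i p)) * P i p))"
  by (intro continuous_intros continuous_on_compose2[OF dc_cont[of UNIV]] along_cont X_cont U_cont assms) auto

lemma W_int_cont:
  assumes "continuous_on simp\<delta> (P i)" "\<And>j. continuous_on strip (W j)"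
  shows "continuous_on simp\<delta> (\<lambda>p. src i (\<lambda>j. W j (fst p, X i p)) * P i p)"
  by (intro continuous_intros along_cont X_cont assms)

lemma P_slice:
  assumes "adm' P W" "0 \<le> s" "s \<le> t" "t \<le> \<delta>"
  shows "continuous_on {s..t} (\<lambda>\<sigma>. dc (mid (\<lambda>j. U j (\<sigma>, X i (\<sigma>, t, x)))) * (mid (\<lambda>j. W j (\<sigma>, X i (\<sigma>, t, x))) * P i (\<sigma>, t, x)))"
  using slice_cont[OF P_int_cont[where P = P and W = W and i = i, OF adm'D(1,2)[OF assms(1)]], of s t t x] assms by simp

lemma W_slice:
  assumes "adm' P W" "0 \<le> s" "s \<le> t" "t \<le> \<delta>"
  shows "continuous_on {s..t} (\<lambda>\<sigma>. src i (\<lambda>j. W j (\<sigma>, X i (\<sigma>, t, x))) * P i (\<sigma>, t, x))"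
  using slice_cont[OF W_int_cont[where P = P and W = W and i = i, OF adm'D(1,2)[OF assms(1)]], of s t t x] assms by simp

lemma FP_cont:
  assumes "continuous_on simp\<delta> (P i)" "\<And>j. continuous_on strip (W j)"
  shows "continuous_on simp\<delta> (FP P W i)"
proof -
  have "continuous_on simp\<delta> (\<lambda>p. 1 - sg i * (case p of (s, t, x) \<Rightarrow> integral {s..t} (\<lambda>\<sigma>. dc (mid (\<lambda>j. U j (\<sigma>, X i (\<sigma>, t, x)))) *
     (mid (\<lambda>j. W j (\<sigma>, X i (\<sigma>, t, x))) * P i (\<sigma>, t, x)))))"
    using continuous_on_integral_time_simplex[OF P_int_cont[where P = P and W = W and i = i, OF assms]]
    by (intro continuous_intros) simp_all
  then show ?thesis unfolding FP_def by (simp add: case_prod_beta)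
qed

lemma FW_cont:
  assumes P: "continuous_on simp\<delta> (P i)" and W: "\<And>j. continuous_on strip (W j)"
  shows "continuous_on strip (FW P W i)"
proof -
  have "continuous_on strip (\<lambda>p. DU0 i (case p of (t, x) \<Rightarrow> X i (0, t, x)) * (case p of (t, x) \<Rightarrow> P i (0, t, x)) + (case p of (t, x) \<Rightarrow> integral {0..t} (\<lambda>\<sigma>. src i (\<lambda>j. W j (\<sigma>, X i (\<sigma>, t, x))) * P i (\<sigma>, t, x))))"
    using continuous_on_initial[OF continuous_on_integral_time_simplex[OF W_int_cont[where P = P and W = W and i = i, OF assms]]] continuous_on_initial[OF X_cont] continuous_on_initial[OF P]
    by (intro continuous_intros continuous_on_compose2[OF DU0_cont]) simp_all
  then show ?thesis unfolding FW_def by (simp add: case_prod_beta)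
qed

lemma mult_bound: "\<bar>a\<bar> \<le> A \<Longrightarrow> \<bar>b\<bar> \<le> C \<Longrightarrow> \<bar>a * b\<bar> \<le> A * C" for a b A C :: real
  unfolding abs_mult by (intro mult_mono) auto

lemma mult_diff_bound:
  fixes m p m' p' :: real
  assumes "\<bar>m\<bar> \<le> M" "\<bar>p'\<bar> \<le> Q" "\<bar>p - p'\<bar> \<le> d" "\<bar>m - m'\<bar> \<le> e"
  shows "\<bar>m * p - m' * p'\<bar> \<le> M * d + e * Q"
proof -
  have "m * p - m' * p' = m * (p - p') + (m - m') * p'" by (simp add: algebra_simps)
  then show ?thesis
    using mult_bound[OF assms(1,3)] mult_bound[OF assms(4,2)] by linarith
qed

lemma in_strip: "0 \<le> \<sigma> \<Longrightarrow> \<sigma> \<le> t \<Longrightarrow> t \<le> \<delta> \<Longrightarrow> (\<sigma>, y) \<in> strip" by (simp add: mem_strip)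

lemma in_simp: "0 \<le> \<sigma> \<Longrightarrow> \<sigma> \<le> t \<Longrightarrow> t \<le> \<delta> \<Longrightarrow> (\<sigma>, t, y) \<in> simp\<delta>" by (simp add: mem_simplex)

lemma adm'_maps:
  assumes PW: "adm' P W" shows "adm' (FP P W) (FW P W)"
proof -
  have "\<bar>FP P W i a\<bar> \<le> 2" if a: "a \<in> simp\<delta>" for i a
  proof -
    obtain s t x where st: "a = (s, t, x)" "0 \<le> s" "s \<le> t" "t \<le> \<delta>" using a by (cases a) (auto simp: mem_simplex)
    have "\<bar>integral {s..t} (\<lambda>\<sigma>. dc (mid (\<lambda>j. U j (\<sigma>, X i (\<sigma>, t, x)))) *
     (mid (\<lambda>j. W j (\<sigma>, X i (\<sigma>, t, x))) * P i (\<sigma>, t, x)))\<bar> \<le> \<delta> * (K * (4 * L0 * 2))"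
      using st by (intro integral_abs_bound P_slice PW mult_bound dc_le abs_mid_le adm'D(3,4)[OF PW] in_strip in_simp) auto
    also have "\<dots> \<le> 1" using \<delta>KL by (simp add: algebra_simps)
    finally show ?thesis
      using abs_sg_mult_le[of i "integral {s..t} (\<lambda>\<sigma>. dc (mid (\<lambda>j. U j (\<sigma>, X i (\<sigma>, t, x)))) *
     (mid (\<lambda>j. W j (\<sigma>, X i (\<sigma>, t, x))) * P i (\<sigma>, t, x)))"] unfolding FP_def st prod.case by linarith
  qed
  moreover have "\<bar>FW P W i p\<bar> \<le> 4 * L0" if p: "p \<in> strip" for i p
  proof -
    obtain t x where st: "p = (t, x)" "0 \<le> t" "t \<le> \<delta>" using p by (cases p) (auto simp: mem_strip)
    have 1: "\<bar>integral {0..t} (\<lambda>\<sigma>. src i (\<lambda>j. W j (\<sigma>, X i (\<sigma>, t, x))) * P i (\<sigma>, t, x))\<bar> \<le> \<delta> * (4 * L0 * 2)"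
      using st by (intro integral_abs_bound W_slice PW mult_bound abs_src_le adm'D(3,4)[OF PW] in_strip in_simp) auto
    have 2: "\<delta> * (4 * L0 * 2) \<le> 1 / 12 * (4 * L0 * 2)" using \<delta>1 L0_pos by (intro mult_right_mono) auto
    have 3: "\<bar>DU0 i (X i (0, t, x)) * P i (0, t, x)\<bar> \<le> L0 * 2"
      using st by (intro mult_bound DU0_le adm'D(3)[OF PW] in_simp) auto
    show ?thesis using 1 2 3 L0_pos unfolding FW_def st prod.case by linarith
  qed
  ultimately show ?thesis
    unfolding adm'_def
    using FP_cont[where P = P and W = W, OF adm'D(1,2)[OF PW]] FW_cont[where P = P and W = W, OF adm'D(1,2)[OF PW]] by blast
qed

lemma along_error_sum: "4 * L0 * (d * \<eta>) + d * 2 = 3 * d"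
  using L0_\<eta> by (simp add: algebra_simps)

lemma \<delta>K3: assumes "d \<ge> 0" shows "\<delta> * (K * (3 * d)) \<le> d / 2 * \<eta>"
  using mult_right_mono[OF \<delta>K, of "3 * d"] assms by (simp add: algebra_simps)

text \<open>Origin of the constants 12 and 24 in the conditions on \<open>\<delta>\<close>. A
  product along the curve changes by \<open>4 * L0 * (d * \<eta>) + d * 2 = 3 * d\<close>; then
  \<open>\<delta> * K \<le> \<eta> / 6\<close> gives exactly \<open>d / 2 * \<eta>\<close>, and
  \<open>\<delta> \<le> 1 / 12\<close> gives \<open>d / 4\<close>, which together with
  \<open>d / 4\<close> from the data is exactly \<open>d / 2\<close>.\<close>

lemma adm'_contr:
  assumes PW: "adm' P W" and PW': "adm' P' W'" and d0: "d \<ge> 0"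
    and dP: "\<And>i a. a \<in> simp\<delta> \<Longrightarrow> \<bar>P i a - P' i a\<bar> \<le> d * \<eta>"
    and dW: "\<And>i b. b \<in> strip \<Longrightarrow> \<bar>W i b - W' i b\<bar> \<le> d"
  shows "(\<forall>i. (\<forall>a\<in>simp\<delta>. \<bar>FP P W i a - FP P' W' i a\<bar> \<le> d / 2 * \<eta>) \<and> (\<forall>b\<in>strip. \<bar>FW P W i b - FW P' W' i b\<bar> \<le> d / 2))"
proof -
  have "\<bar>FP P W i a - FP P' W' i a\<bar> \<le> d / 2 * \<eta>" if a: "a \<in> simp\<delta>" for i a
  proof -
    obtain s t x where st: "a = (s, t, x)" "0 \<le> s" "s \<le> t" "t \<le> \<delta>" using a by (cases a) (auto simp: mem_simplex)
    have "\<bar>(mid (\<lambda>j. W j (\<sigma>, X i (\<sigma>, t, x))) * P i (\<sigma>, t, x)) - (mid (\<lambda>j. W' j (\<sigma>, X i (\<sigma>, t, x))) * P' i (\<sigma>, t, x))\<bar> \<le> 3 * d"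
      if "\<sigma> \<in> {s..t}" for \<sigma>
      unfolding along_error_sum[symmetric] using st that
      by (intro mult_diff_bound mid_lip abs_mid_le adm'D(4)[OF PW] adm'D(3)[OF PW'] in_strip in_simp dP dW) auto
    then have "\<bar>dc (mid (\<lambda>j. U j (\<sigma>, X i (\<sigma>, t, x)))) * (mid (\<lambda>j. W j (\<sigma>, X i (\<sigma>, t, x))) * P i (\<sigma>, t, x)) -
       dc (mid (\<lambda>j. U j (\<sigma>, X i (\<sigma>, t, x)))) * (mid (\<lambda>j. W' j (\<sigma>, X i (\<sigma>, t, x))) * P' i (\<sigma>, t, x))\<bar> \<le> K * (3 * d)"
      if "\<sigma> \<in> {s..t}" for \<sigma>
      unfolding right_diff_distrib[symmetric] using that by (intro mult_bound dc_le)
    then have 1: "\<bar>integral {s..t} (\<lambda>\<sigma>. dc (mid (\<lambda>j. U j (\<sigma>, X i (\<sigma>, t, x)))) * (mid (\<lambda>j. W j (\<sigma>, X i (\<sigma>, t, x))) * P i (\<sigma>, t, x))) -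
       integral {s..t} (\<lambda>\<sigma>. dc (mid (\<lambda>j. U j (\<sigma>, X i (\<sigma>, t, x)))) * (mid (\<lambda>j. W' j (\<sigma>, X i (\<sigma>, t, x))) * P' i (\<sigma>, t, x)))\<bar> \<le> \<delta> * (K * (3 * d))"
      using st by (intro integral_diff_bound P_slice PW PW') auto
    show ?thesis unfolding FP_def st prod.case by (rule sg_diff_leI[OF order_refl 1]) (use \<delta>K3[OF d0] in simp)
  qed
  moreover have "\<bar>FW P W i p - FW P' W' i p\<bar> \<le> d / 2" if p: "p \<in> strip" for i p
  proof -
    obtain t x where st: "p = (t, x)" "0 \<le> t" "t \<le> \<delta>" using p by (cases p) (auto simp: mem_strip)
    have "\<bar>(src i (\<lambda>j. W j (\<sigma>, X i (\<sigma>, t, x))) * P i (\<sigma>, t, x)) - (src i (\<lambda>j. W' j (\<sigma>, X i (\<sigma>, t, x))) * P' i (\<sigma>, t, x))\<bar> \<le> 3 * d"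
      if "\<sigma> \<in> {0..t}" for \<sigma>
      unfolding along_error_sum[symmetric] using st that
      by (intro mult_diff_bound src_lip abs_src_le adm'D(4)[OF PW] adm'D(3)[OF PW'] in_strip in_simp dP dW) auto
    then have 1: "\<bar>integral {0..t} (\<lambda>\<sigma>. src i (\<lambda>j. W j (\<sigma>, X i (\<sigma>, t, x))) * P i (\<sigma>, t, x)) -
       integral {0..t} (\<lambda>\<sigma>. src i (\<lambda>j. W' j (\<sigma>, X i (\<sigma>, t, x))) * P' i (\<sigma>, t, x))\<bar> \<le> \<delta> * (3 * d)"
      using st by (intro integral_diff_bound W_slice PW PW') auto
    have 2: "\<delta> * (3 * d) \<le> 1 / 12 * (3 * d)" using \<delta>1 d0 by (intro mult_right_mono) auto
    have 3: "\<bar>DU0 i (X i (0, t, x)) * P i (0, t, x) - DU0 i (X i (0, t, x)) * P' i (0, t, x)\<bar> \<le> L0 * (d * \<eta>)"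
      unfolding right_diff_distrib[symmetric] using st by (intro mult_bound DU0_le dP in_simp) auto
    have 4: "L0 * (d * \<eta>) = d / 4" using L0_\<eta> by (simp add: algebra_simps)
    show ?thesis unfolding FW_def st prod.case
      by (rule add_diff_leI[OF 3 order_trans[OF 1 2]]) (unfold 4, simp)
  qed
  ultimately show ?thesis by blast
qed

lemma adm'_limit:
  assumes P: "\<And>n. adm' (Xs n) (Us n)"
    and X: "\<And>i. uniform_limit simp\<delta> (\<lambda>n. Xs n i) (X' i) sequentially"
    and U: "\<And>i. uniform_limit strip (\<lambda>n. Us n i) (U' i) sequentially"
  shows "adm' X' U'"
  unfolding adm'_def
proof (intro conjI allI ballI impI)
  show "continuous_on simp\<delta> (X' i)" for i
    by (rule uniform_limit_continuous_on[OF _ X]) (use P adm'_def in blast)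
  show "continuous_on strip (U' i)" for i
    by (rule uniform_limit_continuous_on[OF _ U]) (use P adm'_def in blast)
  show "\<bar>U' i p\<bar> \<le> 4 * L0" if "p \<in> strip" for i p
    by (rule uniform_limit_le[OF U that]) (use P that adm'_def in blast)
  show "\<bar>X' i p\<bar> \<le> 2" if "p \<in> simp\<delta>" for i p
    by (rule uniform_limit_le[OF X that]) (use P that adm'_def in blast)
qed

lemma fixed_point':
  "\<exists>P W. adm' P W \<and> (\<forall>i. (\<forall>a\<in>simp\<delta>. FP P W i a = P i a) \<and> (\<forall>b\<in>strip. FW P W i b = W i b))"
proof (rule pair_contraction[where P = adm' and F = FP and G = FW and C = L0 and ?X0.0 = "\<lambda>i p. 1" and ?U0.0 = "\<lambda>i p. 0",
      OF \<eta>_pos _ _ _ adm'_maps adm'_limit adm'_contr])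
  show "adm' (\<lambda>i p. 1) (\<lambda>i p. 0)" using L0_pos by (simp add: adm'_def)
  have src0: "src i (\<lambda>j. 0) = 0" for i by (cases i) auto
  show "\<bar>FP (\<lambda>i p. 1) (\<lambda>i p. 0) i a - 1\<bar> \<le> L0 * \<eta>" if "a \<in> simp\<delta>" for i a
    using L0_\<eta> by (cases a) (simp add: FP_def mid_def)
  show "\<bar>FW (\<lambda>i p. 1) (\<lambda>i p. 0) i b - 0\<bar> \<le> L0" if "b \<in> strip" for i b
    using DU0_le by (cases b) (simp add: FW_def src0)
  show "strip \<noteq> {}" using \<delta>_pos by (auto simp: strip_def)
qed auto

text \<open>Both sides solve the same backward integral equation from the same position at time
  \<open>r\<close>. At a maximum of their distance \<open>e\<close> the equation gives
  \<open>e \<le> e / 6\<close>, hence \<open>e = 0\<close>.\<close>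

lemma X_flow:
  assumes "0 \<le> \<sigma>" "\<sigma> \<le> r" "r \<le> t" "t \<le> \<delta>"
  shows "X i (\<sigma>, r, X i (r, t, x)) = X i (\<sigma>, t, x)"
proof -
  define y where "y = X i (r, t, x)"
  define e where "e \<tau> = \<bar>X i (\<tau>, r, y) - X i (\<tau>, t, x)\<bar>" for \<tau>
  have "continuous_on {0..r} e" unfolding e_def
    using assms slice_cont[OF X_cont, of 0 r r i y] slice_cont[OF X_cont, of 0 r t i x] by (intro continuous_intros) auto
  moreover have "{0..r} \<noteq> {}" using assms by auto
  ultimately obtain \<tau>0 where \<tau>0: "\<tau>0 \<in> {0..r}" "\<And>\<tau>. \<tau> \<in> {0..r} \<Longrightarrow> e \<tau> \<le> e \<tau>0"
    using continuous_attains_sup[of "{0..r}" e] by auto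
  let ?f = "\<lambda>\<tau>. c (mid (\<lambda>j. U j (\<tau>, X i (\<tau>, t, x))))"
  have "integral {\<tau>0..r} ?f + integral {r..t} ?f = integral {\<tau>0..t} ?f"
    using \<tau>0(1) assms by (intro Henstock_Kurzweil_Integration.integral_combine integrable_continuous_real speed_slice) auto
  then have "sg i * integral {\<tau>0..t} ?f = sg i * integral {\<tau>0..r} ?f + sg i * integral {r..t} ?f"
    by (simp flip: distrib_left)
  then have 1: "X i (\<tau>0, t, x) = y - sg i * integral {\<tau>0..r} ?f"
    using X_eq[of \<tau>0 t x i] X_eq[of r t x i] \<tau>0(1) assms by (simp add: in_simp y_def)
  have 2: "X i (\<tau>0, r, y) = y - sg i * integral {\<tau>0..r} (\<lambda>\<tau>. c (mid (\<lambda>j. U j (\<tau>, X i (\<tau>, r, y)))))"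
    using X_eq[of \<tau>0 r y i] \<tau>0(1) assms by (simp add: in_simp)
  have cb: "\<bar>c (mid (\<lambda>j. U j (\<tau>, X i (\<tau>, r, y)))) - ?f \<tau>\<bar> \<le> K * (4 * L0 * e \<tau>0)" if "\<tau> \<in> {\<tau>0..r}" for \<tau>
  proof -
    have "\<bar>mid (\<lambda>j. U j (\<tau>, X i (\<tau>, r, y))) - mid (\<lambda>j. U j (\<tau>, X i (\<tau>, t, x)))\<bar> \<le> 4 * L0 * e \<tau>"
      unfolding e_def using that \<tau>0(1) assms by (intro mid_lip U_lip) auto
    also have "\<dots> \<le> 4 * L0 * e \<tau>0" using \<tau>0 that L0_pos by (intro mult_left_mono) auto
    finally show ?thesis by (intro order_trans[OF c_lip] mult_left_mono K_nonneg)
  qed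
  have "\<bar>integral {\<tau>0..r} (\<lambda>\<tau>. c (mid (\<lambda>j. U j (\<tau>, X i (\<tau>, r, y))))) - integral {\<tau>0..r} ?f\<bar> \<le> \<delta> * (K * (4 * L0 * e \<tau>0))"
    using \<tau>0(1) assms by (intro integral_diff_bound speed_slice cb) auto
  from sg_diff_leI[where i = i and x = y and y = y, OF order_refl this order_refl]
  have 3: "e \<tau>0 \<le> \<delta> * (K * (4 * L0 * e \<tau>0))" unfolding e_def 1 2 by simp
  have "e \<tau>0 \<ge> 0" by (simp add: e_def)
  with 3 mult_right_mono[OF \<delta>KL, of "4 * e \<tau>0"] have "e \<tau>0 = 0" by (simp add: algebra_simps)
  with \<tau>0(2)[of \<sigma>] assms have "e \<sigma> \<le> 0" by auto
  then show ?thesis by (simp add: e_def y_def)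
qed

text \<open>Restarts the integral equation at an intermediate time. The defining equation refers to
  time 0 only, while a time derivative needs short increments.\<close>

lemma U_semigroup:
  assumes "0 \<le> r" "r \<le> t" "t \<le> \<delta>"
  shows "U i (t, x) = U i (r, X i (r, t, x)) + integral {r..t} (\<lambda>\<sigma>. src i (\<lambda>j. U j (\<sigma>, X i (\<sigma>, t, x))))"
proof -
  let ?f = "\<lambda>\<sigma>. src i (\<lambda>j. U j (\<sigma>, X i (\<sigma>, t, x)))"
  have 1: "integral {0..r} ?f + integral {r..t} ?f = integral {0..t} ?f"
    using assms by (intro Henstock_Kurzweil_Integration.integral_combine integrable_continuous_real src_slice) auto
  have "integral {0..r} (\<lambda>\<sigma>. src i (\<lambda>j. U j (\<sigma>, X i (\<sigma>, r, X i (r, t, x))))) = integral {0..r} ?f"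
    using assms by (intro integral_cong) (simp add: X_flow)
  with 1 show ?thesis
    using U_eq[of t x i] U_eq[of r "X i (r, t, x)" i] X_flow[of 0 r t i x] assms by (simp add: mem_strip)
qed

lemma X_speed:
  assumes "0 \<le> s" "s \<le> t" "t \<le> \<delta>" shows "\<bar>X i (s, t, x) - x\<bar> \<le> \<Lambda> * (t - s)"
proof -
  have "\<bar>integral {s..t} (\<lambda>\<sigma>. c (mid (\<lambda>j. U j (\<sigma>, X i (\<sigma>, t, x)))))\<bar> \<le> (t - s) * \<Lambda>"
    using assms by (intro integral_abs_bound speed_slice c_le U_le in_strip) auto
  then show ?thesis
    using abs_sg_mult_le[of i "integral {s..t} (\<lambda>\<sigma>. c (mid (\<lambda>j. U j (\<sigma>, X i (\<sigma>, t, x)))))"] X_eq[of s t x i] assms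
    by (simp add: in_simp mult.commute)
qed

lemma \<Lambda>_nonneg: "\<Lambda> \<ge> 0" using B_nonneg K_nonneg by (simp add: \<Lambda>_def)

text \<open>Small displacement of the foot point plus a small source integral. This keeps the
  solution in the range where the extended speed is the true one.\<close>

lemma U_close:
  assumes "(t, x) \<in> strip" shows "\<bar>U i (t, x) - U0 i x\<bar> \<le> (L0 * \<Lambda> + B + 1) * \<delta>"
proof -
  have t: "0 \<le> t" "t \<le> \<delta>" using assms by (auto simp: mem_strip)
  have 1: "\<bar>integral {0..t} (\<lambda>\<sigma>. src i (\<lambda>j. U j (\<sigma>, X i (\<sigma>, t, x))))\<bar> \<le> \<delta> * (B + 1)"
    using t by (intro integral_abs_bound src_slice abs_src_le U_le in_strip) auto
  have "\<Lambda> * (t - 0) \<le> \<Lambda> * \<delta>" using t \<Lambda>_nonneg by (intro mult_left_mono) auto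
  then have "\<bar>X i (0, t, x) - x\<bar> \<le> \<Lambda> * \<delta>" using X_speed[of 0 t i x] t by linarith
  then have "L0 * \<bar>X i (0, t, x) - x\<bar> \<le> L0 * (\<Lambda> * \<delta>)" using L0_pos by (intro mult_left_mono) auto
  with U0_lip[of i "X i (0, t, x)" x] have 2: "\<bar>U0 i (X i (0, t, x)) - U0 i x\<bar> \<le> L0 * (\<Lambda> * \<delta>)" by linarith
  have "(L0 * \<Lambda> + B + 1) * \<delta> = L0 * (\<Lambda> * \<delta>) + \<delta> * (B + 1)" by (simp add: algebra_simps)
  then show ?thesis using 1 2 U_eq[OF assms, of i] by linarith
qed

lemma U_init: "U i (0, x) = U0 i x"
  using U_eq[of 0 x i] X_eq[of 0 0 x i] \<delta>_pos by (simp add: mem_strip in_simp)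

end

section \<open>Differentiability of the fixed point in space and time\<close>

locale riemann_diff = riemann_fixed +
  fixes P :: "comp \<Rightarrow> real \<times> real \<times> real \<Rightarrow> real" and W :: "comp \<Rightarrow> real \<times> real \<Rightarrow> real"
  assumes PW: "adm' P W"
    and P_fix: "\<And>i a. a \<in> simp\<delta> \<Longrightarrow> FP P W i a = P i a"
    and W_fix: "\<And>i b. b \<in> strip \<Longrightarrow> FW P W i b = W i b"
begin

lemmas P_le = adm'D(3)[OF PW]
lemmas W_cont = adm'D(2)[OF PW]
lemmas W_le = adm'D(4)[OF PW]

lemma P_eq: "(s, t, x) \<in> simp\<delta> \<Longrightarrow>
    P i (s, t, x) = 1 - sg i * integral {s..t} (\<lambda>\<sigma>. dc (mid (\<lambda>j. U j (\<sigma>, X i (\<sigma>, t, x)))) *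
     (mid (\<lambda>j. W j (\<sigma>, X i (\<sigma>, t, x))) * P i (\<sigma>, t, x)))"
  using P_fix[of "(s, t, x)" i] by (simp add: FP_def)

lemma W_eq: "(t, x) \<in> strip \<Longrightarrow>
    W i (t, x) = DU0 i (X i (0, t, x)) * P i (0, t, x) + integral {0..t} (\<lambda>\<sigma>. src i (\<lambda>j. W j (\<sigma>, X i (\<sigma>, t, x))) * P i (\<sigma>, t, x))"
  using W_fix[of "(t, x)" i] by (simp add: FW_def)

text \<open>\<open>k\<close> bounds the defect of the difference quotients. The integral equations improve \<open>k\<close> to
  \<open>k / 2 + \<nu>\<close> for smaller increments, so the infimum of the good \<open>k\<close> is \<open>0\<close>.\<close>
definition good_at :: "real \<Rightarrow> real \<Rightarrow> bool" where
  "good_at k e \<longleftrightarrow> (\<forall>i. (\<forall>s t x. (s, t, x) \<in> simp\<delta> \<longrightarrow> \<bar>X i (s, t, x + e) - X i (s, t, x) - e * P i (s, t, x)\<bar> \<le> k * \<eta> * \<bar>e\<bar>) \<and>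
     (\<forall>t x. (t, x) \<in> strip \<longrightarrow> \<bar>U i (t, x + e) - U i (t, x) - e * W i (t, x)\<bar> \<le> k * \<bar>e\<bar>))"

definition good :: "real \<Rightarrow> bool" where
  "good k \<longleftrightarrow> (\<exists>\<rho>>0. \<forall>e. \<bar>e\<bar> \<le> \<rho> \<longrightarrow> good_at k e)"

text \<open>The Lipschitz bounds of \<open>(X, U)\<close> and the sup bounds of
  \<open>(P, W)\<close> already give a finite defect for all increments; the constant is
  generous.\<close>

lemma good_start: "good (16 * L0 + 8 * L0)"
proof -
  have "good_at (16 * L0 + 8 * L0) e" for e
    unfolding good_at_def
  proof (intro allI conjI impI)
    fix i s t x assume st: "(s, t, x) \<in> simp\<delta>"
    have "\<bar>e * P i (s, t, x)\<bar> \<le> \<bar>e\<bar> * 2" using st by (intro mult_bound P_le) auto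
    moreover have "\<bar>X i (s, t, x + e) - X i (s, t, x)\<bar> \<le> 2 * \<bar>e\<bar>" using X_lip[OF st, of i] X_lip[of s t "x + e" i x] st by (simp add: mem_simplex)
    moreover have "(16 * L0 + 8 * L0) * \<eta> * \<bar>e\<bar> = 6 * \<bar>e\<bar>" using L0_\<eta> by (simp add: algebra_simps)
    ultimately show "\<bar>X i (s, t, x + e) - X i (s, t, x) - e * P i (s, t, x)\<bar> \<le> (16 * L0 + 8 * L0) * \<eta> * \<bar>e\<bar>" by linarith
  next
    fix i t x assume st: "(t, x) \<in> strip"
    have "\<bar>e * W i (t, x)\<bar> \<le> \<bar>e\<bar> * (4 * L0)" using st by (intro mult_bound W_le) auto
    moreover have "\<bar>U i (t, x + e) - U i (t, x)\<bar> \<le> 4 * L0 * \<bar>e\<bar>" using U_lip[of t i "x + e" x] st by (simp add: mem_strip)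
    moreover have "(16 * L0 + 8 * L0) * \<bar>e\<bar> = 4 * L0 * \<bar>e\<bar> + \<bar>e\<bar> * (4 * L0) + 16 * (L0 * \<bar>e\<bar>)" by (simp add: algebra_simps)
    moreover have "0 \<le> L0 * \<bar>e\<bar>" using L0_pos by simp
    ultimately show "\<bar>U i (t, x + e) - U i (t, x) - e * W i (t, x)\<bar> \<le> (16 * L0 + 8 * L0) * \<bar>e\<bar>" by linarith
  qed
  then show ?thesis unfolding good_def by (intro exI[of _ 1]) auto
qed

text \<open>Chain rule with a defect. The displaced point is up to \<open>2 * \<bar>e\<bar>\<close>
  away, hence the radius \<open>\<rho> / 2\<close> and a contribution \<open>2 * k\<close>;
  replacing its displacement by \<open>e * P\<close> costs \<open>k * \<eta> * 4 * L0 = k\<close>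
  more.\<close>

lemma good_along:
  assumes k: "k \<ge> 0" and g: "\<And>e. \<bar>e\<bar> \<le> \<rho> \<Longrightarrow> good_at k e" and e: "\<bar>e\<bar> \<le> \<rho> / 2"
    and st: "0 \<le> \<sigma>" "\<sigma> \<le> t" "t \<le> \<delta>"
  shows "\<bar>U j (\<sigma>, X i (\<sigma>, t, x + e)) - U j (\<sigma>, X i (\<sigma>, t, x)) - e * (W j (\<sigma>, X i (\<sigma>, t, x)) * P i (\<sigma>, t, x))\<bar> \<le> 3 * k * \<bar>e\<bar>"
proof -
  define y where "y = X i (\<sigma>, t, x)"
  define d where "d = X i (\<sigma>, t, x + e) - y"
  have d: "\<bar>d\<bar> \<le> 2 * \<bar>e\<bar>" using X_lip[of \<sigma> t "x + e" i x] in_simp[OF st] by (simp add: d_def y_def)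
  then have "good_at k d" using e by (intro g) linarith
  then have 1: "\<bar>U j (\<sigma>, y + d) - U j (\<sigma>, y) - d * W j (\<sigma>, y)\<bar> \<le> k * \<bar>d\<bar>"
    using in_strip[OF st] by (simp add: good_at_def)
  have 2: "k * \<bar>d\<bar> \<le> k * (2 * \<bar>e\<bar>)" using d k by (intro mult_left_mono)
  have "good_at k e" using e by (intro g) linarith
  then have "\<bar>d - e * P i (\<sigma>, t, x)\<bar> \<le> k * \<eta> * \<bar>e\<bar>"
    using in_simp[OF st] by (simp add: good_at_def d_def y_def)
  then have 3: "\<bar>(d - e * P i (\<sigma>, t, x)) * W j (\<sigma>, y)\<bar> \<le> (k * \<eta> * \<bar>e\<bar>) * (4 * L0)"
    by (intro mult_bound W_le in_strip[OF st])
  have 4: "(k * \<eta> * \<bar>e\<bar>) * (4 * L0) = k * \<bar>e\<bar>" using L0_\<eta> by (simp add: algebra_simps)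
  have 5: "U j (\<sigma>, y + d) - U j (\<sigma>, y) - e * (W j (\<sigma>, y) * P i (\<sigma>, t, x)) =
     (U j (\<sigma>, y + d) - U j (\<sigma>, y) - d * W j (\<sigma>, y)) + (d - e * P i (\<sigma>, t, x)) * W j (\<sigma>, y)"
    by (simp add: algebra_simps)
  have "\<bar>U j (\<sigma>, y + d) - U j (\<sigma>, y) - e * (W j (\<sigma>, y) * P i (\<sigma>, t, x))\<bar> \<le> k * (2 * \<bar>e\<bar>) + k * \<bar>e\<bar>"
    unfolding 5 using 1 2 3 4 by linarith
  moreover have "y + d = X i (\<sigma>, t, x + e)" by (simp add: d_def)
  ultimately show ?thesis by (simp add: y_def)
qed

lemma sg_neg_le: "a = - (sg i * b) \<Longrightarrow> \<bar>b\<bar> \<le> d \<Longrightarrow> \<bar>a\<bar> \<le> d"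
  by (cases i) auto

lemma integral_lin_bound:
  fixes f g h :: "real \<Rightarrow> real"
  assumes "s \<le> t" "t - s \<le> \<delta>" "continuous_on {s..t} f" "continuous_on {s..t} g" "continuous_on {s..t} h"
    and b: "\<And>\<sigma>. \<sigma> \<in> {s..t} \<Longrightarrow> \<bar>f \<sigma> - g \<sigma> - e * h \<sigma>\<bar> \<le> b"
  shows "\<bar>integral {s..t} f - integral {s..t} g - e * integral {s..t} h\<bar> \<le> \<delta> * b"
proof -
  have i: "f integrable_on {s..t}" "g integrable_on {s..t}" "h integrable_on {s..t}"
    using assms by (auto intro: integrable_continuous_real)
  have "integral {s..t} f - integral {s..t} g - e * integral {s..t} h = integral {s..t} (\<lambda>\<sigma>. f \<sigma> - g \<sigma> - e * h \<sigma>)"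
    using i by (simp add: integral_diff integrable_diff integrable_on_mult_right)
  then show ?thesis using assms by (auto intro!: integral_abs_bound continuous_intros)
qed

lemma good_step:
  assumes gk: "good k" and k: "k \<ge> 0" and \<nu>: "\<nu> > 0"
  shows "good (k / 2 + \<nu>)"
proof -
  obtain \<rho> where \<rho>: "\<rho> > 0" "\<And>e. \<bar>e\<bar> \<le> \<rho> \<Longrightarrow> good_at k e" using gk unfolding good_def by blast
  have "\<exists>r>0. \<forall>x d. \<bar>d\<bar> \<le> r \<longrightarrow> \<bar>U0 i (x + d) - U0 i x - d * DU0 i x\<bar> \<le> \<nu> / 2 * \<bar>d\<bar>" for i
    using U0_unif[of "\<nu> / 2" i] \<nu> by simp
  then obtain r where r: "\<And>i. r i > 0" "\<And>i x d. \<bar>d\<bar> \<le> r i \<Longrightarrow> \<bar>U0 i (x + d) - U0 i x - d * DU0 i x\<bar> \<le> \<nu> / 2 * \<bar>d\<bar>"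
    by metis
  \<comment> \<open>\<open>\<rho> / 2\<close> is the radius of \<open>good_along\<close>; the bound
    by \<open>\<nu>\<close> makes the quadratic remainder of \<open>c\<close> small against
    \<open>\<nu>\<close>; the radii \<open>r\<close> are halved because foot points move by up to
    \<open>2 * \<bar>e\<bar>\<close>.\<close>
  define \<rho>' where "\<rho>' = min (min (\<rho> / 2) (\<nu> / (16 * L0\<^sup>2))) (min (r Rp) (min (r Rm) (r Vc)) / 2)"
  have \<rho>': "\<rho>' > 0" using \<rho>(1) \<nu> r(1) L0_pos by (simp add: \<rho>'_def)
  have "good_at (k / 2 + \<nu>) e" if e: "\<bar>e\<bar> \<le> \<rho>'" for e
  proof -
    have e1: "\<bar>e\<bar> \<le> \<rho> / 2" and e2: "\<bar>e\<bar> \<le> \<nu> / (16 * L0\<^sup>2)" using e by (simp_all add: \<rho>'_def)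
    have e3: "2 * \<bar>e\<bar> \<le> r i" for i using e by (cases i) (simp_all add: \<rho>'_def)
    note al = good_along[OF k \<rho>(2) e1]
    show ?thesis unfolding good_at_def
    proof (intro allI conjI impI)
      fix i s t x assume "(s, t, x) \<in> simp\<delta>"
      then have st: "0 \<le> s" "s \<le> t" "t \<le> \<delta>" by (auto simp: mem_simplex)
      let ?m' = "\<lambda>\<sigma>. mid (\<lambda>j. U j (\<sigma>, X i (\<sigma>, t, x + e)))" and ?m = "\<lambda>\<sigma>. mid (\<lambda>j. U j (\<sigma>, X i (\<sigma>, t, x)))"
      let ?h = "\<lambda>\<sigma>. mid (\<lambda>j. W j (\<sigma>, X i (\<sigma>, t, x))) * P i (\<sigma>, t, x)"
      have b: "\<bar>c (?m' \<sigma>) - c (?m \<sigma>) - e * (dc (?m \<sigma>) * ?h \<sigma>)\<bar> \<le> K * (64 * L0\<^sup>2 * \<bar>e\<bar> * \<bar>e\<bar>) + K * (3 * k * \<bar>e\<bar>)"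
        if \<sigma>: "\<sigma> \<in> {s..t}" for \<sigma>
      proof -
        have "\<bar>mid (\<lambda>j. U j (\<sigma>, X i (\<sigma>, t, x + e)) - U j (\<sigma>, X i (\<sigma>, t, x)) - e * (W j (\<sigma>, X i (\<sigma>, t, x)) * P i (\<sigma>, t, x)))\<bar> \<le> 3 * k * \<bar>e\<bar>"
          using \<sigma> st by (intro abs_mid_le al) auto
        moreover have "mid (\<lambda>j. U j (\<sigma>, X i (\<sigma>, t, x + e)) - U j (\<sigma>, X i (\<sigma>, t, x)) - e * (W j (\<sigma>, X i (\<sigma>, t, x)) * P i (\<sigma>, t, x)))
           = (?m' \<sigma> - ?m \<sigma>) - e * ?h \<sigma>"
          by (simp add: mid_def field_simps)
        ultimately have 1: "\<bar>(?m' \<sigma> - ?m \<sigma>) - e * ?h \<sigma>\<bar> \<le> 3 * k * \<bar>e\<bar>" by simp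
        have 2: "\<bar>dc (?m \<sigma>) * ((?m' \<sigma> - ?m \<sigma>) - e * ?h \<sigma>)\<bar> \<le> K * (3 * k * \<bar>e\<bar>)"
          by (intro mult_bound dc_le 1)
        have "\<bar>U j (\<sigma>, X i (\<sigma>, t, x + e)) - U j (\<sigma>, X i (\<sigma>, t, x))\<bar> \<le> 8 * L0 * \<bar>e\<bar>" for j
        proof -
          have "4 * L0 * \<bar>X i (\<sigma>, t, x + e) - X i (\<sigma>, t, x)\<bar> \<le> 4 * L0 * (2 * \<bar>e\<bar>)"
            using X_lip[of \<sigma> t "x + e" i x] \<sigma> st L0_pos by (intro mult_left_mono) (auto simp: mem_simplex)
          with U_lip[of \<sigma> j "X i (\<sigma>, t, x + e)" "X i (\<sigma>, t, x)"] \<sigma> st show ?thesis by auto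
        qed
        then have "\<bar>?m' \<sigma> - ?m \<sigma>\<bar> \<le> 8 * L0 * \<bar>e\<bar>" by (rule mid_lip)
        then have "\<bar>?m' \<sigma> - ?m \<sigma>\<bar>\<^sup>2 \<le> (8 * L0 * \<bar>e\<bar>)\<^sup>2" by (intro power_mono) auto
        then have "K * (?m' \<sigma> - ?m \<sigma>)\<^sup>2 \<le> K * (8 * L0 * \<bar>e\<bar>)\<^sup>2" by (intro mult_left_mono K_nonneg) simp
        also have "(8 * L0 * \<bar>e\<bar>)\<^sup>2 = 64 * L0\<^sup>2 * \<bar>e\<bar> * \<bar>e\<bar>" by (simp add: power2_eq_square)
        finally have 3: "\<bar>c (?m' \<sigma>) - c (?m \<sigma>) - dc (?m \<sigma>) * (?m' \<sigma> - ?m \<sigma>)\<bar> \<le> K * (64 * L0\<^sup>2 * \<bar>e\<bar> * \<bar>e\<bar>)"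
          using c_quad[of "?m' \<sigma>" "?m \<sigma>"] by linarith
        have 4: "c (?m' \<sigma>) - c (?m \<sigma>) - e * (dc (?m \<sigma>) * ?h \<sigma>) =
          (c (?m' \<sigma>) - c (?m \<sigma>) - dc (?m \<sigma>) * (?m' \<sigma> - ?m \<sigma>)) + dc (?m \<sigma>) * ((?m' \<sigma> - ?m \<sigma>) - e * ?h \<sigma>)"
          by (simp add: algebra_simps)
        show ?thesis unfolding 4 using 2 3 by linarith
      qed
      have "\<bar>integral {s..t} (\<lambda>\<sigma>. c (?m' \<sigma>)) - integral {s..t} (\<lambda>\<sigma>. c (?m \<sigma>)) - e * integral {s..t} (\<lambda>\<sigma>. dc (?m \<sigma>) * ?h \<sigma>)\<bar>
         \<le> \<delta> * (K * (64 * L0\<^sup>2 * \<bar>e\<bar> * \<bar>e\<bar>) + K * (3 * k * \<bar>e\<bar>))"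
        using st by (intro integral_lin_bound speed_slice P_slice PW b) auto
      also have "\<dots> = \<delta> * K * (64 * L0\<^sup>2 * \<bar>e\<bar> * \<bar>e\<bar> + 3 * k * \<bar>e\<bar>)" by (simp add: algebra_simps)
      \<comment> \<open>The halving of \<open>k\<close>: the factor \<open>\<eta> / 6\<close> turns
        the defect \<open>3 * k\<close> into \<open>k / 2 * \<eta>\<close>.\<close>
      also have "\<dots> \<le> \<eta> / 6 * (64 * L0\<^sup>2 * \<bar>e\<bar> * \<bar>e\<bar> + 3 * k * \<bar>e\<bar>)"
        using \<delta>K k by (intro mult_right_mono) auto
      also have "\<dots> \<le> \<eta> / 6 * (6 * \<nu> * \<bar>e\<bar> + 3 * k * \<bar>e\<bar>)"
      proof -
        have "16 * L0\<^sup>2 * \<bar>e\<bar> \<le> \<nu>" using e2 L0_pos by (simp add: field_simps)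
        then have "64 * L0\<^sup>2 * \<bar>e\<bar> \<le> 6 * \<nu>" using \<nu> by linarith
        then have "64 * L0\<^sup>2 * \<bar>e\<bar> * \<bar>e\<bar> \<le> 6 * \<nu> * \<bar>e\<bar>" by (rule mult_right_mono) auto
        then show ?thesis using \<eta>_pos by (intro mult_left_mono) auto
      qed
      also have "\<dots> = (k / 2 + \<nu>) * \<eta> * \<bar>e\<bar>" by (simp add: field_simps)
      finally have 5: "\<bar>integral {s..t} (\<lambda>\<sigma>. c (?m' \<sigma>)) - integral {s..t} (\<lambda>\<sigma>. c (?m \<sigma>)) - e * integral {s..t} (\<lambda>\<sigma>. dc (?m \<sigma>) * ?h \<sigma>)\<bar> \<le> (k / 2 + \<nu>) * \<eta> * \<bar>e\<bar>" .
      have "X i (s, t, x + e) - X i (s, t, x) - e * P i (s, t, x) =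
        - (sg i * (integral {s..t} (\<lambda>\<sigma>. c (?m' \<sigma>)) - integral {s..t} (\<lambda>\<sigma>. c (?m \<sigma>)) - e * integral {s..t} (\<lambda>\<sigma>. dc (?m \<sigma>) * ?h \<sigma>)))"
      proof -
        have alg: "X' = x + e - s * A \<Longrightarrow> Y = x - s * B \<Longrightarrow> p = 1 - s * C \<Longrightarrow> X' - Y - e * p = - (s * (A - B - e * C))"
          for X' Y p s A B C :: real by (hypsubst, simp add: algebra_simps)
        show ?thesis by (rule alg[OF X_eq X_eq P_eq]) (use st in \<open>simp_all add: mem_simplex\<close>)
      qed
      then show "\<bar>X i (s, t, x + e) - X i (s, t, x) - e * P i (s, t, x)\<bar> \<le> (k / 2 + \<nu>) * \<eta> * \<bar>e\<bar>"
        using 5 by (rule sg_neg_le)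
    next
      fix i t x assume ts: "(t, x) \<in> strip"
      then have st: "0 \<le> t" "t \<le> \<delta>" by (auto simp: mem_strip)
      have b: "\<bar>src i (\<lambda>j. U j (\<sigma>, X i (\<sigma>, t, x + e))) - src i (\<lambda>j. U j (\<sigma>, X i (\<sigma>, t, x))) - e * (src i (\<lambda>j. W j (\<sigma>, X i (\<sigma>, t, x))) * P i (\<sigma>, t, x))\<bar> \<le> 3 * k * \<bar>e\<bar>"
        if \<sigma>: "\<sigma> \<in> {0..t}" for \<sigma>
      proof -
        have "\<bar>src i (\<lambda>j. U j (\<sigma>, X i (\<sigma>, t, x + e)) - U j (\<sigma>, X i (\<sigma>, t, x)) - e * (W j (\<sigma>, X i (\<sigma>, t, x)) * P i (\<sigma>, t, x)))\<bar> \<le> 3 * k * \<bar>e\<bar>"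
          using \<sigma> st by (intro abs_src_le al) auto
        moreover have "src i (\<lambda>j. U j (\<sigma>, X i (\<sigma>, t, x + e)) - U j (\<sigma>, X i (\<sigma>, t, x)) - e * (W j (\<sigma>, X i (\<sigma>, t, x)) * P i (\<sigma>, t, x)))
           = src i (\<lambda>j. U j (\<sigma>, X i (\<sigma>, t, x + e))) - src i (\<lambda>j. U j (\<sigma>, X i (\<sigma>, t, x))) - e * (src i (\<lambda>j. W j (\<sigma>, X i (\<sigma>, t, x))) * P i (\<sigma>, t, x))"
          by (cases i) (simp_all add: field_simps)
        ultimately show ?thesis by simp
      qed
      have 1: "\<bar>integral {0..t} (\<lambda>\<sigma>. src i (\<lambda>j. U j (\<sigma>, X i (\<sigma>, t, x + e)))) - integral {0..t} (\<lambda>\<sigma>. src i (\<lambda>j. U j (\<sigma>, X i (\<sigma>, t, x))))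
          - e * integral {0..t} (\<lambda>\<sigma>. src i (\<lambda>j. W j (\<sigma>, X i (\<sigma>, t, x))) * P i (\<sigma>, t, x))\<bar> \<le> \<delta> * (3 * k * \<bar>e\<bar>)"
        using st by (intro integral_lin_bound src_slice W_slice PW b) auto
      have 2: "\<delta> * (3 * k * \<bar>e\<bar>) \<le> 1 / 12 * (3 * k * \<bar>e\<bar>)" using \<delta>1 k by (intro mult_right_mono) auto
      define y where "y = X i (0, t, x)"
      define d where "d = X i (0, t, x + e) - y"
      have d: "\<bar>d\<bar> \<le> 2 * \<bar>e\<bar>" using X_lip[of 0 t "x + e" i x] st by (simp add: d_def y_def mem_simplex)
      have 3: "\<bar>U0 i (y + d) - U0 i y - d * DU0 i y\<bar> \<le> \<nu> / 2 * \<bar>d\<bar>" using d e3[of i] by (intro r(2)) linarith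
      have 4: "\<nu> / 2 * \<bar>d\<bar> \<le> \<nu> / 2 * (2 * \<bar>e\<bar>)" using d \<nu> by (intro mult_left_mono) auto
      have "good_at k e" using e1 \<rho>(1) by (intro \<rho>(2)) linarith
      then have "\<bar>d - e * P i (0, t, x)\<bar> \<le> k * \<eta> * \<bar>e\<bar>"
        using st by (simp add: good_at_def d_def y_def mem_simplex)
      then have 5: "\<bar>(d - e * P i (0, t, x)) * DU0 i y\<bar> \<le> (k * \<eta> * \<bar>e\<bar>) * L0"
        by (intro mult_bound DU0_le)
      have 6: "(k * \<eta> * \<bar>e\<bar>) * L0 = k * \<bar>e\<bar> / 4" using L0_\<eta> by (simp add: algebra_simps)
      have yd: "X i (0, t, x + e) = y + d" "X i (0, t, x) = y" by (simp_all add: d_def y_def)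
      have 7: "U i (t, x + e) - U i (t, x) - e * W i (t, x) = (U0 i (y + d) - U0 i y - d * DU0 i y) + (d - e * P i (0, t, x)) * DU0 i y
         + (integral {0..t} (\<lambda>\<sigma>. src i (\<lambda>j. U j (\<sigma>, X i (\<sigma>, t, x + e)))) - integral {0..t} (\<lambda>\<sigma>. src i (\<lambda>j. U j (\<sigma>, X i (\<sigma>, t, x))))
          - e * integral {0..t} (\<lambda>\<sigma>. src i (\<lambda>j. W j (\<sigma>, X i (\<sigma>, t, x))) * P i (\<sigma>, t, x)))"
      proof -
        have alg: "A = a + I \<Longrightarrow> A' = a' + I' \<Longrightarrow> w = D * p + J \<Longrightarrow> A - A' - e * w = (a - a' - d * D) + (d - e * p) * D + (I - I' - e * J)"
          for A A' a a' I I' w D p J :: real by (hypsubst, simp add: algebra_simps)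
        show ?thesis by (rule alg) (use U_eq[of t "x + e" i] U_eq[of t x i] W_eq[of t x i] ts yd in \<open>simp_all add: mem_strip\<close>)
      qed
      \<comment> \<open>Here one quarter of \<open>k\<close> comes from the position error in the
        initial data and one quarter from the source.\<close>
      have 8: "(k / 2 + \<nu>) * \<bar>e\<bar> = \<nu> / 2 * (2 * \<bar>e\<bar>) + k * \<bar>e\<bar> / 4 + 1 / 12 * (3 * k * \<bar>e\<bar>)" by (simp add: field_simps)
      show "\<bar>U i (t, x + e) - U i (t, x) - e * W i (t, x)\<bar> \<le> (k / 2 + \<nu>) * \<bar>e\<bar>"
        unfolding 7 8 using order_trans[OF 1 2] order_trans[OF 3 4] 5[unfolded 6]
        by (intro order_trans[OF abs_triangle_ineq] add_mono) auto
    qed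
  qed
  then show ?thesis unfolding good_def using \<rho>' by blast
qed

lemma good_mono: "good k \<Longrightarrow> k \<le> k' \<Longrightarrow> good k'"
proof -
  assume "good k" "k \<le> k'"
  then obtain \<rho> where \<rho>: "\<rho> > 0" "\<And>e. \<bar>e\<bar> \<le> \<rho> \<Longrightarrow> good_at k e" unfolding good_def by blast
  have "good_at k' e" if "good_at k e" for e
  proof -
    have "k * \<eta> * \<bar>e\<bar> \<le> k' * \<eta> * \<bar>e\<bar>" "k * \<bar>e\<bar> \<le> k' * \<bar>e\<bar>"
      using \<open>k \<le> k'\<close> \<eta>_pos by (auto intro!: mult_right_mono)
    then show ?thesis using that unfolding good_at_def by (meson order_trans)
  qed
  then show ?thesis using \<rho> unfolding good_def by blast
qed

lemma good_all: assumes "k > 0" shows "good k"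
proof -
  define S where "S = {k. k \<ge> 0 \<and> good k}"
  have ne: "S \<noteq> {}" using good_start L0_pos by (auto simp: S_def intro!: exI[of _ "16 * L0 + 8 * L0"])
  have bd: "bdd_below S" by (auto simp: S_def bdd_below_def)
  have "Inf S \<ge> 0" using ne by (intro cInf_greatest) (auto simp: S_def)
  moreover have "\<not> Inf S > 0"
  proof
    assume m: "Inf S > 0"
    \<comment> \<open>With \<open>m\<close> the infimum, a value below \<open>5 m / 4\<close> is
      improved to \<open>k' / 2 + m / 4\<close>, which is below \<open>7 m / 8\<close>.\<close>
    then obtain k' where k': "k' \<in> S" "k' < Inf S + Inf S / 4"
      using cInf_lessD[OF ne, of "Inf S + Inf S / 4"] by auto
    have "k' / 2 + Inf S / 4 \<in> S" using k'(1) m by (auto simp: S_def intro!: good_step)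
    then have "Inf S \<le> k' / 2 + Inf S / 4" using bd by (intro cInf_lower)
    with k'(2) m show False by simp
  qed
  ultimately have "Inf S < k" using assms by linarith
  then obtain k' where "k' \<in> S" "k' < k" using cInf_lessD[OF ne] by blast
  then show ?thesis using good_mono[of k' k] by (auto simp: S_def)
qed

lemma U_deriv_x:
  assumes "(t, x) \<in> strip" shows "((\<lambda>y. U i (t, y)) has_real_derivative W i (t, x)) (at x)"
  unfolding has_field_derivative_def has_derivative_at_alt
proof (intro conjI allI impI bounded_linear_mult_right)
  fix e :: real assume "e > 0"
  from good_all[OF this] obtain \<rho> where \<rho>: "\<rho> > 0" "\<And>d. \<bar>d\<bar> \<le> \<rho> \<Longrightarrow> good_at e d" unfolding good_def by blast
  have "\<bar>U i (t, y) - U i (t, x) - W i (t, x) * (y - x)\<bar> \<le> e * \<bar>y - x\<bar>" if "\<bar>y - x\<bar> < \<rho>" for y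
  proof -
    have "good_at e (y - x)" using that by (intro \<rho>(2)) auto
    then have "\<bar>U i (t, x + (y - x)) - U i (t, x) - (y - x) * W i (t, x)\<bar> \<le> e * \<bar>y - x\<bar>"
      using assms unfolding good_at_def by blast
    then show ?thesis by (simp add: mult.commute)
  qed
  with \<rho>(1) show "\<exists>d>0. \<forall>y. norm (y - x) < d \<longrightarrow> norm (U i (t, y) - U i (t, x) - W i (t, x) * (y - x)) \<le> e * norm (y - x)"
    by (intro exI[of _ \<rho>]) auto
qed

text \<open>Follow the characteristic from \<open>(b, x)\<close> back to time \<open>a\<close>, then
  return from its position \<open>y\<close> to \<open>x\<close> on the slice \<open>a\<close> by the
  mean value theorem. The base time \<open>t\<close> may be either endpoint, which serves right and
  left difference quotients alike. The three terms of the bound are the variation of the source, of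
  the slope \<open>W\<close> and of the speed.\<close>

lemma U_increment:
  assumes t: "t \<in> {a, b}" and ab: "0 \<le> a" "a \<le> b" "b \<le> \<delta>" "\<Lambda> * (b - a) < r" "b - a < r"
    and S: "\<And>\<sigma> z. \<bar>\<sigma> - t\<bar> < r \<Longrightarrow> \<bar>z - x\<bar> < r \<Longrightarrow> (\<sigma>, z) \<in> strip \<Longrightarrow> \<bar>src i (\<lambda>j. U j (\<sigma>, z)) - src i (\<lambda>j. U j (t, x))\<bar> \<le> \<nu>"
    and C: "\<And>\<sigma> z. \<bar>\<sigma> - t\<bar> < r \<Longrightarrow> \<bar>z - x\<bar> < r \<Longrightarrow> (\<sigma>, z) \<in> strip \<Longrightarrow> \<bar>c (mid (\<lambda>j. U j (\<sigma>, z))) - c (mid (\<lambda>j. U j (t, x)))\<bar> \<le> \<nu>"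
    and Wc: "\<And>\<sigma> z. \<bar>\<sigma> - t\<bar> < r \<Longrightarrow> \<bar>z - x\<bar> < r \<Longrightarrow> (\<sigma>, z) \<in> strip \<Longrightarrow> \<bar>W i (\<sigma>, z) - W i (t, x)\<bar> \<le> \<nu>"
  shows "\<bar>U i (b, x) - U i (a, x) - (b - a) * (src i (\<lambda>j. U j (t, x)) - sg i * c (mid (\<lambda>j. U j (t, x))) * W i (t, x))\<bar> \<le> \<nu> * (1 + \<Lambda> + 4 * L0) * (b - a)"
proof -
  define y where "y = X i (a, b, x)"
  have Xc: "\<bar>X i (\<sigma>, b, x) - x\<bar> < r" if "\<sigma> \<in> {a..b}" for \<sigma>
  proof -
    have "\<Lambda> * (b - \<sigma>) \<le> \<Lambda> * (b - a)" using that \<Lambda>_nonneg by (intro mult_left_mono) auto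
    then show ?thesis using X_speed[of \<sigma> b i x] that ab by auto
  qed
  have \<sigma>c: "\<bar>\<sigma> - t\<bar> < r" if "\<sigma> \<in> {a..b}" for \<sigma> using that t ab by auto
  have 1: "\<bar>integral {a..b} (\<lambda>\<sigma>. src i (\<lambda>j. U j (\<sigma>, X i (\<sigma>, b, x)))) - integral {a..b} (\<lambda>\<sigma>. src i (\<lambda>j. U j (t, x)))\<bar> \<le> (b - a) * \<nu>"
    using ab by (intro integral_diff_bound src_slice S \<sigma>c Xc in_strip) (auto simp: mem_strip)
  have 2: "\<bar>integral {a..b} (\<lambda>\<sigma>. c (mid (\<lambda>j. U j (\<sigma>, X i (\<sigma>, b, x))))) - integral {a..b} (\<lambda>\<sigma>. c (mid (\<lambda>j. U j (t, x))))\<bar> \<le> (b - a) * \<nu>"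
    using ab by (intro integral_diff_bound speed_slice C \<sigma>c Xc in_strip) (auto simp: mem_strip)
  have yx: "y - x = - (sg i * integral {a..b} (\<lambda>\<sigma>. c (mid (\<lambda>j. U j (\<sigma>, X i (\<sigma>, b, x))))))"
    using X_eq[of a b x i] ab by (simp add: y_def mem_simplex)
  have "y - x + sg i * ((b - a) * c (mid (\<lambda>j. U j (t, x)))) = - (sg i * (integral {a..b} (\<lambda>\<sigma>. c (mid (\<lambda>j. U j (\<sigma>, X i (\<sigma>, b, x))))) - integral {a..b} (\<lambda>\<sigma>. c (mid (\<lambda>j. U j (t, x))))))"
    unfolding yx using ab by (simp add: algebra_simps)
  then have 3: "\<bar>y - x + sg i * ((b - a) * c (mid (\<lambda>j. U j (t, x))))\<bar> \<le> (b - a) * \<nu>"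
    using 2 by (rule sg_neg_le)
  have yx2: "\<bar>y - x\<bar> \<le> \<Lambda> * (b - a)" using X_speed[of a b i x] ab by (simp add: y_def)
  obtain z where z: "\<bar>z - x\<bar> \<le> \<bar>y - x\<bar>" "U i (a, y) - U i (a, x) = (y - x) * W i (a, z)"
  proof (cases "x = y")
    case True then show ?thesis using that[of x] by simp
  next
    case False
    have D: "\<And>z. ((\<lambda>y. U i (a, y)) has_real_derivative W i (a, z)) (at z)"
      using ab by (intro U_deriv_x) (auto simp: mem_strip)
    show ?thesis
    proof (cases "x < y")
      case True
      from MVT2[OF True, of "\<lambda>y. U i (a, y)" "\<lambda>z. W i (a, z)"] D obtain z where "x < z" "z < y" "U i (a, y) - U i (a, x) = (y - x) * W i (a, z)" by blast
      then show ?thesis using that[of z] by auto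
    next
      case F: False
      with False have "y < x" by simp
      from MVT2[OF this, of "\<lambda>y. U i (a, y)" "\<lambda>z. W i (a, z)"] D obtain z where "y < z" "z < x" "U i (a, x) - U i (a, y) = (x - y) * W i (a, z)" by blast
      then show ?thesis using that[of z] by (auto simp: algebra_simps)
    qed
  qed
  have "\<bar>W i (a, z) - W i (t, x)\<bar> \<le> \<nu>"
    using z(1) yx2 ab t by (intro Wc) (auto simp: mem_strip)
  then have 4: "\<bar>(y - x) * (W i (a, z) - W i (t, x))\<bar> \<le> (\<Lambda> * (b - a)) * \<nu>" using yx2 by (intro mult_bound)
  have 5: "\<bar>(y - x + sg i * ((b - a) * c (mid (\<lambda>j. U j (t, x))))) * W i (t, x)\<bar> \<le> ((b - a) * \<nu>) * (4 * L0)"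
    using t ab by (intro mult_bound 3 W_le) (auto simp: mem_strip)
  have "U i (b, x) - U i (a, x) = (y - x) * W i (a, z) + integral {a..b} (\<lambda>\<sigma>. src i (\<lambda>j. U j (\<sigma>, X i (\<sigma>, b, x))))"
    using U_semigroup[of a b i x] ab z(2) by (simp add: y_def)
  then have 6: "U i (b, x) - U i (a, x) - (b - a) * (src i (\<lambda>j. U j (t, x)) - sg i * c (mid (\<lambda>j. U j (t, x))) * W i (t, x)) =
     (integral {a..b} (\<lambda>\<sigma>. src i (\<lambda>j. U j (\<sigma>, X i (\<sigma>, b, x)))) - integral {a..b} (\<lambda>\<sigma>. src i (\<lambda>j. U j (t, x))))
     + ((y - x) * (W i (a, z) - W i (t, x)) + (y - x + sg i * ((b - a) * c (mid (\<lambda>j. U j (t, x))))) * W i (t, x))"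
    using ab by (simp add: algebra_simps)
  have 7: "\<nu> * (1 + \<Lambda> + 4 * L0) * (b - a) = (b - a) * \<nu> + ((\<Lambda> * (b - a)) * \<nu> + ((b - a) * \<nu>) * (4 * L0))"
    by (simp add: algebra_simps)
  show ?thesis unfolding 6 7 by (intro order_trans[OF abs_triangle_ineq] add_mono 1 4 5)
qed

lemma continuous_on_strip_ball:
  fixes g :: "real \<times> real \<Rightarrow> real"
  assumes "continuous_on strip g" "(t, x) \<in> strip" "\<nu> > 0"
  shows "\<exists>r>0. \<forall>\<sigma> z. \<bar>\<sigma> - t\<bar> < r \<longrightarrow> \<bar>z - x\<bar> < r \<longrightarrow> (\<sigma>, z) \<in> strip \<longrightarrow> \<bar>g (\<sigma>, z) - g (t, x)\<bar> \<le> \<nu>"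
proof -
  obtain d where d: "d > 0" "\<And>q. q \<in> strip \<Longrightarrow> dist q (t, x) < d \<Longrightarrow> dist (g q) (g (t, x)) < \<nu>"
    using assms unfolding continuous_on_iff by metis
  have "dist (\<sigma>, z) (t, x) < d" if "\<bar>\<sigma> - t\<bar> < d / 2" "\<bar>z - x\<bar> < d / 2" for \<sigma> z
    using that norm_Pair_le[of "\<sigma> - t" "z - x"] by (simp add: dist_norm)
  then show ?thesis using d by (intro exI[of _ "d / 2"]) (fastforce simp: dist_real_def)
qed

lemma U_deriv_t:
  assumes tx: "(t, x) \<in> strip"
  shows "((\<lambda>s. U i (s, x)) has_real_derivative (src i (\<lambda>j. U j (t, x)) - sg i * c (mid (\<lambda>j. U j (t, x))) * W i (t, x))) (at t within {0..\<delta>})"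
    (is "(_ has_real_derivative ?D) _")
  unfolding has_field_derivative_def has_derivative_within_alt
proof (intro conjI allI impI bounded_linear_mult_right)
  fix e :: real assume e: "e > 0"
  define N where "N = 1 + \<Lambda> + 4 * L0"
  have N: "N > 0" using \<Lambda>_nonneg L0_pos by (simp add: N_def)
  define \<nu> where "\<nu> = e / N"
  have \<nu>: "\<nu> > 0" "\<nu> * N = e" using e N by (simp_all add: \<nu>_def)
  obtain r1 where r1: "r1 > 0" "\<And>\<sigma> z. \<bar>\<sigma> - t\<bar> < r1 \<Longrightarrow> \<bar>z - x\<bar> < r1 \<Longrightarrow> (\<sigma>, z) \<in> strip \<Longrightarrow> \<bar>src i (\<lambda>j. U j (\<sigma>, z)) - src i (\<lambda>j. U j (t, x))\<bar> \<le> \<nu>"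
    using continuous_on_strip_ball[OF continuous_on_src[where U = U and i = i, OF U_cont] tx \<nu>(1)] by blast
  have "continuous_on strip (\<lambda>p. c (mid (\<lambda>j. U j p)))"
    by (intro continuous_on_compose2[OF c_cont[of UNIV]] continuous_intros U_cont) auto
  from continuous_on_strip_ball[OF this tx \<nu>(1)]
  obtain r2 where r2: "r2 > 0" "\<And>\<sigma> z. \<bar>\<sigma> - t\<bar> < r2 \<Longrightarrow> \<bar>z - x\<bar> < r2 \<Longrightarrow> (\<sigma>, z) \<in> strip \<Longrightarrow> \<bar>c (mid (\<lambda>j. U j (\<sigma>, z))) - c (mid (\<lambda>j. U j (t, x)))\<bar> \<le> \<nu>"
    by blast
  obtain r3 where r3: "r3 > 0" "\<And>\<sigma> z. \<bar>\<sigma> - t\<bar> < r3 \<Longrightarrow> \<bar>z - x\<bar> < r3 \<Longrightarrow> (\<sigma>, z) \<in> strip \<Longrightarrow> \<bar>W i (\<sigma>, z) - W i (t, x)\<bar> \<le> \<nu>"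
    using continuous_on_strip_ball[OF W_cont[of i] tx \<nu>(1)] by blast
  define r where "r = min r1 (min r2 r3)"
  have r: "r > 0" "r \<le> r1" "r \<le> r2" "r \<le> r3" using r1(1) r2(1) r3(1) by (auto simp: r_def)
  \<comment> \<open>Chosen so that an increment below \<open>d\<close> is below \<open>r\<close> and
    moves a characteristic by less than \<open>r\<close>.\<close>
  define d where "d = r / (1 + \<Lambda>)"
  have d: "d > 0" "d \<le> r" using r \<Lambda>_nonneg by (simp_all add: d_def field_simps)
  have \<Lambda>d: "\<Lambda> * q < r" if "0 \<le> q" "q < d" for q
  proof -
    have "(1 + \<Lambda>) * q < (1 + \<Lambda>) * d" using that \<Lambda>_nonneg by (intro mult_strict_left_mono) auto
    also have "\<dots> = r" using \<Lambda>_nonneg by (simp add: d_def)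
    finally show ?thesis using that by (simp add: algebra_simps)
  qed
  have inc: "\<bar>U i (b, x) - U i (a, x) - (b - a) * ?D\<bar> \<le> \<nu> * (1 + \<Lambda> + 4 * L0) * (b - a)"
    if "t \<in> {a, b}" "0 \<le> a" "a \<le> b" "b \<le> \<delta>" "b - a < d" for a b
    by (rule U_increment[where r = r]) (use that \<Lambda>d[of "b - a"] d r r1(2) r2(2) r3(2) in \<open>auto\<close>)
  have "\<bar>U i (s, x) - U i (t, x) - ?D * (s - t)\<bar> \<le> e * \<bar>s - t\<bar>" if s: "s \<in> {0..\<delta>}" "\<bar>s - t\<bar> < d" for s
  proof (cases "s \<le> t")
    case True
    have "U i (s, x) - U i (t, x) - ?D * (s - t) = - (U i (t, x) - U i (s, x) - (t - s) * ?D)" by (simp add: algebra_simps)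
    then show ?thesis using inc[of s t] s True tx \<nu>(2) by (simp add: N_def mem_strip)
  next
    case False
    then show ?thesis using inc[of t s] s tx \<nu>(2) by (simp add: N_def mem_strip mult.commute)
  qed
  then show "\<exists>d>0. \<forall>y\<in>{0..\<delta>}. norm (y - t) < d \<longrightarrow> norm (U i (y, x) - U i (t, x) - ?D * (y - t)) \<le> e * norm (y - t)"
    using d(1) by auto
qed

end

context riemann_system begin

theorem C1_solution:
  "\<exists>U W. (\<forall>i. continuous_on strip (U i)) \<and> (\<forall>i. continuous_on strip (W i)) \<and> (\<forall>i x. U i (0, x) = U0 i x) \<and>
     (\<forall>i t x. (t, x) \<in> strip \<longrightarrow> ((\<lambda>y. U i (t, y)) has_real_derivative W i (t, x)) (at x) \<and>
       ((\<lambda>s. U i (s, x)) has_real_derivative (src i (\<lambda>j. U j (t, x)) - sg i * c (mid (\<lambda>j. U j (t, x))) * W i (t, x))) (at t within {0..\<delta>}) \<and>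
       \<bar>U i (t, x) - U0 i x\<bar> \<le> (L0 * \<Lambda> + B + 1) * \<delta>)"
proof -
  obtain X U where XU: "adm X U" "\<And>i a. a \<in> simp\<delta> \<Longrightarrow> FX X U i a = X i a" "\<And>i b. b \<in> strip \<Longrightarrow> FU X U i b = U i b"
    using fixed_point by blast
  interpret f: riemann_fixed c dc K B L0 \<delta> U0 DU0 X U by unfold_locales (fact XU)+
  obtain P W where PW: "f.adm' P W" "\<And>i a. a \<in> simp\<delta> \<Longrightarrow> f.FP P W i a = P i a" "\<And>i b. b \<in> strip \<Longrightarrow> f.FW P W i b = W i b"
    using f.fixed_point' by blast
  interpret g: riemann_diff c dc K B L0 \<delta> U0 DU0 X U P W by unfold_locales (fact PW)+
  show ?thesis
    by (intro exI[of _ U] exI[of _ W] conjI allI impI f.U_cont g.W_cont f.U_init g.U_deriv_x g.U_deriv_t f.U_close)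
qed

end

section \<open>Characteristics and maximum principles\<close>

text \<open>Continuity of one partial derivative together with existence of the other at the point
  gives total differentiability, also at the ends of \<open>I\<close>. \<open>J\<close> may be
  smaller than \<open>I\<close> because characteristics are constructed on short intervals
  only.\<close>

lemma DERIV_along_curve:
  fixes f fx :: "real \<Rightarrow> real \<Rightarrow> real"
  assumes ft: "((\<lambda>s. f s (\<zeta> t)) has_real_derivative D) (at t within I)"
    and fx: "\<And>s y. s \<in> I \<Longrightarrow> ((\<lambda>y. f s y) has_real_derivative fx s y) (at y)"
    and cont: "continuous_on (I \<times> UNIV) (\<lambda>(t, x). fx t x)"
    and t: "t \<in> I" and \<zeta>: "(\<zeta> has_real_derivative z) (at t within J)" and J: "J \<subseteq> I"
  shows "((\<lambda>s. f s (\<zeta> s)) has_real_derivative D + fx t (\<zeta> t) * z) (at t within J)"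
proof -
  have "((\<lambda>(s, y). f s y) has_derivative (\<lambda>(ts, ty). D * ts + blinfun_apply (fx t (\<zeta> t) *\<^sub>R id_blinfun) ty)) (at (t, \<zeta> t) within I \<times> UNIV)"
  proof (rule has_derivative_partialsI)
    show "((\<lambda>s. f s (\<zeta> t)) has_derivative (*) D) (at t within I)"
      using ft by (simp add: has_field_derivative_def)
    show "((\<lambda>y. f s y) has_derivative blinfun_apply (fx s y *\<^sub>R id_blinfun)) (at y within UNIV)" if "s \<in> I" for s y
      using fx[OF that, of y] by (simp add: has_field_derivative_def scaleR_blinfun.rep_eq)
    have "continuous (at (t, \<zeta> t) within I \<times> UNIV) (\<lambda>(t, x). fx t x)"
      using cont t by (auto simp: continuous_on_eq_continuous_within)
    then show "continuous (at (t, \<zeta> t) within I \<times> UNIV) (\<lambda>(x, y). fx x y *\<^sub>R id_blinfun)"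
      unfolding case_prod_beta by (intro continuous_intros)
  qed auto
  moreover have "((\<lambda>s. (s, \<zeta> s)) has_derivative (\<lambda>h. (h, z * h))) (at t within J)"
    using \<zeta> by (auto simp: has_field_derivative_def intro!: derivative_eq_intros)
  moreover have "(\<lambda>s. (s, \<zeta> s)) ` J \<subseteq> I \<times> UNIV" using J by auto
  ultimately have "((\<lambda>(s, y). f s y) \<circ> (\<lambda>s. (s, \<zeta> s)) has_derivative
      (\<lambda>(ts, ty). D * ts + blinfun_apply (fx t (\<zeta> t) *\<^sub>R id_blinfun) ty) \<circ> (\<lambda>h. (h, z * h))) (at t within J)"
    by (intro diff_chain_within) (auto intro: has_derivative_subset)
  moreover have "(\<lambda>(ts, ty). D * ts + blinfun_apply (fx t (\<zeta> t) *\<^sub>R id_blinfun) ty) \<circ> (\<lambda>h. (h, z * h)) = (*) (D + fx t (\<zeta> t) * z)"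
    by (rule ext) (simp add: scaleR_blinfun.rep_eq algebra_simps)
  ultimately show ?thesis
    by (simp add: has_field_derivative_def comp_def)
qed

lemma MVT_increment:
  fixes g :: "real \<Rightarrow> real"
  assumes "\<And>y. (g has_real_derivative g' y) (at y)"
  obtains \<theta> where "\<bar>\<theta>\<bar> \<le> \<bar>e\<bar>" "g (x + e) - g x = e * g' (x + \<theta>)"
proof (cases "e = 0")
  case True then show ?thesis using that[of 0] by simp
next
  case False
  show ?thesis
  proof (cases "e > 0")
    case True
    then have "x < x + e" by simp
    from MVT2[OF this, of g g'] assms obtain z where "x < z" "z < x + e" "g (x + e) - g x = e * g' z" by auto
    then show ?thesis using that[of "z - x"] by auto
  next
    case F: False
    with False have "x + e < x" by simp
    from MVT2[OF this, of g g'] assms obtain z where "x + e < z" "z < x" "g x - g (x + e) = - e * g' z" by auto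
    then show ?thesis using that[of "z - x"] by auto
  qed
qed

text \<open>Since \<open>f\<^sub>x\<close> is only continuous, the equation cannot be differentiated in \<open>x\<close>. Instead the
  difference quotients \<open>(f t (\<zeta> t + e) - f t (\<zeta> t)) / e\<close> along the shifted curve are
  differentiable in \<open>t\<close>, with derivatives converging locally uniformly as \<open>e\<close> tends to \<open>0\<close>.\<close>
lemma DERIV_x_derivative_along_characteristic:
  fixes f fx g gx lam lamx :: "real \<Rightarrow> real \<Rightarrow> real"
  assumes t: "t \<in> {a..b}" and I: "{a..b} \<subseteq> I"
    and \<zeta>: "\<And>s. s \<in> {a..b} \<Longrightarrow> (\<zeta> has_real_derivative lam s (\<zeta> s)) (at s within {a..b})"
    and ft: "\<And>s x. s \<in> I \<Longrightarrow> ((\<lambda>r. f r x) has_real_derivative g s x - lam s x * fx s x) (at s within I)"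
    and fx: "\<And>s y. s \<in> I \<Longrightarrow> (f s has_real_derivative fx s y) (at y)"
    and gx: "\<And>s y. s \<in> I \<Longrightarrow> (g s has_real_derivative gx s y) (at y)"
    and lamx: "\<And>s y. s \<in> I \<Longrightarrow> (lam s has_real_derivative lamx s y) (at y)"
    and cfx: "continuous_on (I \<times> UNIV) (\<lambda>(t, x). fx t x)"
    and cgx: "continuous_on (I \<times> UNIV) (\<lambda>(t, x). gx t x)"
    and clamx: "continuous_on (I \<times> UNIV) (\<lambda>(t, x). lamx t x)"
  shows "((\<lambda>s. fx s (\<zeta> s)) has_real_derivative gx t (\<zeta> t) - lamx t (\<zeta> t) * fx t (\<zeta> t)) (at t within {a..b})"
    (is "(_ has_real_derivative ?G) _")
  unfolding has_field_derivative_def has_derivative_within_alt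
proof (intro conjI allI impI bounded_linear_mult_right)
  fix \<nu> :: real assume \<nu>: "\<nu> > 0"
  have c\<zeta>: "continuous_on {a..b} \<zeta>" using \<zeta> by (meson DERIV_continuous continuous_on_eq_continuous_within)
  have pc: "continuous_on ({a..b} \<times> UNIV) (\<lambda>q. k (fst q) (\<zeta> (fst q) + m (snd q)))"
    if "continuous_on (I \<times> UNIV) (\<lambda>(t, x). k t x)" "continuous_on UNIV m"
    for k :: "real \<Rightarrow> real \<Rightarrow> real" and m :: "real \<times> real \<times> real \<Rightarrow> real"
  proof -
    have "continuous_on ({a..b} \<times> UNIV) (\<lambda>q. (\<lambda>(t, x). k t x) (fst q, \<zeta> (fst q) + m (snd q)))"
      by (rule continuous_on_compose2[OF that(1)])
        (use I in \<open>auto intro!: continuous_intros continuous_on_compose2[OF c\<zeta>] continuous_on_compose2[OF that(2)]\<close>)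
    then show ?thesis by simp
  qed
  \<comment> \<open>Three separate offsets, since the mean value theorem yields different
    intermediate points for \<open>g\<close> and for \<open>lam\<close>, and \<open>fx\<close> is
    taken at the offset \<open>e\<close> itself.\<close>
  define \<Psi> where "\<Psi> q = gx (fst q) (\<zeta> (fst q) + fst (snd q)) - lamx (fst q) (\<zeta> (fst q) + fst (snd (snd q))) * fx (fst q) (\<zeta> (fst q) + snd (snd (snd q)))"
    for q :: "real \<times> real \<times> real \<times> real"
  have "continuous_on ({a..b} \<times> UNIV) \<Psi>"
    unfolding \<Psi>_def by (intro continuous_intros pc cgx clamx cfx)
  moreover have "(t, 0, 0, 0) \<in> {a..b} \<times> UNIV" using t by simp
  ultimately obtain d where d: "d > 0" "\<And>q. q \<in> {a..b} \<times> UNIV \<Longrightarrow> dist q (t, 0, 0, 0) < d \<Longrightarrow> dist (\<Psi> q) (\<Psi> (t, 0, 0, 0)) < \<nu>"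
    using \<nu> unfolding continuous_on_iff by metis
  have \<Psi>0: "\<Psi> (t, 0, 0, 0) = ?G" by (simp add: \<Psi>_def)
  have near: "\<bar>\<Psi> (s, p, q, r) - ?G\<bar> \<le> \<nu>" if "s \<in> {a..b}" "\<bar>s - t\<bar> < d / 4" "\<bar>p\<bar> < d / 4" "\<bar>q\<bar> < d / 4" "\<bar>r\<bar> < d / 4" for s p q r
  proof -
    have "dist (s, p, q, r) (t, 0, 0, 0) < d"
      using that norm_Pair_le[of "s - t" "(p, q, r)"] norm_Pair_le[of p "(q, r)"] norm_Pair_le[of q r] by (simp add: dist_norm)
    then show ?thesis using d(2)[of "(s, p, q, r)"] that(1) \<Psi>0 by (simp add: dist_real_def)
  qed
  define F where "F e s = (f s (\<zeta> s + e) - f s (\<zeta> s)) / e" for e s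
  \<comment> \<open>The shifted curve is not a characteristic: it moves with the speed at
    \<open>\<zeta> s\<close>, so the difference of the speeds times \<open>fx\<close>
    remains.\<close>
  define F' where "F' e s = ((g s (\<zeta> s + e) - g s (\<zeta> s)) - (lam s (\<zeta> s + e) - lam s (\<zeta> s)) * fx s (\<zeta> s + e)) / e" for e s
  have dF: "(F e has_real_derivative F' e s) (at s within {a..b})" if s: "s \<in> {a..b}" and "e \<noteq> 0" for e s
  proof -
    have s': "s \<in> I" using s I by auto
    have \<zeta>e: "((\<lambda>r. \<zeta> r + e) has_real_derivative lam s (\<zeta> s)) (at s within {a..b})"
      using \<zeta>[OF s] by (auto intro!: derivative_eq_intros)
    show ?thesis unfolding F_def F'_def
      using DERIV_along_curve[where \<zeta> = "\<lambda>r. \<zeta> r + e", OF ft[OF s'] fx cfx s' \<zeta>e I]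
        DERIV_along_curve[where \<zeta> = \<zeta>, OF ft[OF s'] fx cfx s' \<zeta>[OF s] I]
      by (auto intro!: derivative_eq_intros simp: \<open>e \<noteq> 0\<close> algebra_simps diff_divide_distrib add_divide_distrib)
  qed
  have F'_near: "\<bar>F' e s - ?G\<bar> \<le> \<nu>" if "s \<in> {a..b}" "\<bar>s - t\<bar> < d / 4" "\<bar>e\<bar> < d / 4" "e \<noteq> 0" for e s
  proof -
    have s': "s \<in> I" using that I by auto
    obtain p where p: "\<bar>p\<bar> \<le> \<bar>e\<bar>" "g s (\<zeta> s + e) - g s (\<zeta> s) = e * gx s (\<zeta> s + p)"
      using MVT_increment[of "g s" "gx s" e "\<zeta> s"] gx[OF s'] by metis
    obtain q where q: "\<bar>q\<bar> \<le> \<bar>e\<bar>" "lam s (\<zeta> s + e) - lam s (\<zeta> s) = e * lamx s (\<zeta> s + q)"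
      using MVT_increment[of "lam s" "lamx s" e "\<zeta> s"] lamx[OF s'] by metis
    have "F' e s = \<Psi> (s, p, q, e)"
      using that(4) unfolding F'_def p(2) q(2) \<Psi>_def by (simp add: field_simps)
    then show ?thesis using near[of s p q e] that p(1) q(1) by simp
  qed
  have Fbound: "\<bar>F e s - F e t - ?G * (s - t)\<bar> \<le> \<nu> * \<bar>s - t\<bar>" if s: "s \<in> {a..b}" "\<bar>s - t\<bar> < d / 4" and e: "\<bar>e\<bar> < d / 4" "e \<noteq> 0" for e s
  proof -
    have seg: "r \<in> {a..b} \<and> \<bar>r - t\<bar> < d / 4" if "r \<in> closed_segment t s" for r
      using that s t by (auto simp: closed_segment_eq_real_ivl split: if_splits)
    have "norm ((F e s - ?G * s) - (F e t - ?G * t)) \<le> \<nu> * norm (s - t)"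
    proof (rule field_differentiable_bound[of "closed_segment t s" _ "\<lambda>r. F' e r - ?G"])
      fix r assume r: "r \<in> closed_segment t s"
      have sub: "closed_segment t s \<subseteq> {a..b}" using seg by blast
      show "((\<lambda>r. F e r - ?G * r) has_field_derivative F' e r - ?G) (at r within closed_segment t s)"
        using seg[OF r] by (auto intro!: derivative_eq_intros DERIV_subset[OF dF[OF _ e(2)] sub])
      show "norm (F' e r - ?G) \<le> \<nu>" using F'_near seg[OF r] e by simp
    qed auto
    then show ?thesis by (simp add: algebra_simps)
  qed
  have Flim: "((\<lambda>e. F e s) \<longlongrightarrow> fx s (\<zeta> s)) (at 0)" if "s \<in> {a..b}" for s
    using fx[of s "\<zeta> s"] that I unfolding F_def DERIV_def by auto
  have "\<bar>fx s (\<zeta> s) - fx t (\<zeta> t) - ?G * (s - t)\<bar> \<le> \<nu> * \<bar>s - t\<bar>" if s: "s \<in> {a..b}" "\<bar>s - t\<bar> < d / 4" for s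
  proof -
    \<comment> \<open>The estimate \<open>Fbound\<close> holds with the same \<open>\<nu>\<close>
      for all small \<open>e\<close>, so it survives the limit in which the quotients become
      \<open>fx\<close>.\<close>
    have "((\<lambda>e. \<bar>F e s - F e t - ?G * (s - t)\<bar>) \<longlongrightarrow> \<bar>fx s (\<zeta> s) - fx t (\<zeta> t) - ?G * (s - t)\<bar>) (at 0)"
      by (intro tendsto_intros Flim s t)
    moreover have "\<forall>\<^sub>F e in at 0. \<bar>F e s - F e t - ?G * (s - t)\<bar> \<le> \<nu> * \<bar>s - t\<bar>"
      unfolding eventually_at using Fbound[OF s] d(1) by (intro exI[of _ "d / 4"]) auto
    ultimately show ?thesis by (rule tendsto_upperbound) simp
  qed
  then show "\<exists>d>0. \<forall>y\<in>{a..b}. norm (y - t) < d \<longrightarrow> norm (fx y (\<zeta> y) - fx t (\<zeta> t) - ?G * (y - t)) \<le> \<nu> * norm (y - t)"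
    using d(1) by (intro exI[of _ "d / 4"]) auto
qed

text \<open>Picard iteration through \<open>pair_contraction\<close> with a trivial second
  component. The difference of the integrals up to \<open>t\<close> and up to \<open>t0\<close> is
  the oriented integral from \<open>t0\<close>, so the prescribed point may lie anywhere in the
  interval.\<close>

lemma characteristic_exists:
  fixes lam :: "real \<Rightarrow> real \<Rightarrow> real"
  assumes cont: "continuous_on ({a..b} \<times> UNIV) (\<lambda>(t, x). lam t x)"
    and lip: "\<And>t x y. t \<in> {a..b} \<Longrightarrow> \<bar>lam t x - lam t y\<bar> \<le> K * \<bar>x - y\<bar>"
    and small: "(b - a) * K \<le> 1 / 2" and t0: "t0 \<in> {a..b}"
  shows "\<exists>\<zeta>. \<zeta> t0 = x0 \<and> (\<forall>t\<in>{a..b}. (\<zeta> has_real_derivative lam t (\<zeta> t)) (at t within {a..b}))"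
proof -
  have comp: "continuous_on {s..t} (\<lambda>s. lam s (X s))" if "continuous_on {a..b} X" "{s..t} \<subseteq> {a..b}" for X s t
  proof -
    have "continuous_on {s..t} (\<lambda>s. (\<lambda>(t, x). lam t x) (s, X s))"
      by (rule continuous_on_compose2[OF cont])
        (use that in \<open>auto intro!: continuous_intros continuous_on_subset[OF that(1)]\<close>)
    then show ?thesis by simp
  qed
  let ?F = "\<lambda>(X :: unit \<Rightarrow> real \<Rightarrow> real) (U :: unit \<Rightarrow> unit \<Rightarrow> real) (i :: unit) t.
     x0 + integral {a..t} (\<lambda>s. lam s (X () s)) - integral {a..t0} (\<lambda>s. lam s (X () s))"
  let ?P = "\<lambda>(X :: unit \<Rightarrow> real \<Rightarrow> real) (U :: unit \<Rightarrow> unit \<Rightarrow> real). continuous_on {a..b} (X ())"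
  have Fcont: "continuous_on {a..b} (\<lambda>t. x0 + integral {a..t} (\<lambda>s. lam s (X s)) - integral {a..t0} (\<lambda>s. lam s (X s)))"
    if "continuous_on {a..b} X" for X
    using comp[OF that, of a b] by (intro continuous_intros indefinite_integral_continuous_1 integrable_continuous_real) auto
  have "\<exists>X U. ?P X U \<and> (\<forall>i. (\<forall>t\<in>{a..b}. ?F X U i t = X i t) \<and> (\<forall>b\<in>UNIV. (\<lambda>_. 0) b = U i b))"
  proof -
    have c0: "continuous_on {a..b} (\<lambda>t. x0 + integral {a..t} (\<lambda>s. lam s x0) - integral {a..t0} (\<lambda>s. lam s x0) - x0)"
      using continuous_on_diff[OF Fcont[of "\<lambda>_. x0"] continuous_on_const[of _ x0]] by simp
    obtain C where C: "\<And>t. t \<in> {a..b} \<Longrightarrow> \<bar>x0 + integral {a..t} (\<lambda>s. lam s x0) - integral {a..t0} (\<lambda>s. lam s x0) - x0\<bar> \<le> C"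
      using compact_imp_bounded[OF compact_continuous_image[OF c0 compact_Icc]]
      unfolding bounded_iff real_norm_def by (metis (no_types, lifting) imageI)
    have C0: "C \<ge> 0" using C[OF t0] by simp
    show ?thesis
    proof (rule pair_contraction[where P = ?P and F = ?F and G = "\<lambda>_ _ _ _. 0" and \<eta> = 1 and ?X0.0 = "\<lambda>_ _. x0" and ?U0.0 = "\<lambda>_ _. 0" and C = C])
      fix X X' :: "unit \<Rightarrow> real \<Rightarrow> real" and U U' :: "unit \<Rightarrow> unit \<Rightarrow> real" and d :: real
      assume X: "continuous_on {a..b} (X ())" and X': "continuous_on {a..b} (X' ())" and d: "d \<ge> 0"
        and close: "\<And>i t. t \<in> {a..b} \<Longrightarrow> \<bar>X i t - X' i t\<bar> \<le> d * 1"
      have K: "K \<ge> 0" using lip[OF t0, of 1 0] by (smt (verit) abs_ge_zero mult_less_0_iff)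
      have b1: "\<bar>lam s (X () s) - lam s (X' () s)\<bar> \<le> K * d" if "s \<in> {a..b}" for s
        using lip[OF that, of "X () s" "X' () s"] mult_left_mono[OF close[OF that, of "()"] K] by simp
      have main: "\<bar>integral {s..t} (\<lambda>s. lam s (X () s)) - integral {s..t} (\<lambda>s. lam s (X' () s))\<bar> \<le> d / 2"
        if "a \<le> s" "s \<le> t" "t \<le> b" for s t
      proof -
        have "\<bar>integral {s..t} (\<lambda>s. lam s (X () s)) - integral {s..t} (\<lambda>s. lam s (X' () s))\<bar> \<le> (b - a) * (K * d)"
          using that by (intro integral_diff_bound comp X X' b1) auto
        also have "\<dots> \<le> d / 2" using mult_right_mono[OF small d] by (simp add: algebra_simps)
        finally show ?thesis .
      qed
      have comb: "integral {a..s} (\<lambda>s. lam s (Y s)) + integral {s..t} (\<lambda>s. lam s (Y s)) = integral {a..t} (\<lambda>s. lam s (Y s))"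
        if "a \<le> s" "s \<le> t" "t \<le> b" "continuous_on {a..b} Y" for s t Y
        using that by (intro Henstock_Kurzweil_Integration.integral_combine integrable_continuous_real comp) auto
      have "\<bar>?F X U i t - ?F X' U' i t\<bar> \<le> d / 2 * 1" if t: "t \<in> {a..b}" for i t
      proof (cases "t \<le> t0")
        case True
        have o: "a \<le> t" "t0 \<le> b" using t t0 by auto
        show ?thesis
          using main[OF o(1) True o(2)] comb[OF o(1) True o(2) X] comb[OF o(1) True o(2) X'] by linarith
      next
        case False
        have o: "a \<le> t0" "t0 \<le> t" "t \<le> b" using t t0 False by auto
        show ?thesis using main[OF o] comb[OF o X] comb[OF o X'] by linarith
      qed
      then show "\<forall>i. (\<forall>t\<in>{a..b}. \<bar>?F X U i t - ?F X' U' i t\<bar> \<le> d / 2 * 1) \<and> (\<forall>b\<in>UNIV. \<bar>(0::real) - 0\<bar> \<le> d / 2)"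
        using d by auto
    next
      fix Xs and X :: "unit \<Rightarrow> real \<Rightarrow> real"
      assume "\<And>n. continuous_on {a..b} (Xs n ())" "\<And>i. uniform_limit {a..b} (\<lambda>n. Xs n i) (X i) sequentially"
      then show "continuous_on {a..b} (X ())" by (rule uniform_limit_continuous_on)
    qed (use Fcont C C0 in auto)
  qed
  then obtain X where X: "continuous_on {a..b} (X ())" "\<And>t. t \<in> {a..b} \<Longrightarrow> x0 + integral {a..t} (\<lambda>s. lam s (X () s)) - integral {a..t0} (\<lambda>s. lam s (X () s)) = X () t"
    by blast
  have "((X ()) has_real_derivative lam t (X () t)) (at t within {a..b})" if t: "t \<in> {a..b}" for t
  proof -
    have "((\<lambda>t. x0 + integral {a..t} (\<lambda>s. lam s (X () s)) - integral {a..t0} (\<lambda>s. lam s (X () s))) has_real_derivative lam t (X () t)) (at t within {a..b})"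
      using integral_has_real_derivative[OF comp[OF X(1) order_refl] t] by (auto intro!: derivative_eq_intros)
    then show ?thesis
      by (rule has_field_derivative_transform_within[OF _ zero_less_one t]) (use X(2) in auto)
  qed
  moreover have "X () t0 = x0" using X(2)[OF t0] by simp
  ultimately show ?thesis by blast
qed

text \<open>At the earliest time at which some component of \<open>\<Phi>\<close> reaches \<open>\<nu>\<close>, the hypothesis \<open>step\<close>
  produces an even earlier contact.\<close>
lemma first_contact:
  fixes \<Phi> :: "'i::finite \<Rightarrow> real \<times> real \<Rightarrow> real"
  assumes D: "compact D" and D0: "\<And>t x. (t, x) \<in> D \<Longrightarrow> t \<ge> 0"
    and down: "\<And>t x s. (t, x) \<in> D \<Longrightarrow> 0 \<le> s \<Longrightarrow> s \<le> t \<Longrightarrow> (s, x) \<in> D"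
    and cont: "\<And>i. continuous_on D (\<Phi> i)"
    and init: "\<And>i x. (0, x) \<in> D \<Longrightarrow> \<Phi> i (0, x) < \<nu>"
    and step: "\<And>i t x. (t, x) \<in> D \<Longrightarrow> t > 0 \<Longrightarrow> \<Phi> i (t, x) = \<nu> \<Longrightarrow> (\<And>j. \<Phi> j (t, x) \<le> \<nu>) \<Longrightarrow>
       \<exists>s y. (s, y) \<in> D \<and> s < t \<and> \<Phi> i (s, y) \<ge> \<nu>"
    and p: "p \<in> D"
  shows "\<Phi> i p < \<nu>"
proof (rule ccontr)
  assume nlt: "\<not> \<Phi> i p < \<nu>"
  define E where "E = (\<Union>i. {q \<in> D. \<nu> \<le> \<Phi> i q})"
  have "closed {q \<in> D. \<nu> \<le> \<Phi> i q}" for i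
    using continuous_closed_preimage[OF cont compact_imp_closed[OF D] closed_atLeast[of \<nu>], of i]
    by (simp add: vimage_def Int_def conj_commute)
  then have "compact {q \<in> D. \<nu> \<le> \<Phi> i q}" for i
    using compact_Int_closed[OF D, of "{q \<in> D. \<nu> \<le> \<Phi> i q}"] by (simp add: Int_def conj_commute)
  then have E: "compact E" unfolding E_def by (intro compact_UN) auto
  have "p \<in> E" using nlt p by (auto simp: E_def not_less simp del: split_paired_Ex)
  then have Ene: "E \<noteq> {}" by blast
  obtain m where m: "m \<in> E" "\<And>q. q \<in> E \<Longrightarrow> fst m \<le> fst q"
    using continuous_attains_inf[OF E Ene continuous_on_fst[OF continuous_on_id]] by blast
  obtain t x where tx: "m = (t, x)" by (cases m)
  obtain j where j: "(t, x) \<in> D" "\<nu> \<le> \<Phi> j (t, x)" using m(1) tx by (auto simp: E_def)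
  have t0: "t > 0" using D0[OF j(1)] init[of x j] j by (cases "t = 0") auto
  have early: "\<Phi> k (s, y) < \<nu>" if "(s, y) \<in> D" "s < t" for k s y
    using m(2)[of "(s, y)"] that tx by (force simp: E_def not_le[symmetric])
  \<comment> \<open>A component strictly above \<open>\<nu>\<close> would by continuity be above it
    slightly earlier at the same \<open>x\<close>, a point that \<open>down\<close> keeps in
    \<open>D\<close>.\<close>
  have le: "\<Phi> k (t, x) \<le> \<nu>" for k
  proof (rule ccontr)
    assume "\<not> \<Phi> k (t, x) \<le> \<nu>"
    then obtain d where d: "d > 0" "\<And>q. q \<in> D \<Longrightarrow> dist q (t, x) < d \<Longrightarrow> dist (\<Phi> k q) (\<Phi> k (t, x)) < \<Phi> k (t, x) - \<nu>"
      using cont[of k] j(1) unfolding continuous_on_iff by (metis diff_gt_0_iff_gt not_le)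
    define s where "s = max 0 (t - d / 2)"
    have s: "0 \<le> s" "s < t" "t - s < d" using t0 d(1) by (auto simp: s_def)
    then have sD: "(s, x) \<in> D" using down[OF j(1), of s] by auto
    moreover have "dist (s, x) (t, x) < d" using s by (simp add: dist_Pair_Pair dist_real_def)
    ultimately have "\<Phi> k (s, x) > \<nu>" using d(2)[of "(s, x)"] by (simp add: dist_real_def)
    then show False using early[OF sD s(2), of k] by simp
  qed
  then have "\<Phi> j (t, x) = \<nu>" using j(2) by (simp add: antisym)
  from step[OF j(1) t0 this le] early show False by (meson not_le)
qed

text \<open>Real induction: the supremum of the good initial segments belongs to \<open>A\<close>
  because \<open>A\<close> is closed, and \<open>ext\<close> moves it to the right as long as it is
  below \<open>b\<close>.\<close>

lemma interval_induction:
  fixes a b :: real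
  assumes ab: "a \<le> b" and A: "closed A" "a \<in> A"
    and ext: "\<And>t. t \<in> A \<Longrightarrow> a \<le> t \<Longrightarrow> t < b \<Longrightarrow> \<exists>e>0. \<forall>s. t < s \<longrightarrow> s < t + e \<longrightarrow> s \<le> b \<longrightarrow> s \<in> A"
  shows "{a..b} \<subseteq> A"
proof -
  define S where "S = {t \<in> {a..b}. {a..t} \<subseteq> A}"
  have aS: "a \<in> S" using A ab by (auto simp: S_def)
  have bd: "bdd_above S" by (auto simp: S_def bdd_above_def)
  define c where "c = Sup S"
  have c: "a \<le> c" "c \<le> b" using aS bd by (auto simp: c_def S_def intro!: cSup_upper cSup_least)
  have below: "s \<in> A" if s: "a \<le> s" "s < c" for s
  proof -
    have "\<exists>u\<in>S. s < u" using less_cSupD[of S s] s aS unfolding c_def by blast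
    then show ?thesis using s by (auto simp: S_def)
  qed
  have cA: "c \<in> A"
  proof (cases "c = a")
    case False
    with c have "a < c" by simp
    have "c \<in> closure {a<..<c}" using \<open>a < c\<close> by (simp add: closure_greaterThanLessThan)
    moreover have "{a<..<c} \<subseteq> A" using below by auto
    ultimately show ?thesis using closure_minimal[OF _ A(1)] by blast
  qed (use A in simp)
  have cS: "{a..c} \<subseteq> A" using below cA by (metis atLeastAtMost_iff less_eq_real_def subsetI)
  have "c = b"
  proof (rule ccontr)
    assume "c \<noteq> b"
    with c have cb: "c < b" by simp
    from ext[OF cA c(1) cb] obtain e where e: "e > 0" "\<And>s. c < s \<Longrightarrow> s < c + e \<Longrightarrow> s \<le> b \<Longrightarrow> s \<in> A" by blast
    define u where "u = min b (c + e / 2)"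
    have u: "c < u" "u \<le> b" "u < c + e" using cb e(1) by (auto simp: u_def)
    have "s \<in> A" if "s \<in> {a..u}" for s
      using that cS e(2)[of s] u by (cases "s \<le> c") auto
    then have "u \<in> S" using u c by (auto simp: S_def)
    then have "u \<le> c" unfolding c_def using bd by (rule cSup_upper)
    with u show False by simp
  qed
  with cS show ?thesis by simp
qed

section \<open>A priori estimates\<close>

text \<open>The antiderivative of \<open>h powr ((\<gamma> - 3) / 2)\<close> that vanishes at the
  rest state \<open>h = 1\<close>, so that all Riemann invariants are zero outside the support of
  the perturbation.\<close>

definition RK :: "real \<Rightarrow> real \<Rightarrow> real" where
  "RK \<gamma> h = (if \<gamma> = 1 then ln h else 2 / (\<gamma> - 1) * (h powr ((\<gamma> - 1) / 2) - 1))"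

text \<open>Inverse of \<open>RK\<close> on the half-line where the base of the power is
  positive.\<close>

definition RH :: "real \<Rightarrow> real \<Rightarrow> real" where
  "RH \<gamma> r = (if \<gamma> = 1 then exp r else (1 + (\<gamma> - 1) / 2 * r) powr (2 / (\<gamma> - 1)))"

lemma RK_one [simp]: "RK \<gamma> 1 = 0" by (simp add: RK_def)

lemma RK_deriv:
  assumes "h > 0" shows "(RK \<gamma> has_real_derivative h powr ((\<gamma> - 3) / 2)) (at h)"
proof (cases "\<gamma> = 1")
  case True
  then show ?thesis using assms unfolding RK_def by (auto intro!: derivative_eq_intros simp: powr_minus field_simps)
next
  case False
  have "((\<lambda>h. 2 / (\<gamma> - 1) * (h powr ((\<gamma> - 1) / 2) - 1)) has_real_derivative 2 / (\<gamma> - 1) * ((\<gamma> - 1) / 2 * h powr ((\<gamma> - 1) / 2 - 1))) (at h)"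
    using has_real_derivative_powr[OF assms, of "(\<gamma> - 1) / 2"] assms by (auto intro!: derivative_eq_intros)
  moreover have "2 / (\<gamma> - 1) * ((\<gamma> - 1) / 2 * h powr ((\<gamma> - 1) / 2 - 1)) = h powr ((\<gamma> - 3) / 2)"
  proof -
    have z: "2 / (\<gamma> - 1) * ((\<gamma> - 1) / 2 * z) = z" for z using False by simp
    show ?thesis unfolding z by (rule arg_cong[of _ _ "\<lambda>a. h powr a"]) (simp add: field_simps)
  qed
  ultimately show ?thesis using False unfolding RK_def by simp
qed

lemma RK_strict_mono: assumes "0 < a" "a < b" shows "RK \<gamma> a < RK \<gamma> b"
proof (rule DERIV_pos_imp_increasing[OF assms(2)])
  fix x assume "a \<le> x" "x \<le> b"
  then show "\<exists>y. (RK \<gamma> has_real_derivative y) (at x) \<and> y > 0"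
    using RK_deriv[of x \<gamma>] assms by auto
qed

lemma RK_le_iff: "0 < a \<Longrightarrow> 0 < b \<Longrightarrow> RK \<gamma> a \<le> RK \<gamma> b \<longleftrightarrow> a \<le> b"
  using RK_strict_mono[of a b \<gamma>] RK_strict_mono[of b a \<gamma>] by (cases a b rule: linorder_cases) auto

lemma RK_inj: "0 < a \<Longrightarrow> 0 < b \<Longrightarrow> RK \<gamma> a = RK \<gamma> b \<Longrightarrow> a = b"
  by (metis RK_le_iff antisym order_refl)

lemma RK_RH: assumes "\<gamma> \<ge> 1" "1 + (\<gamma> - 1) / 2 * r > 0" shows "RK \<gamma> (RH \<gamma> r) = r"
proof (cases "\<gamma> = 1")
  case False
  have "RH \<gamma> r powr ((\<gamma> - 1) / 2) = 1 + (\<gamma> - 1) / 2 * r"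
  proof -
    have "2 / (\<gamma> - 1) * ((\<gamma> - 1) / 2) = 1" using False by simp
    then show ?thesis using assms False by (simp only: RH_def powr_powr if_False powr_one)
  qed
  then show ?thesis using False assms by (simp add: RK_def)
qed (simp add: RK_def RH_def)

lemma RH_pos: assumes "1 + (\<gamma> - 1) / 2 * r > 0" shows "RH \<gamma> r > 0"
  using assms by (auto simp: RH_def)

lemma RK_range: assumes "\<gamma> \<ge> 1" "h > 0" shows "1 + (\<gamma> - 1) / 2 * RK \<gamma> h > 0"
proof (cases "\<gamma> = 1")
  case False
  then have "(\<gamma> - 1) / 2 * (2 / (\<gamma> - 1) * z) = z" for z by simp
  then have "(\<gamma> - 1) / 2 * RK \<gamma> h = h powr ((\<gamma> - 1) / 2) - 1" using False by (simp only: RK_def if_False)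
  then have "1 + (\<gamma> - 1) / 2 * RK \<gamma> h = h powr ((\<gamma> - 1) / 2)" by linarith
  then show ?thesis using assms(2) by (simp only:) simp
qed simp

lemma RH_RK: assumes "\<gamma> \<ge> 1" "h > 0" shows "RH \<gamma> (RK \<gamma> h) = h"
  using RK_inj[of "RH \<gamma> (RK \<gamma> h)" h \<gamma>] RK_RH[of \<gamma> "RK \<gamma> h"] RH_pos RK_range[OF assms] assms by auto

text \<open>Monotonicity compares \<open>h\<close> with \<open>RH\<close> of a sufficiently large
  argument. The absolute value of \<open>q\<close> is used because for \<open>\<gamma> > 1\<close>
  the range of \<open>RK\<close> is bounded below.\<close>

lemma RK_unbounded: assumes "\<gamma> \<ge> 1" shows "\<exists>b>0. \<forall>h>0. RK \<gamma> h \<le> q \<longrightarrow> h \<le> b"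
proof -
  have r: "1 + (\<gamma> - 1) / 2 * \<bar>q\<bar> > 0"
    using assms by (intro add_pos_nonneg mult_nonneg_nonneg) auto
  have "h \<le> RH \<gamma> \<bar>q\<bar>" if "h > 0" "RK \<gamma> h \<le> q" for h
  proof -
    have "RK \<gamma> h \<le> RK \<gamma> (RH \<gamma> \<bar>q\<bar>)" using that RK_RH[OF assms r] by simp
    then show ?thesis using RK_le_iff[of h "RH \<gamma> \<bar>q\<bar>" \<gamma>] that RH_pos[OF r] by blast
  qed
  then show ?thesis using RH_pos[OF r] by blast
qed

lemma powr_half_identities:
  fixes h \<gamma> :: real assumes "h > 0"
  shows "h powr ((\<gamma> + 1) / 2) = h powr ((\<gamma> - 3) / 2) * h\<^sup>2"
    and "h powr ((\<gamma> - 1) / 2) = h powr ((\<gamma> - 3) / 2) * h"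
    and "h powr (\<gamma> - 1) = h powr ((\<gamma> - 3) / 2) * h powr ((\<gamma> - 3) / 2) * h\<^sup>2"
proof -
  have 2: "h\<^sup>2 = h powr 2" using assms by simp
  have 1: "h = h powr 1" using assms by simp
  show "h powr ((\<gamma> + 1) / 2) = h powr ((\<gamma> - 3) / 2) * h\<^sup>2"
    unfolding 2 powr_add[symmetric] by (rule arg_cong[of _ _ "\<lambda>a. h powr a"]) (simp add: field_simps)
  show "h powr ((\<gamma> - 1) / 2) = h powr ((\<gamma> - 3) / 2) * h"
    by (subst (3) 1, unfold powr_add[symmetric]) (rule arg_cong[of _ _ "\<lambda>a. h powr a"], simp add: field_simps)
  show "h powr (\<gamma> - 1) = h powr ((\<gamma> - 3) / 2) * h powr ((\<gamma> - 3) / 2) * h\<^sup>2"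
    unfolding 2 powr_add[symmetric] by (rule arg_cong[of _ _ "\<lambda>a. h powr a"]) (simp add: field_simps)
qed

instance comp :: finite
proof
  have "(UNIV :: comp set) \<subseteq> {Rp, Rm, Vc}" using comp.exhaust by auto
  then show "finite (UNIV :: comp set)" by (rule finite_subset) auto
qed

section \<open>The diagonal form of a classical solution and finite speed of propagation\<close>

locale solution =
  fixes \<gamma> T :: real and h u v :: "real \<Rightarrow> real \<Rightarrow> real"
  assumes \<gamma>: "\<gamma> \<ge> 1" and T: "T \<ge> 0" and sol: "classical_solution \<gamma> {0..T} h u v"
begin

text \<open>The derivative of \<open>RK\<close> at \<open>h\<close>; hence \<open>q * h_x\<close> is
  the space derivative of \<open>RK \<gamma> h\<close>.\<close>

definition "q t x = h t x powr ((\<gamma> - 3) / 2)"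

definition "cs t x = h t x powr ((\<gamma> + 1) / 2)"

fun rie :: "comp \<Rightarrow> real \<Rightarrow> real \<Rightarrow> real" where
  "rie Rp t x = u t x + RK \<gamma> (h t x)"
| "rie Rm t x = u t x - RK \<gamma> (h t x)"
| "rie Vc t x = v t x"

fun riex :: "comp \<Rightarrow> real \<Rightarrow> real \<Rightarrow> real" where
  "riex Rp t x = dxi u t x + q t x * dxi h t x"
| "riex Rm t x = dxi u t x - q t x * dxi h t x"
| "riex Vc t x = dxi v t x"

lemma pos: "t \<in> {0..T} \<Longrightarrow> h t x > 0" using sol by (auto simp: classical_solution_def)

lemma cont: "f \<in> {h, u, v} \<Longrightarrow> continuous_on ({0..T} \<times> UNIV) (\<lambda>(t, x). f t x)"
  and contx: "f \<in> {h, u, v} \<Longrightarrow> continuous_on ({0..T} \<times> UNIV) (\<lambda>(t, x). dxi f t x)"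
  using sol unfolding classical_solution_def by blast+

lemmas cont' = cont[unfolded case_prod_beta] and contx' = contx[unfolded case_prod_beta]

lemma fields_cont: "continuous_on ({0..T} \<times> UNIV) (\<lambda>p. h (fst p) (snd p))"
  "continuous_on ({0..T} \<times> UNIV) (\<lambda>p. u (fst p) (snd p))"
  "continuous_on ({0..T} \<times> UNIV) (\<lambda>p. v (fst p) (snd p))"
  "continuous_on ({0..T} \<times> UNIV) (\<lambda>p. dxi h (fst p) (snd p))"
  "continuous_on ({0..T} \<times> UNIV) (\<lambda>p. dxi u (fst p) (snd p))"
  "continuous_on ({0..T} \<times> UNIV) (\<lambda>p. dxi v (fst p) (snd p))"
  using cont'[of h] cont'[of u] cont'[of v] contx'[of h] contx'[of u] contx'[of v] by auto

lemma dx: "f \<in> {h, u, v} \<Longrightarrow> t \<in> {0..T} \<Longrightarrow> (f t has_real_derivative dxi f t x) (at x)"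
  using sol unfolding classical_solution_def dxi_def
  by (metis DERIV_deriv_iff_real_differentiable)

lemma ht: "t \<in> {0..T} \<Longrightarrow> ((\<lambda>s. h s x) has_real_derivative - (h t x)\<^sup>2 * dxi u t x) (at t within {0..T})"
  and ut: "t \<in> {0..T} \<Longrightarrow> ((\<lambda>s. u s x) has_real_derivative v t x - h t x powr (\<gamma> - 1) * dxi h t x) (at t within {0..T})"
  and vt: "t \<in> {0..T} \<Longrightarrow> ((\<lambda>s. v s x) has_real_derivative - u t x) (at t within {0..T})"
  using sol unfolding classical_solution_def by blast+

lemma cs_pos: "t \<in> {0..T} \<Longrightarrow> cs t x > 0"
  using pos[of t x] by (simp add: cs_def)

lemma cs_eq: "t \<in> {0..T} \<Longrightarrow> cs t x = q t x * (h t x)\<^sup>2"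
  unfolding cs_def q_def by (rule powr_half_identities(1)[OF pos])

lemma q_cont: "continuous_on ({0..T} \<times> UNIV) (\<lambda>(t, x). q t x)"
  unfolding q_def case_prod_beta
  using pos by (intro continuous_intros fields_cont) (auto simp: less_imp_neq[symmetric])

lemma cs_cont: "continuous_on ({0..T} \<times> UNIV) (\<lambda>(t, x). cs t x)"
  unfolding cs_def case_prod_beta
  using pos by (intro continuous_intros fields_cont) (auto simp: less_imp_neq[symmetric])

lemma RK_cont: "continuous_on {0<..} (RK \<gamma>)"
  using RK_deriv by (intro continuous_at_imp_continuous_on) (auto dest: DERIV_isCont)

lemma rie_cont: "continuous_on ({0..T} \<times> UNIV) (\<lambda>(t, x). rie i t x)"
proof -
  have "continuous_on ({0..T} \<times> UNIV) (\<lambda>p. RK \<gamma> (h (fst p) (snd p)))"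
    using pos by (intro continuous_on_compose2[OF RK_cont] fields_cont) auto
  then show ?thesis unfolding case_prod_beta
    by (cases i) (auto intro!: continuous_intros fields_cont)
qed

lemma riex_cont: "continuous_on ({0..T} \<times> UNIV) (\<lambda>(t, x). riex i t x)"
  using q_cont unfolding case_prod_beta
  by (cases i) (auto intro!: continuous_intros fields_cont)

lemma rie_dx: assumes "t \<in> {0..T}" shows "(rie i t has_real_derivative riex i t x) (at x)"
proof -
  have "((\<lambda>x. RK \<gamma> (h t x)) has_real_derivative q t x * dxi h t x) (at x)"
    unfolding q_def by (rule DERIV_chain2[where g = "h t" and x = x, OF RK_deriv[OF pos[OF assms]] dx[of h, OF _ assms]]) simp
  moreover have "rie i t = (case i of Rp \<Rightarrow> \<lambda>x. u t x + RK \<gamma> (h t x) | Rm \<Rightarrow> \<lambda>x. u t x - RK \<gamma> (h t x) | Vc \<Rightarrow> v t)"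
    by (cases i) (auto simp: fun_eq_iff)
  ultimately show ?thesis
    by (cases i) (auto intro!: derivative_eq_intros dx assms)
qed

text \<open>The factorisations \<open>cs = q * h^2\<close> and
  \<open>h powr (\<gamma> - 1) = q^2 * h^2\<close> combine the terms from the density and the
  velocity equation into \<open>cs\<close> times a single \<open>riex\<close>.\<close>

lemma rie_dt: assumes t: "t \<in> {0..T}"
  shows "((\<lambda>s. rie i s x) has_real_derivative src i (\<lambda>j. rie j t x) - sg i * cs t x * riex i t x) (at t within {0..T})"
proof -
  have K: "((\<lambda>s. RK \<gamma> (h s x)) has_real_derivative q t x * (- (h t x)\<^sup>2 * dxi u t x)) (at t within {0..T})"
    unfolding q_def by (rule DERIV_chain2[where g = "\<lambda>s. h s x", OF RK_deriv[OF pos[OF t]] ht[OF t]])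
  have e: "h t x powr (\<gamma> - 1) = q t x * q t x * (h t x)\<^sup>2" "cs t x = q t x * (h t x)\<^sup>2"
    using powr_half_identities(3)[OF pos[OF t], of x \<gamma>] cs_eq[OF t] by (simp_all add: q_def)
  note ut' = ut[OF t, of x, unfolded e(1)]
  show ?thesis
    by (cases i) (auto intro!: derivative_eq_intros K ut' vt[OF t] simp: e(2) algebra_simps)
qed

lemma rie_mid: "mid (\<lambda>j. rie j t x) = RK \<gamma> (h t x)" by (simp add: mid_def)

text \<open>At \<open>h = 1\<close> the speed is 1, and \<open>2 powr (2 / (\<gamma> + 1))\<close>
  is the density at which it is 2. Small invariants therefore propagate inside a cone of slope
  2.\<close>

lemma rie_small_speed:
  assumes t: "t \<in> {0..T}" and le: "\<And>j. \<bar>rie j t x\<bar> \<le> m" and m: "m < RK \<gamma> (2 powr (2 / (\<gamma> + 1)))"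
  shows "cs t x \<le> 2"
proof -
  have "RK \<gamma> (h t x) \<le> m" using abs_mid_le[of "\<lambda>j. rie j t x", OF le] by (simp add: rie_mid)
  then have "h t x \<le> 2 powr (2 / (\<gamma> + 1))"
    using RK_le_iff[where a = "h t x" and \<gamma> = \<gamma> and b = "2 powr (2 / (\<gamma> + 1))", OF pos[OF t]] m by auto
  then have "cs t x \<le> (2 powr (2 / (\<gamma> + 1))) powr ((\<gamma> + 1) / 2)"
    unfolding cs_def using pos[OF t, of x] \<gamma> by (intro powr_mono2) auto
  also have "\<dots> = 2"
  proof -
    have "2 / (\<gamma> + 1) * ((\<gamma> + 1) / 2) = 1" using \<gamma> by simp
    then show ?thesis by (simp only: powr_powr) simp
  qed
  finally show ?thesis .
qed

definition "\<Phi> i p = (rie i (fst p) (snd p))\<^sup>2 * exp (- 4 * fst p)"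

lemma \<Phi>_cont: assumes "D \<subseteq> {0..T} \<times> UNIV" shows "continuous_on D (\<Phi> i)"
  unfolding \<Phi>_def
  by (rule continuous_on_subset[OF _ assms]) (use rie_cont[of i] in \<open>auto simp: case_prod_beta intro!: continuous_intros\<close>)

text \<open>The factor \<open>exp (- 4 t)\<close> outweighs the growth produced by the source terms.\<close>
lemma \<Phi>_step:
  assumes t: "t \<in> {0..T}" "t > 0" and pos\<Phi>: "\<Phi> i (t, x) > 0" and max: "\<And>j. \<Phi> j (t, x) \<le> \<Phi> i (t, x)"
  shows "\<exists>d>0. \<forall>k. 0 < k \<longrightarrow> k < d \<longrightarrow> k \<le> t \<longrightarrow> \<Phi> i (t - k, x - sg i * cs t x * k) > \<Phi> i (t, x)"
proof -
  define c where "c = sg i * cs t x"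
  \<comment> \<open>A straight line tangent to the characteristic at the contact point; the
    derivative at \<open>t\<close> sees only this slope.\<close>
  define \<zeta> where "\<zeta> s = x + c * (s - t)" for s
  have \<zeta>t: "\<zeta> t = x" by (simp add: \<zeta>_def)
  have d\<zeta>: "(\<zeta> has_real_derivative c) (at t within {0..t})" unfolding \<zeta>_def by (auto intro!: derivative_eq_intros)
  have "((\<lambda>s. rie i s (\<zeta> s)) has_real_derivative (src i (\<lambda>j. rie j t (\<zeta> t)) - sg i * cs t (\<zeta> t) * riex i t (\<zeta> t)) + riex i t (\<zeta> t) * c) (at t within {0..t})"
    by (rule DERIV_along_curve[OF rie_dt[OF t(1)] _ riex_cont t(1) d\<zeta>]) (use t in \<open>auto intro: rie_dx\<close>)
  then have D: "((\<lambda>s. rie i s (\<zeta> s)) has_real_derivative src i (\<lambda>j. rie j t x)) (at t within {0..t})"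
    by (simp add: \<zeta>t c_def algebra_simps)
  define R where "R = rie i t x"
  have \<Phi>R: "\<Phi> i (t, x) = R\<^sup>2 * exp (- 4 * t)" by (simp add: \<Phi>_def R_def)
  have "\<bar>rie j t x\<bar> \<le> \<bar>R\<bar>" for j
    using max[of j] by (simp add: \<Phi>_def R_def abs_le_square_iff)
  then have srcR: "\<bar>src i (\<lambda>j. rie j t x)\<bar> \<le> \<bar>R\<bar>" by (rule abs_src_le)
  have "((\<lambda>s. (rie i s (\<zeta> s))\<^sup>2 * exp (- 4 * s)) has_real_derivative (2 * R * src i (\<lambda>j. rie j t x) - 4 * R\<^sup>2) * exp (- 4 * t)) (at t within {0..t})"
    by (auto intro!: derivative_eq_intros D simp: \<zeta>t R_def algebra_simps)
  moreover have "(2 * R * src i (\<lambda>j. rie j t x) - 4 * R\<^sup>2) * exp (- 4 * t) < 0"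
  proof -
    have "R * src i (\<lambda>j. rie j t x) \<le> \<bar>R\<bar> * \<bar>R\<bar>"
      using mult_left_mono[OF srcR abs_ge_zero[of R]] abs_ge_self[of "R * src i (\<lambda>j. rie j t x)"] by (simp add: abs_mult)
    moreover have "R\<^sup>2 > 0" using pos\<Phi> \<Phi>R by (simp add: zero_less_mult_iff)
    ultimately show ?thesis by (intro mult_neg_pos) (auto simp: power2_eq_square)
  qed
  ultimately obtain d where d: "d > 0" "\<And>k. k > 0 \<Longrightarrow> t - k \<in> {0..t} \<Longrightarrow> k < d \<Longrightarrow>
      (rie i t (\<zeta> t))\<^sup>2 * exp (- 4 * t) < (rie i (t - k) (\<zeta> (t - k)))\<^sup>2 * exp (- 4 * (t - k))"
    using has_real_derivative_neg_dec_left[of "\<lambda>s. (rie i s (\<zeta> s))\<^sup>2 * exp (- 4 * s)"] by meson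
  show ?thesis
  proof (intro exI[of _ d] conjI allI impI)
    fix k assume k: "0 < k" "k < d" "k \<le> t"
    have "\<zeta> (t - k) = x - sg i * cs t x * k" by (simp add: \<zeta>_def c_def)
    then show "\<Phi> i (t - k, x - sg i * cs t x * k) > \<Phi> i (t, x)"
      using d(2)[of k] k t by (simp add: \<Phi>_def \<zeta>t)
  qed (rule d(1))
qed

text \<open>At a first contact with a low level all invariants are at most \<open>m\<close>, so the
  speed is at most 2 and a step back along the characteristic remains in the trapezoid, where the
  weighted square was larger. Hence no low level is reached, and arbitrarily low levels force all
  invariants to be 0.\<close>

lemma domain_of_dependence:
  assumes triv: "\<And>x. p \<le> x \<Longrightarrow> x \<le> r \<Longrightarrow> h 0 x = 1 \<and> u 0 x = 0 \<and> v 0 x = 0"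
    and tx: "t \<in> {0..T}" "p + 2 * t \<le> x" "x \<le> r - 2 * t"
  shows "h t x = 1 \<and> u t x = 0 \<and> v t x = 0"
proof -
  define D where "D = {(t, x). t \<in> {0..T} \<and> p + 2 * t \<le> x \<and> x \<le> r - 2 * t}"
  have Dsub: "D \<subseteq> {0..T} \<times> UNIV" by (auto simp: D_def)
  have "D = ({0..T} \<times> {p..r}) \<inter> ({q. p + 2 * fst q \<le> snd q} \<inter> {q. snd q \<le> r - 2 * fst q})"
    by (auto simp: D_def)
  moreover have "closed {q :: real \<times> real. p + 2 * fst q \<le> snd q}" "closed {q :: real \<times> real. snd q \<le> r - 2 * fst q}"
    by (intro closed_Collect_le continuous_intros)+
  ultimately have cD: "compact D"
    by (simp add: compact_Int_closed compact_Times closed_Int)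
  \<comment> \<open>Half the critical value, as \<open>rie_small_speed\<close> asks for a strict
    inequality.\<close>
  define m where "m = RK \<gamma> (2 powr (2 / (\<gamma> + 1))) / 2"
  have m: "m > 0"
  proof -
    have "1 < (2::real) powr (2 / (\<gamma> + 1))" using \<gamma> by simp
    from RK_strict_mono[OF zero_less_one this, of \<gamma>] show ?thesis by (simp add: m_def)
  qed
  have lt: "\<Phi> i (t, x) < \<nu>" if \<nu>: "0 < \<nu>" "\<nu> \<le> m\<^sup>2 * exp (- 4 * T)" for i \<nu>
  proof (rule first_contact[OF cD])
    show "continuous_on D (\<Phi> i)" for i by (rule \<Phi>_cont[OF Dsub])
    show "\<Phi> i (0, x) < \<nu>" if "(0, x) \<in> D" for i x
      using triv[of x] that \<nu> by (cases i) (auto simp: D_def \<Phi>_def)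
    fix i t x assume tx: "(t, x) \<in> D" and t0: "t > 0" and eq: "\<Phi> i (t, x) = \<nu>" and le: "\<And>j. \<Phi> j (t, x) \<le> \<nu>"
    have t: "t \<in> {0..T}" using tx by (auto simp: D_def)
    have "\<bar>rie j t x\<bar> \<le> m" for j
    proof -
      have "(rie j t x)\<^sup>2 * exp (- 4 * t) \<le> m\<^sup>2 * exp (- 4 * T)" using le[of j] \<nu>(2) by (simp add: \<Phi>_def)
      also have "\<dots> \<le> m\<^sup>2 * exp (- 4 * t)" using t by (intro mult_left_mono) auto
      finally show ?thesis using m by (simp add: abs_le_square_iff[symmetric])
    qed
    then have cs: "0 < cs t x" "cs t x \<le> 2"
      using m t by (auto intro!: rie_small_speed[of t x m] cs_pos simp: m_def)
    obtain d where d: "d > 0" "\<And>k. 0 < k \<Longrightarrow> k < d \<Longrightarrow> k \<le> t \<Longrightarrow> \<Phi> i (t - k, x - sg i * cs t x * k) > \<Phi> i (t, x)"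
      using \<Phi>_step[OF t t0, of i x] eq le \<nu>(1) by auto
    define k where "k = min t (d / 2)"
    have k: "0 < k" "k < d" "k \<le> t" using d(1) t0 by (auto simp: k_def)
    have "\<bar>sg i * (cs t x * k)\<bar> \<le> 2 * k"
      using cs k mult_right_mono[OF cs(2), of k] by (intro order_trans[OF abs_sg_mult_le]) simp
    then have "\<bar>sg i * cs t x * k\<bar> \<le> 2 * k" by (simp add: mult.assoc)
    moreover have "(t - k, x - w) \<in> D" if "\<bar>w\<bar> \<le> 2 * k" for w
      using that tx k by (auto simp: D_def abs_le_iff)
    ultimately have "(t - k, x - sg i * cs t x * k) \<in> D" by blast
    then show "\<exists>s y. (s, y) \<in> D \<and> s < t \<and> \<Phi> i (s, y) \<ge> \<nu>"
      using d(2)[OF k] k(1) eq by (intro exI[of _ "t - k"] exI[of _ "x - sg i * cs t x * k"]) auto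
  qed (use tx in \<open>auto simp: D_def\<close>)
  have "\<Phi> i (t, x) \<le> 0" for i
  proof (rule ccontr)
    assume "\<not> \<Phi> i (t, x) \<le> 0"
    then show False using lt[of "min (\<Phi> i (t, x)) (m\<^sup>2 * exp (- 4 * T))" i] m by auto
  qed
  then have z: "rie i t x = 0" for i
    by (simp add: \<Phi>_def mult_le_0_iff)
  have "v t x = 0" "RK \<gamma> (h t x) = 0" "u t x = 0" using z[of Vc] z[of Rp] z[of Rm] by auto
  then show ?thesis using RK_inj[OF pos[OF tx(1)] zero_less_one, of \<gamma> x] by simp
qed

end

section \<open>Solutions at rest outside a bounded set\<close>

locale localized_solution = solution +
  fixes M0 :: real
  assumes M0: "M0 \<ge> 0" and triv0: "\<And>x. \<bar>x\<bar> \<ge> M0 \<Longrightarrow> h 0 x = 1 \<and> u 0 x = 0 \<and> v 0 x = 0"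
begin

text \<open>The base of the trapezoid runs from the edge of the support to \<open>2 * t\<close>
  beyond \<open>x\<close>, just far enough to have \<open>(t, x)\<close> on its slanted
  side.\<close>

lemma outside: assumes "t \<in> {0..T}" "\<bar>x\<bar> \<ge> M0 + 2 * T" shows "h t x = 1 \<and> u t x = 0 \<and> v t x = 0"
proof (cases "x \<ge> 0")
  case True
  show ?thesis
    by (rule domain_of_dependence[of M0 "x + 2 * t" t x]) (use triv0 True assms M0 in auto)
next
  case False
  show ?thesis
    by (rule domain_of_dependence[of "x - 2 * t" "- M0" t x]) (use triv0 False assms M0 in auto)
qed

lemma outside_dx:
  assumes "t \<in> {0..T}" "\<bar>x\<bar> > M0 + 2 * T" "f \<in> {h, u, v}" shows "dxi f t x = 0"
proof -
  have op: "open {x :: real. \<bar>x\<bar> > M0 + 2 * T}" by (intro open_Collect_less continuous_intros)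
  define k where "k = f t x"
  have "(f t has_real_derivative 0) (at x)"
    by (rule has_field_derivative_transform_within_open[of "\<lambda>_. k" _ _ "{x. \<bar>x\<bar> > M0 + 2 * T}", OF _ op])
      (use outside[OF assms(1)] assms(2,3) in \<open>auto simp: k_def\<close>)
  then show ?thesis using dx[OF assms(3,1)] DERIV_unique by blast
qed

text \<open>The margin 1 leaves room for one step back along a characteristic from any point of the
  disturbed region.\<close>

definition "slab = {0..T} \<times> {- (M0 + 2 * T + 1)..M0 + 2 * T + 1}"

lemma slab_compact: "compact slab" by (simp add: slab_def compact_Times)

lemma slab_sub: "slab \<subseteq> {0..T} \<times> UNIV" by (auto simp: slab_def)

text \<open>A contact with a level above \<open>N\<^sup>2\<close> lies in the disturbed region;
  \<open>\<Phi>_step\<close> with a step of at most \<open>1 / cs\<close> then finds a larger value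
  earlier in the slab. The rate \<open>2\<close> is half of the rate \<open>4\<close> in
  \<open>\<Phi>\<close>, a square.\<close>

lemma rie_bound:
  assumes N: "\<And>i x. \<bar>rie i 0 x\<bar> \<le> N" and t: "t \<in> {0..T}"
  shows "\<bar>rie i t x\<bar> \<le> N * exp (2 * t)"
proof -
  have N0: "N \<ge> 0" using N[of Rp 0] by linarith
  have out: "rie i t x = 0" if "t \<in> {0..T}" "\<bar>x\<bar> \<ge> M0 + 2 * T" for i t x
    using outside[OF that] by (cases i) auto
  have lt: "\<Phi> i p < \<nu>" if \<nu>: "N\<^sup>2 < \<nu>" and p: "p \<in> slab" for i \<nu> p
  proof (rule first_contact[OF slab_compact _ _ _ _ _ p])
    show "continuous_on slab (\<Phi> i)" for i by (rule \<Phi>_cont[OF slab_sub])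
    have \<nu>0: "\<nu> > 0" using \<nu> by (smt (verit) zero_le_power2)
    show "\<Phi> i (0, x) < \<nu>" if "(0, x) \<in> slab" for i x
    proof -
      have "(rie i 0 x)\<^sup>2 \<le> N\<^sup>2" using N[of i x] N0 by (simp add: abs_le_square_iff[symmetric])
      then show ?thesis using \<nu> by (simp add: \<Phi>_def)
    qed
    fix i t x assume tx: "(t, x) \<in> slab" and t0: "t > 0" and eq: "\<Phi> i (t, x) = \<nu>" and le: "\<And>j. \<Phi> j (t, x) \<le> \<nu>"
    have t: "t \<in> {0..T}" using tx by (auto simp: slab_def)
    have xin: "\<bar>x\<bar> < M0 + 2 * T"
    proof (rule ccontr)
      assume "\<not> \<bar>x\<bar> < M0 + 2 * T"
      then have "rie i t x = 0" using out[OF t, of x i] by simp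
      then show False using eq \<nu>0 by (simp add: \<Phi>_def)
    qed
    obtain d where d: "d > 0" "\<And>k. 0 < k \<Longrightarrow> k < d \<Longrightarrow> k \<le> t \<Longrightarrow> \<Phi> i (t - k, x - sg i * cs t x * k) > \<Phi> i (t, x)"
      using \<Phi>_step[OF t t0, of i x] eq le \<nu>0 by auto
    have c: "cs t x > 0" by (rule cs_pos[OF t])
    define k where "k = min (min t (d / 2)) (1 / cs t x)"
    have k: "0 < k" "k < d" "k \<le> t" "k \<le> 1 / cs t x" using d(1) t0 c by (auto simp: k_def)
    have "\<bar>sg i * (cs t x * k)\<bar> \<le> 1"
      using c k by (intro order_trans[OF abs_sg_mult_le]) (simp add: field_simps)
    then have "\<bar>sg i * cs t x * k\<bar> \<le> 1" by (simp add: mult.assoc)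
    moreover have "(t - k, x - w) \<in> slab" if "\<bar>w\<bar> \<le> 1" for w
      using that t xin k by (auto simp: slab_def abs_le_iff abs_less_iff)
    ultimately have "(t - k, x - sg i * cs t x * k) \<in> slab" by blast
    then show "\<exists>s y. (s, y) \<in> slab \<and> s < t \<and> \<Phi> i (s, y) \<ge> \<nu>"
      using d(2)[OF k(1-3)] k(1) eq by (intro exI[of _ "t - k"] exI[of _ "x - sg i * cs t x * k"]) auto
  qed (auto simp: slab_def)
  show ?thesis
  proof (cases "\<bar>x\<bar> \<ge> M0 + 2 * T")
    case True then show ?thesis using out[OF t True, of i] N0 by simp
  next
    case False
    then have "(t, x) \<in> slab" using t by (auto simp: slab_def)
    from lt[OF _ this, of _ i] have "\<Phi> i (t, x) \<le> N\<^sup>2" by (meson dense_ge less_imp_le)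
    then have "(rie i t x)\<^sup>2 * exp (- (4 * t)) \<le> N\<^sup>2" by (simp add: \<Phi>_def)
    then have "(rie i t x)\<^sup>2 \<le> N\<^sup>2 * exp (4 * t)" by (simp add: exp_minus field_simps)
    also have "\<dots> = (N * exp (2 * t))\<^sup>2" by (simp add: power_mult_distrib exp_double[symmetric])
    finally show ?thesis using N0 by (simp add: abs_le_square_iff[symmetric] abs_mult)
  qed
qed

end

lemma DERIV_le_imp_increment_le:
  fixes f f' :: "real \<Rightarrow> real"
  assumes "a \<le> b" "\<And>s. s \<in> {a..b} \<Longrightarrow> (f has_real_derivative f' s) (at s within {a..b})" "\<And>s. s \<in> {a..b} \<Longrightarrow> f' s \<le> c"
  shows "f b - f a \<le> c * (b - a)"
proof (cases "a = b")
  case False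
  with assms(1) have ab: "a < b" by simp
  have "\<exists>x\<in>{a<..<b}. f b - f a = f' x * (b - a)"
    using mvt_simple[OF ab, of f "\<lambda>s h. f' s * h"] assms(2) by (auto simp: has_field_derivative_def)
  then show ?thesis using assms(3) ab by (auto intro!: mult_right_mono)
qed simp

section \<open>The Riccati equations and the conservation of vorticity\<close>

context solution begin

text \<open>A Boolean indexes the two moving families so that \<open>\<not> b\<close> denotes the
  other one; \<open>True\<close> is \<open>j = 2\<close>, \<open>False\<close> is
  \<open>j = 1\<close>.\<close>

definition "cb b = (if b then Rp else Rm)"

definition "sb b = (if b then 1 else - 1 :: real)"

definition "Z b t x = sqrt (h t x) * riex (cb b) t x"

definition "csx t x = (\<gamma> + 1) / 2 * (q t x * h t x) * dxi h t x"

text \<open>The right-hand side of the Riccati equation, still with \<open>v_x\<close>;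
  \<open>vorticity\<close> later replaces it by initial data and \<open>- 1/h\<close>.\<close>

definition "ric b t x = sqrt (h t x) * (dxi v t x - (\<gamma> + 1) / 4 * (Z b t x)\<^sup>2 + (\<gamma> - 1) / 4 * (Z b t x * Z (\<not> b) t x))"

lemma Zw_eq: "Zw \<gamma> h u 1 t x = Z False t x" "Zw \<gamma> h u 2 t x = Z True t x"
  by (simp_all add: Zw_def Z_def cb_def q_def)

lemma sg_cb: "sg (cb b) = sb b" by (simp add: sb_def cb_def)

lemma src_cb: "src (cb b) y = y Vc" by (simp add: cb_def)

lemma cs_dx: assumes t: "t \<in> {0..T}" shows "(cs t has_real_derivative csx t x) (at x)"
proof -
  have "((\<lambda>x. h t x powr ((\<gamma> + 1) / 2)) has_real_derivative (\<gamma> + 1) / 2 * h t x powr ((\<gamma> + 1) / 2 - 1) * dxi h t x) (at x)"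
    by (rule DERIV_chain2[where g = "h t" and x = x, OF has_real_derivative_powr[OF pos[OF t]] dx[of h, OF _ t]]) simp
  moreover have "(\<gamma> + 1) / 2 - 1 = (\<gamma> - 1) / 2" by (simp add: field_simps)
  ultimately show ?thesis
    unfolding cs_def[abs_def] csx_def q_def by (simp only: powr_half_identities(2)[OF pos[OF t]])
qed

lemma csx_cont: "continuous_on ({0..T} \<times> UNIV) (\<lambda>(t, x). csx t x)"
  using q_cont unfolding csx_def case_prod_beta by (auto intro!: continuous_intros fields_cont)

lemma Z_cont: "continuous_on ({0..T} \<times> UNIV) (\<lambda>(t, x). Z b t x)"
  using riex_cont[of "cb b"] unfolding Z_def case_prod_beta by (auto intro!: continuous_intros fields_cont)

text \<open>Along the family \<open>\<beta>\<close> the density changes at the rate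
  \<open>- h^2\<close> times the gradient of the other family, so differentiating the weight yields
  a mixed product. The derivative of the speed contains \<open>h_x\<close>, half the difference of
  the two gradients up to a factor, and yields the square and a further mixed product.\<close>

lemma Z_along:
  assumes t: "t \<in> {a..b}" and ab: "{a..b} \<subseteq> {0..T}"
    and \<zeta>: "\<And>s. s \<in> {a..b} \<Longrightarrow> (\<zeta> has_real_derivative sb \<beta> * cs s (\<zeta> s)) (at s within {a..b})"
  shows "((\<lambda>s. Z \<beta> s (\<zeta> s)) has_real_derivative ric \<beta> t (\<zeta> t)) (at t within {a..b})"
proof -
  have t': "t \<in> {0..T}" using t ab by auto
  have w: "((\<lambda>s. riex (cb \<beta>) s (\<zeta> s)) has_real_derivative dxi v t (\<zeta> t) - (sb \<beta> * csx t (\<zeta> t)) * riex (cb \<beta>) t (\<zeta> t)) (at t within {a..b})"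
  proof (rule DERIV_x_derivative_along_characteristic[where f = "rie (cb \<beta>)" and g = v and lam = "\<lambda>t x. sb \<beta> * cs t x" and I = "{0..T}", OF t ab \<zeta>])
    show "((\<lambda>r. rie (cb \<beta>) r x) has_real_derivative v s x - sb \<beta> * cs s x * riex (cb \<beta>) s x) (at s within {0..T})"
      if "s \<in> {0..T}" for s x using rie_dt[OF that, of "cb \<beta>" x] by (simp add: sg_cb src_cb)
    show "((\<lambda>x. sb \<beta> * cs s x) has_real_derivative sb \<beta> * csx s y) (at y)" if "s \<in> {0..T}" for s y
      by (rule DERIV_cmult[OF cs_dx[OF that]])
    show "continuous_on ({0..T} \<times> UNIV) (\<lambda>(t, x). sb \<beta> * csx t x)"
      using csx_cont unfolding case_prod_beta by (intro continuous_intros)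
  qed (use riex_cont rie_dx dx contx in auto)
  define H where "H = h t (\<zeta> t)"
  have H: "H > 0" using pos[OF t'] by (simp add: H_def)
  have h': "((\<lambda>s. h s (\<zeta> s)) has_real_derivative (- H\<^sup>2 * dxi u t (\<zeta> t)) + dxi h t (\<zeta> t) * (sb \<beta> * cs t (\<zeta> t))) (at t within {a..b})"
    unfolding H_def
    by (rule DERIV_along_curve[OF ht[OF t'] _ contx t' \<zeta>[OF t] ab]) (auto intro: dx)
  have rt: "((\<lambda>s. sqrt (h s (\<zeta> s))) has_real_derivative inverse (sqrt H) / 2 * ((- H\<^sup>2 * dxi u t (\<zeta> t)) + dxi h t (\<zeta> t) * (sb \<beta> * cs t (\<zeta> t)))) (at t within {a..b})"
    using DERIV_chain2[where g = "\<lambda>s. h s (\<zeta> s)" and x = t, OF DERIV_real_sqrt h'] H by (simp add: H_def)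
  have "((\<lambda>s. Z \<beta> s (\<zeta> s)) has_real_derivative
     inverse (sqrt H) / 2 * ((- H\<^sup>2 * dxi u t (\<zeta> t)) + dxi h t (\<zeta> t) * (sb \<beta> * cs t (\<zeta> t))) * riex (cb \<beta>) t (\<zeta> t)
      + (dxi v t (\<zeta> t) - (sb \<beta> * csx t (\<zeta> t)) * riex (cb \<beta>) t (\<zeta> t)) * sqrt H) (at t within {a..b})"
    using DERIV_mult[OF rt w] unfolding Z_def H_def by (simp add: algebra_simps)
  moreover have "inverse (sqrt H) / 2 * ((- H\<^sup>2 * dxi u t (\<zeta> t)) + dxi h t (\<zeta> t) * (sb \<beta> * cs t (\<zeta> t))) * riex (cb \<beta>) t (\<zeta> t)
      + (dxi v t (\<zeta> t) - (sb \<beta> * csx t (\<zeta> t)) * riex (cb \<beta>) t (\<zeta> t)) * sqrt H = ric \<beta> t (\<zeta> t)"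
  proof -
    define r where "r = sqrt H"
    have r: "r > 0" "H = r\<^sup>2" using H by (simp_all add: r_def)
    define g where "g = q t (\<zeta> t) * dxi h t (\<zeta> t)"
    define ux where "ux = dxi u t (\<zeta> t)"
    define e where "e = sb \<beta>"
    have e: "e * e = 1" by (simp add: e_def sb_def)
    have w1: "riex (cb \<beta>) t (\<zeta> t) = ux + e * g" and w2: "riex (cb (\<not> \<beta>)) t (\<zeta> t) = ux - e * g"
      by (auto simp: cb_def sb_def e_def ux_def g_def)
    have c1: "dxi h t (\<zeta> t) * (sb \<beta> * cs t (\<zeta> t)) = e * g * r\<^sup>2 * r\<^sup>2"
      unfolding cs_eq[OF t'] H_def[symmetric] r(2) g_def e_def by (simp add: power2_eq_square)
    have c2: "sb \<beta> * csx t (\<zeta> t) = e * ((\<gamma> + 1) / 2) * g * r\<^sup>2"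
      unfolding csx_def H_def[symmetric] r(2) g_def e_def by simp
    have 1: "inverse r / 2 * (- (r\<^sup>2)\<^sup>2 * ux + e * g * r\<^sup>2 * r\<^sup>2) = - r * r\<^sup>2 / 2 * (ux - e * g)"
      using r(1) by (simp add: power2_eq_square field_simps)
    have 2: "e * (e * z) = z" for z using e by (metis mult.assoc mult_1)
    show ?thesis
      unfolding ric_def Z_def H_def[symmetric] w1 w2 c1 c2 r_def[symmetric] unfolding r(2) ux_def[symmetric] 1
      by (simp add: algebra_simps power2_eq_square 2 add_divide_distrib diff_divide_distrib)
  qed
  ultimately show ?thesis by simp
qed

text \<open>The equation for \<open>v\<close> is transport with speed 0, so the difference-quotient
  lemma gives \<open>- u_x\<close> as time derivative of \<open>v_x\<close>, even though no mixed
  second derivative is given; \<open>1/h\<close> has time derivative \<open>u_x\<close>.\<close>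

lemma vorticity: assumes t: "t \<in> {0..T}" shows "dxi v t x + 1 / h t x = dxi v 0 x + 1 / h 0 x"
proof -
  have v': "((\<lambda>s. dxi v s x) has_real_derivative - dxi u s x) (at s within {0..T})" if s: "s \<in> {0..T}" for s
  proof -
    have "((\<lambda>s. dxi v s ((\<lambda>_. x) s)) has_real_derivative - dxi u s x - 0 * dxi v s x) (at s within {0..T})"
      by (rule DERIV_x_derivative_along_characteristic[where f = v and g = "\<lambda>t x. - u t x" and lam = "\<lambda>t x. 0" and lamx = "\<lambda>t x. 0" and I = "{0..T}" and \<zeta> = "\<lambda>_. x" and gx = "\<lambda>t x. - dxi u t x", OF s])
        (use vt dx contx in \<open>auto intro!: derivative_eq_intros continuous_intros simp: case_prod_beta fields_cont\<close>)
    then show ?thesis by simp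
  qed
  have h': "((\<lambda>s. 1 / h s x) has_real_derivative dxi u s x) (at s within {0..T})" if s: "s \<in> {0..T}" for s
    using pos[OF s, of x] by (auto intro!: derivative_eq_intros ht[OF s] simp: power2_eq_square)
  have "((\<lambda>s. dxi v s x + 1 / h s x) has_real_derivative 0) (at s within {0..T})" if "s \<in> {0..T}" for s
    using DERIV_add[OF v'[OF that] h'[OF that]] by simp
  then have "\<exists>k. \<forall>s\<in>{0..T}. dxi v s x + 1 / h s x = k"
    by (intro has_field_derivative_zero_constant) auto
  then show ?thesis using t T by auto
qed

text \<open>Only upper bounds on \<open>Z\<close> enter, so the resulting lower bound on
  \<open>h\<close> persists while \<open>Z\<close> tends to minus infinity.\<close>

lemma inv_sqrt_growth:
  assumes Z: "\<And>b t x. t \<in> {0..T} \<Longrightarrow> Z b t x \<le> N" and t: "t \<in> {0..T}"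
  shows "1 / sqrt (h t x) \<le> 1 / sqrt (h 0 x) + N / 2 * t"
proof -
  have "((\<lambda>s. 1 / sqrt (h s x)) has_real_derivative (Z True s x + Z False s x) / 4) (at s within {0..t})" if s: "s \<in> {0..t}" for s
  proof -
    have s': "s \<in> {0..T}" using s t by auto
    define r where "r = sqrt (h s x)"
    have r: "r > 0" "h s x = r\<^sup>2" using pos[OF s', of x] by (simp_all add: r_def)
    have D: "((\<lambda>s. sqrt (h s x)) has_real_derivative inverse (sqrt (h s x)) / 2 * (- (h s x)\<^sup>2 * dxi u s x)) (at s within {0..T})"
      using DERIV_chain2[where g = "\<lambda>s. h s x" and x = s, OF DERIV_real_sqrt ht[OF s']] pos[OF s', of x] by simp
    have nz: "sqrt (h s x) \<noteq> 0" using pos[OF s', of x] by simp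
    have "((\<lambda>s. 1 / sqrt (h s x)) has_real_derivative - (inverse r / 2 * (- (r\<^sup>2)\<^sup>2 * dxi u s x)) / (r * r)) (at s within {0..T})"
      using DERIV_divide[OF DERIV_const[of 1] D nz] r(1) unfolding r_def[symmetric] r(2) by simp
    moreover have "- (inverse r / 2 * (- (r\<^sup>2)\<^sup>2 * dxi u s x)) / (r * r) = (Z True s x + Z False s x) / 4"
      using r(1) by (simp add: Z_def cb_def r_def[symmetric] power2_eq_square field_simps)
    ultimately have "((\<lambda>s. 1 / sqrt (h s x)) has_real_derivative (Z True s x + Z False s x) / 4) (at s within {0..T})"
      by (simp only:)
    then show ?thesis by (rule DERIV_subset) (use t in auto)
  qed
  moreover have "(Z True s x + Z False s x) / 4 \<le> N / 2" if "s \<in> {0..t}" for s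
    using Z[of s True x] Z[of s False x] that t by auto
  ultimately have "1 / sqrt (h t x) - 1 / sqrt (h 0 x) \<le> N / 2 * (t - 0)"
    using t by (intro DERIV_le_imp_increment_le) auto
  then show ?thesis by simp
qed

end

section \<open>Upper bounds and barriers for the weighted gradients\<close>

context localized_solution begin

lemma Z_outside: "t \<in> {0..T} \<Longrightarrow> \<bar>x\<bar> > M0 + 2 * T \<Longrightarrow> Z b t x = 0"
  using outside_dx[of t x u] outside_dx[of t x h] by (simp add: Z_def cb_def)

lemma cs_lip: "\<exists>K\<ge>0. \<forall>t\<in>{0..T}. \<forall>x y. \<bar>cs t x - cs t y\<bar> \<le> K * \<bar>x - y\<bar>"
proof -
  have "bounded ((\<lambda>(t, x). csx t x) ` slab)"
    by (intro compact_imp_bounded compact_continuous_image continuous_on_subset[OF csx_cont slab_sub] slab_compact)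
  then obtain K where "\<forall>p\<in>slab. norm ((\<lambda>(t, x). csx t x) p) \<le> K"
    unfolding bounded_iff by blast
  then have K: "\<And>t x. (t, x) \<in> slab \<Longrightarrow> \<bar>csx t x\<bar> \<le> K" by fastforce
  have le: "\<bar>csx t x\<bar> \<le> max K 0" if t: "t \<in> {0..T}" for t x
  proof (cases "\<bar>x\<bar> > M0 + 2 * T")
    case True then show ?thesis using outside_dx[OF t True, of h] by (simp add: csx_def)
  next
    case False
    then have "(t, x) \<in> slab" using t by (auto simp: slab_def)
    from K[OF this] show ?thesis by simp
  qed
  have "\<bar>cs t x - cs t y\<bar> \<le> max K 0 * \<bar>x - y\<bar>" if t: "t \<in> {0..T}" for t x y
    using field_differentiable_bound[of UNIV "cs t" "csx t" "max K 0" x y] cs_dx[OF t] le[OF t] by simp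
  then show ?thesis by (intro exI[of _ "max K 0"]) auto
qed

text \<open>The speed is globally Lipschitz because it is constant far out, so one length
  \<open>d\<close> serves every base point. Short pieces suffice for the contact arguments.\<close>

lemma characteristics:
  "\<exists>d>0. \<forall>a b t0 x0 \<beta>. 0 \<le> a \<longrightarrow> b \<le> T \<longrightarrow> b - a \<le> d \<longrightarrow> t0 \<in> {a..b} \<longrightarrow>
    (\<exists>\<zeta>. \<zeta> t0 = x0 \<and> (\<forall>t\<in>{a..b}. (\<zeta> has_real_derivative sb \<beta> * cs t (\<zeta> t)) (at t within {a..b})))"
proof -
  obtain K where K: "K \<ge> 0" "\<And>t x y. t \<in> {0..T} \<Longrightarrow> \<bar>cs t x - cs t y\<bar> \<le> K * \<bar>x - y\<bar>" using cs_lip by blast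
  define d where "d = 1 / (2 * (K + 1))"
  have d: "d > 0" "d * K \<le> 1 / 2" using K(1) by (simp_all add: d_def field_simps)
  show ?thesis
  proof (intro exI[of _ d] conjI allI impI d)
    fix a b t0 x0 :: real and \<beta> :: bool
    assume ab: "0 \<le> a" "b \<le> T" "b - a \<le> d" "t0 \<in> {a..b}"
    show "\<exists>\<zeta>. \<zeta> t0 = x0 \<and> (\<forall>t\<in>{a..b}. (\<zeta> has_real_derivative sb \<beta> * cs t (\<zeta> t)) (at t within {a..b}))"
    proof (rule characteristic_exists[OF _ _ _ ab(4)])
      have "continuous_on ({0..T} \<times> UNIV) (\<lambda>(t, x). sb \<beta> * cs t x)"
        using cs_cont unfolding case_prod_beta by (intro continuous_intros)
      then show "continuous_on ({a..b} \<times> UNIV) (\<lambda>(t, x). sb \<beta> * cs t x)"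
        by (rule continuous_on_subset) (use ab in auto)
      show "\<bar>sb \<beta> * cs t x - sb \<beta> * cs t y\<bar> \<le> K * \<bar>x - y\<bar>" if "t \<in> {a..b}" for t x y
        using K(2)[of t x y] that ab by (auto simp: sb_def)
      show "(b - a) * K \<le> 1 / 2" using mult_right_mono[OF ab(3) K(1)] d(2) by simp
    qed
  qed
qed

text \<open>As \<open>\<gamma> \<ge> 1\<close>, the mixed term has a nonnegative coefficient and may
  be replaced by the square; the two coefficients then add up to \<open>- 1/2\<close> for every
  \<open>\<gamma>\<close>.\<close>

lemma ric_le:
  assumes t: "t \<in> {0..T}" and W: "dxi v 0 x + 1 / h 0 x \<le> W" and zz: "Z b t x * Z (\<not> b) t x \<le> (Z b t x)\<^sup>2"
  shows "ric b t x \<le> sqrt (h t x) * (W - 1 / h t x - (Z b t x)\<^sup>2 / 2)"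
proof -
  have "dxi v t x \<le> W - 1 / h t x" using vorticity[OF t, of x] W by linarith
  moreover have "(\<gamma> - 1) / 4 * (Z b t x * Z (\<not> b) t x) \<le> (\<gamma> - 1) / 4 * (Z b t x)\<^sup>2"
    using zz \<gamma> by (intro mult_left_mono) auto
  moreover have "(\<gamma> - 1) / 4 * (Z b t x)\<^sup>2 - (\<gamma> + 1) / 4 * (Z b t x)\<^sup>2 = - (Z b t x)\<^sup>2 / 2" by (simp add: field_simps)
  ultimately show ?thesis unfolding ric_def
    using pos[OF t, of x] by (intro mult_left_mono) auto
qed

text \<open>At a contact with a level \<open>\<nu> > N\<close> the bound
  \<open>2 * W \<le> N\<^sup>2\<close> makes the Riccati right-hand side negative, so the same
  characteristic carried a value above \<open>\<nu>\<close> before.\<close>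

lemma Z_upper:
  assumes W: "\<And>x. dxi v 0 x + 1 / h 0 x \<le> W" and N: "\<And>b x. Z b 0 x \<le> N" "N \<ge> 0" "2 * W \<le> N\<^sup>2" and t: "t \<in> {0..T}"
  shows "Z b t x \<le> N"
proof (cases "\<bar>x\<bar> > M0 + 2 * T")
  case True then show ?thesis using Z_outside[OF t True] N(2) by simp
next
  case False
  obtain d where d: "d > 0" "\<And>a b t0 x0 \<beta>. 0 \<le> a \<Longrightarrow> b \<le> T \<Longrightarrow> b - a \<le> d \<Longrightarrow> t0 \<in> {a..b} \<Longrightarrow>
    (\<exists>\<zeta>. \<zeta> t0 = x0 \<and> (\<forall>t\<in>{a..b}. (\<zeta> has_real_derivative sb \<beta> * cs t (\<zeta> t)) (at t within {a..b})))"
    using characteristics by blast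
  define F where "F b p = Z b (fst p) (snd p)" for b p
  have "F b p < \<nu>" if \<nu>: "N < \<nu>" and p: "p \<in> slab" for b \<nu> p
  proof (rule first_contact[OF slab_compact _ _ _ _ _ p])
    show "continuous_on slab (F b)" for b
      using continuous_on_subset[OF Z_cont slab_sub, of b] by (simp add: F_def[abs_def] case_prod_beta)
    show "F b (0, x) < \<nu>" if "(0, x) \<in> slab" for b x using N(1)[of b x] \<nu> by (simp add: F_def)
    fix b t x assume tx: "(t, x) \<in> slab" and t0: "t > 0" and eq: "F b (t, x) = \<nu>" and le: "\<And>j. F j (t, x) \<le> \<nu>"
    have t: "t \<in> {0..T}" using tx by (auto simp: slab_def)
    have xin: "\<bar>x\<bar> \<le> M0 + 2 * T"
      using Z_outside[OF t, of x b] eq \<nu> N(2) by (fastforce simp: F_def)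
    define a where "a = max 0 (t - d)"
    have a: "0 \<le> a" "a < t" "t - a \<le> d" using d(1) t0 by (auto simp: a_def)
    obtain \<zeta> where \<zeta>: "\<zeta> t = x" "\<And>s. s \<in> {a..t} \<Longrightarrow> (\<zeta> has_real_derivative sb b * cs s (\<zeta> s)) (at s within {a..t})"
      using d(2)[of a t t x b] a t by auto
    have D: "((\<lambda>s. Z b s (\<zeta> s)) has_real_derivative ric b t (\<zeta> t)) (at t within {a..t})"
      by (rule Z_along) (use a t \<zeta> in auto)
    have "ric b t x \<le> sqrt (h t x) * (W - 1 / h t x - (Z b t x)\<^sup>2 / 2)"
    proof (rule ric_le[OF t W])
      have "\<nu> * Z (\<not> b) t x \<le> \<nu> * \<nu>" using le[of "\<not> b"] \<nu> N(2) by (intro mult_left_mono) (auto simp: F_def)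
      then show "Z b t x * Z (\<not> b) t x \<le> (Z b t x)\<^sup>2" using eq by (simp add: F_def power2_eq_square)
    qed
    also have "\<dots> < 0"
    proof (rule mult_pos_neg)
      have "N\<^sup>2 \<le> \<nu>\<^sup>2" using \<nu> N(2) by (intro power_mono) auto
      then show "W - 1 / h t x - (Z b t x)\<^sup>2 / 2 < 0"
      proof -
        have "1 / h t x > 0" using pos[OF t, of x] by simp
        moreover have z: "Z b t x = \<nu>" using eq by (simp add: F_def)
        ultimately show ?thesis unfolding z using N(3) \<open>N\<^sup>2 \<le> \<nu>\<^sup>2\<close> by linarith
      qed
    qed (use pos[OF t, of x] in simp)
    finally have neg: "ric b t (\<zeta> t) < 0" by (simp add: \<zeta>(1))
    obtain k1 where k1: "k1 > 0" "\<And>k. k > 0 \<Longrightarrow> t - k \<in> {a..t} \<Longrightarrow> k < k1 \<Longrightarrow> Z b t (\<zeta> t) < Z b (t - k) (\<zeta> (t - k))"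
      using has_real_derivative_neg_dec_left[OF D neg] by blast
    have "continuous (at t within {a..t}) \<zeta>" using \<zeta>(2)[of t] a by (auto dest: DERIV_continuous)
    then obtain k2 where k2: "k2 > 0" "\<And>s. s \<in> {a..t} \<Longrightarrow> dist s t < k2 \<Longrightarrow> dist (\<zeta> s) (\<zeta> t) < 1"
      unfolding continuous_within_eps_delta by (metis zero_less_one)
    \<comment> \<open>\<open>k1\<close> ensures the larger earlier value, \<open>k2\<close> a
      displacement below 1 and hence a point of the slab, and \<open>t - a\<close> the domain of the
      curve.\<close>
    define k where "k = min (min (k1 / 2) (k2 / 2)) (t - a)"
    have k: "k > 0" "k < k1" "k < k2" "t - k \<in> {a..t}" using k1(1) k2(1) a by (auto simp: k_def)
    have "\<bar>\<zeta> (t - k) - x\<bar> < 1" using k2(2)[OF k(4)] k \<zeta>(1) by (simp add: dist_real_def)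
    then have "(t - k, \<zeta> (t - k)) \<in> slab" using xin k t a by (auto simp: slab_def abs_le_iff abs_less_iff)
    then show "\<exists>s y. (s, y) \<in> slab \<and> s < t \<and> F b (s, y) \<ge> \<nu>"
      using k1(2)[OF k(1,4,2)] k(1) eq \<zeta>(1) by (intro exI[of _ "t - k"] exI[of _ "\<zeta> (t - k)"]) (auto simp: F_def)
  qed (auto simp: slab_def)
  moreover have "(t, x) \<in> slab" using False t by (auto simp: slab_def)
  ultimately have "F b (t, x) \<le> N" by (meson dense_ge less_imp_le)
  then show ?thesis by (simp add: F_def)
qed

text \<open>Real induction over the times at which some point lies on or below the barrier. This set
  is the projection of a compact set, hence closed. To the right of such a time one follows the
  smaller component, which at contact falls faster than \<open>y\<close>. The claim is existential
  in \<open>b\<close> and \<open>x\<close> because the family attaining the minimum may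
  change.\<close>

lemma barrier_forward:
  assumes W: "\<And>x. dxi v 0 x + 1 / h 0 x \<le> W" and t12: "0 \<le> t1" "t1 \<le> t2" "t2 \<le> T"
    and y: "\<And>t. t \<in> {t1..t2} \<Longrightarrow> (y has_real_derivative y' t) (at t within {t1..t2})"
    and yneg: "\<And>t. t \<in> {t1..t2} \<Longrightarrow> y t < 0"
    and strict: "\<And>t x. t \<in> {t1..t2} \<Longrightarrow> sqrt (h t x) * (W - 1 / h t x - (y t)\<^sup>2 / 2) < y' t"
    and start: "\<exists>b x. Z b t1 x \<le> y t1"
    and t: "t \<in> {t1..t2}"
  shows "\<exists>b x. Z b t x \<le> y t"
proof -
  obtain d where d: "d > 0" "\<And>a b t0 x0 \<beta>. 0 \<le> a \<Longrightarrow> b \<le> T \<Longrightarrow> b - a \<le> d \<Longrightarrow> t0 \<in> {a..b} \<Longrightarrow>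
    (\<exists>\<zeta>. \<zeta> t0 = x0 \<and> (\<forall>t\<in>{a..b}. (\<zeta> has_real_derivative sb \<beta> * cs t (\<zeta> t)) (at t within {a..b})))"
    using characteristics by blast
  define A where "A = {t \<in> {t1..t2}. \<exists>b x. Z b t x \<le> y t}"
  define S where "S = {t1..t2} \<times> {- (M0 + 2 * T + 1)..M0 + 2 * T + 1}"
  have Ssub: "S \<subseteq> {0..T} \<times> UNIV" using t12 by (auto simp: S_def)
  have cy: "continuous_on {t1..t2} y" using y by (meson DERIV_continuous continuous_on_eq_continuous_within)
  have cS: "compact S" by (simp add: S_def compact_Times)
  have "closed {p \<in> S. Z b (fst p) (snd p) - y (fst p) \<le> 0}" for b
  proof -
    have "continuous_on S (\<lambda>p. Z b (fst p) (snd p) - y (fst p))"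
      using continuous_on_subset[OF Z_cont Ssub, of b]
      by (auto simp: case_prod_beta S_def intro!: continuous_intros continuous_on_compose2[OF cy])
    from continuous_closed_preimage[OF this compact_imp_closed[OF cS] closed_atMost[of 0]]
    show ?thesis by (simp add: vimage_def Int_def conj_commute)
  qed
  then have "compact (S \<inter> {p \<in> S. Z b (fst p) (snd p) - y (fst p) \<le> 0})" for b
    by (intro compact_Int_closed cS)
  then have "compact (\<Union>b. S \<inter> {p \<in> S. Z b (fst p) (snd p) - y (fst p) \<le> 0})"
    by (intro compact_UN) auto
  then have "compact (fst ` (\<Union>b. S \<inter> {p \<in> S. Z b (fst p) (snd p) - y (fst p) \<le> 0}))"
    by (intro compact_continuous_image continuous_intros)
  moreover have "fst ` (\<Union>b. S \<inter> {p \<in> S. Z b (fst p) (snd p) - y (fst p) \<le> 0}) = A"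
  proof (intro equalityI subsetI)
    fix s assume "s \<in> A"
    then obtain b x where s: "s \<in> {t1..t2}" "Z b s x \<le> y s" by (auto simp: A_def)
    \<comment> \<open>Beyond this radius \<open>Z\<close> is 0, above the negative barrier; so the
      projection of the compact part is all of \<open>A\<close>.\<close>
    have "\<not> \<bar>x\<bar> > M0 + 2 * T" using Z_outside[of s x b] s yneg[OF s(1)] t12 by auto
    then have "(s, x) \<in> S" using s by (auto simp: S_def)
    then have "(s, x) \<in> (\<Union>b. S \<inter> {p \<in> S. Z b (fst p) (snd p) - y (fst p) \<le> 0})" using s by auto
    then show "s \<in> fst ` (\<Union>b. S \<inter> {p \<in> S. Z b (fst p) (snd p) - y (fst p) \<le> 0})" by force
  qed (auto simp: A_def S_def)
  ultimately have closed: "closed A" by (simp add: compact_imp_closed)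
  have "{t1..t2} \<subseteq> A"
  proof (rule interval_induction[OF t12(2) closed])
    show "t1 \<in> A" using start t12 by (auto simp: A_def)
    fix s assume sA: "s \<in> A" and "t1 \<le> s" and st2: "s < t2"
    then have s: "s \<in> {t1..t2}" by auto
    have s': "s \<in> {0..T}" using s t12 by auto
    obtain b0 x where b0: "Z b0 s x \<le> y s" using sA by (auto simp: A_def)
    \<comment> \<open>At the given point pass to the smaller component: being negative, it satisfies
      the product condition of \<open>ric_le\<close>.\<close>
    obtain b where b: "Z b s x \<le> y s" "Z b s x \<le> Z (\<not> b) s x"
    proof (cases "Z b0 s x \<le> Z (\<not> b0) s x")
      case True then show ?thesis using that[of b0] b0 by simp
    next
      case False then show ?thesis using that[of "\<not> b0"] b0 by simp
    qed
    define e where "e = min t2 (s + d)"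
    have e: "s < e" "e \<le> t2" "e - s \<le> d" using d(1) st2 by (auto simp: e_def)
    have sub: "{s..e} \<subseteq> {t1..t2}" using e s by auto
    obtain \<zeta> where \<zeta>: "\<zeta> s = x" "\<And>r. r \<in> {s..e} \<Longrightarrow> (\<zeta> has_real_derivative sb b * cs r (\<zeta> r)) (at r within {s..e})"
      using d(2)[of s e s x b] e s' t12 by auto
    have D0: "((\<lambda>r. Z b r (\<zeta> r)) has_real_derivative ric b s (\<zeta> s)) (at s within {s..e})"
      by (rule Z_along) (use e s' t12 \<zeta> in auto)
    have D: "((\<lambda>r. Z b r (\<zeta> r) - y r) has_real_derivative ric b s x - y' s) (at s within {s..e})"
      using DERIV_diff[OF D0 DERIV_subset[OF y[OF s] sub]] by (simp add: \<zeta>(1))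
    have "\<exists>k>0. \<forall>r. s < r \<longrightarrow> r < s + k \<longrightarrow> r \<le> e \<longrightarrow> Z b r (\<zeta> r) - y r < 0"
    proof (cases "Z b s x = y s")
      case True
      have "ric b s x \<le> sqrt (h s x) * (W - 1 / h s x - (Z b s x)\<^sup>2 / 2)"
      proof (rule ric_le[OF s' W])
        show "Z b s x * Z (\<not> b) s x \<le> (Z b s x)\<^sup>2"
          unfolding power2_eq_square using b yneg[OF s] by (intro mult_left_mono_neg) auto
      qed
      then have "ric b s x - y' s < 0" using strict[OF s, of x] True by simp
      from has_real_derivative_neg_dec_right[OF D this]
      obtain k where k: "k > 0" "\<And>r. r > 0 \<Longrightarrow> s + r \<in> {s..e} \<Longrightarrow> r < k \<Longrightarrow> Z b (s + r) (\<zeta> (s + r)) - y (s + r) < Z b s (\<zeta> s) - y s"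
        by blast
      show ?thesis
        by (intro exI[of _ k]) (use k(1) k(2)[of "r - s" for r] True \<zeta>(1) in auto)
    next
      case False
      \<comment> \<open>Strictly below the barrier, continuity alone keeps the value below it for a
        short time.\<close>
      then have "Z b s (\<zeta> s) - y s < 0" using b(1) \<zeta>(1) by simp
      moreover have "((\<lambda>r. Z b r (\<zeta> r) - y r) \<longlongrightarrow> Z b s (\<zeta> s) - y s) (at s within {s..e})"
        using DERIV_continuous[OF D] by (simp add: continuous_within)
      ultimately have "\<forall>\<^sub>F r in at s within {s..e}. Z b r (\<zeta> r) - y r < 0"
        by (intro order_tendstoD(2))
      then obtain k where "k > 0" "\<And>r. r \<in> {s..e} \<Longrightarrow> r \<noteq> s \<Longrightarrow> dist r s < k \<Longrightarrow> Z b r (\<zeta> r) - y r < 0"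
        unfolding eventually_at by blast
      then show ?thesis by (intro exI[of _ k]) (auto simp: dist_real_def)
    qed
    then obtain k where k: "k > 0" "\<And>r. s < r \<Longrightarrow> r < s + k \<Longrightarrow> r \<le> e \<Longrightarrow> Z b r (\<zeta> r) - y r < 0" by blast
    have "r \<in> A" if "s < r" "r < s + min k (e - s)" "r \<le> t2" for r
    proof -
      have "Z b r (\<zeta> r) < y r" using k(2)[of r] that by simp
      then have "Z b r (\<zeta> r) \<le> y r" by simp
      then show ?thesis using that s by (auto simp: A_def)
    qed
    then show "\<exists>e>0. \<forall>r. s < r \<longrightarrow> r < s + e \<longrightarrow> r \<le> t2 \<longrightarrow> r \<in> A"
      using k(1) e(1) by (intro exI[of _ "min k (e - s)"]) auto
  qed
  then show ?thesis using t by (auto simp: A_def)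
qed

end

section \<open>Local existence and continuation of classical solutions\<close>

lemma RH_deriv:
  assumes "\<gamma> \<ge> 1" "1 + (\<gamma> - 1) / 2 * r > 0"
  shows "(RH \<gamma> has_real_derivative RH \<gamma> r powr ((3 - \<gamma>) / 2)) (at r)"
proof (cases "\<gamma> = 1")
  case True
  then show ?thesis unfolding RH_def by (auto intro!: derivative_eq_intros)
next
  case False
  let ?y = "1 + (\<gamma> - 1) / 2 * r"
  have lin: "((\<lambda>r. 1 + (\<gamma> - 1) / 2 * r) has_real_derivative (\<gamma> - 1) / 2) (at r)"
    by (auto intro!: derivative_eq_intros)
  have "((\<lambda>r. (1 + (\<gamma> - 1) / 2 * r) powr (2 / (\<gamma> - 1))) has_real_derivative
      (2 / (\<gamma> - 1) * ?y powr (2 / (\<gamma> - 1) - 1)) * ((\<gamma> - 1) / 2)) (at r)"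
    by (rule DERIV_chain2[where g = "\<lambda>r. 1 + (\<gamma> - 1) / 2 * r", OF has_real_derivative_powr[OF assms(2)] lin])
  moreover have "(2 / (\<gamma> - 1) * ?y powr (2 / (\<gamma> - 1) - 1)) * ((\<gamma> - 1) / 2) = RH \<gamma> r powr ((3 - \<gamma>) / 2)"
  proof -
    have e: "2 / (\<gamma> - 1) * ((3 - \<gamma>) / 2) = 2 / (\<gamma> - 1) - 1" using False by (simp add: field_simps)
    have "RH \<gamma> r powr ((3 - \<gamma>) / 2) = ?y powr (2 / (\<gamma> - 1) * ((3 - \<gamma>) / 2))"
      using False by (simp only: RH_def if_False powr_powr)
    moreover have "(2 / (\<gamma> - 1) * z) * ((\<gamma> - 1) / 2) = z" for z using False by simp
    ultimately show ?thesis by (simp only: e)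
  qed
  ultimately show ?thesis unfolding RH_def[abs_def] if_not_P[OF False] by (simp only:)
qed

text \<open>Here \<open>r\<close> stands for \<open>RK \<gamma> h\<close>. Extending the speed to the whole line spares the fixed point
  argument any control of the range of \<open>h\<close>.\<close>
lemma speed_extension:
  assumes \<gamma>: "\<gamma> \<ge> 1" and a01: "a0 \<le> a1" and a0: "1 + (\<gamma> - 1) / 2 * a0 > 0"
  shows "\<exists>c dc K. (\<forall>r. (c has_real_derivative dc r) (at r)) \<and> (\<forall>r. \<bar>dc r\<bar> \<le> K) \<and>
    (\<forall>r r'. \<bar>dc r - dc r'\<bar> \<le> K * \<bar>r - r'\<bar>) \<and> (\<forall>r\<in>{a0..a1}. c r = RH \<gamma> r powr ((\<gamma> + 1) / 2))"
proof -
  have ok: "1 + (\<gamma> - 1) / 2 * r > 0" if "r \<ge> a0" for r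
  proof -
    have "(\<gamma> - 1) / 2 * a0 \<le> (\<gamma> - 1) / 2 * r" using that \<gamma> by (intro mult_left_mono) auto
    with a0 show ?thesis by linarith
  qed
  have d: "(RH \<gamma> has_real_derivative RH \<gamma> r powr ((3 - \<gamma>) / 2)) (at r)" if "r \<ge> a0" for r
    using RH_deriv[OF \<gamma> ok[OF that]] .
  have p: "RH \<gamma> r > 0" if "r \<ge> a0" for r using RH_pos[OF ok[OF that]] .
  have cR: "continuous_on {a0..a1} (RH \<gamma>)"
    using d by (meson DERIV_isCont atLeastAtMost_iff continuous_at_imp_continuous_on)
  have cR': "continuous_on {a0..a1} (\<lambda>r. RH \<gamma> r powr ((3 - \<gamma>) / 2))"
    using p by (intro continuous_intros cR) (auto simp: less_imp_neq[symmetric])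
  obtain K1 where K1: "\<forall>z\<in>RH \<gamma> ` {a0..a1}. norm z \<le> K1"
    using compact_imp_bounded[OF compact_continuous_image[OF cR compact_Icc]] unfolding bounded_iff by blast
  obtain K2 where K2: "\<forall>z\<in>(\<lambda>r. RH \<gamma> r powr ((3 - \<gamma>) / 2)) ` {a0..a1}. norm z \<le> K2"
    using compact_imp_bounded[OF compact_continuous_image[OF cR' compact_Icc]] unfolding bounded_iff by blast
  have K2': "\<bar>RH \<gamma> r powr ((3 - \<gamma>) / 2)\<bar> \<le> K2" if "r \<in> {a0..a1}" for r using K2 that by auto
  define K where "K = (\<gamma> + 1) / 2 * max K1 K2"
  \<comment> \<open>Freezing the derivative of the speed outside the interval preserves its bound
    and its Lipschitz constant.\<close>
  define clamp where "clamp r = max a0 (min a1 r)" for r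
  have cl: "clamp r \<in> {a0..a1}" "\<bar>clamp r - clamp r'\<bar> \<le> \<bar>r - r'\<bar>" for r r' using a01 by (auto simp: clamp_def)
  \<comment> \<open>By the chain rule the derivative of
    \<open>RH \<gamma> r powr ((\<gamma> + 1) / 2)\<close> is
    \<open>(\<gamma> + 1) / 2 * RH \<gamma> r\<close>, since the exponents
    \<open>(\<gamma> - 1) / 2\<close> and \<open>(3 - \<gamma>) / 2\<close> add up to 1.\<close>
  define dc where "dc r = (\<gamma> + 1) / 2 * RH \<gamma> (clamp r)" for r
  have dcK: "\<bar>dc r\<bar> \<le> K" for r
  proof -
    have "norm (RH \<gamma> (clamp r)) \<le> K1" by (rule K1[rule_format]) (rule imageI[OF cl(1)])
    then have "\<bar>RH \<gamma> (clamp r)\<bar> \<le> max K1 K2" by simp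
    then show ?thesis unfolding dc_def K_def abs_mult using \<gamma> by (intro mult_mono) auto
  qed
  have dcL: "\<bar>dc r - dc r'\<bar> \<le> K * \<bar>r - r'\<bar>" for r r'
  proof -
    have "norm (RH \<gamma> (clamp r) - RH \<gamma> (clamp r')) \<le> max K1 K2 * norm (clamp r - clamp r')"
    proof (rule field_differentiable_bound[of "{a0..a1}" "RH \<gamma>" "\<lambda>r. RH \<gamma> r powr ((3 - \<gamma>) / 2)"])
      show "(RH \<gamma> has_real_derivative RH \<gamma> r powr ((3 - \<gamma>) / 2)) (at r within {a0..a1})" if "r \<in> {a0..a1}" for r
        using d[of r] that by (auto intro: DERIV_subset)
      show "norm (RH \<gamma> r powr ((3 - \<gamma>) / 2)) \<le> max K1 K2" if "r \<in> {a0..a1}" for r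
        using K2'[OF that] by simp
    qed (use cl in auto)
    also have "\<dots> \<le> max K1 K2 * \<bar>r - r'\<bar>"
      using cl(2)[of r r'] order_trans[OF abs_ge_zero K2'[of a0]] a01 by (intro mult_left_mono) (auto simp: le_max_iff_disj)
    finally have "(\<gamma> + 1) / 2 * \<bar>RH \<gamma> (clamp r) - RH \<gamma> (clamp r')\<bar> \<le> (\<gamma> + 1) / 2 * (max K1 K2 * \<bar>r - r'\<bar>)"
      using \<gamma> by (intro mult_left_mono) auto
    moreover have "\<bar>dc r - dc r'\<bar> = (\<gamma> + 1) / 2 * \<bar>RH \<gamma> (clamp r) - RH \<gamma> (clamp r')\<bar>"
      unfolding dc_def right_diff_distrib[symmetric] abs_mult using \<gamma> by simp
    ultimately show ?thesis by (simp add: K_def mult.assoc)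
  qed
  have dc_cont: "continuous_on A dc" for A
  proof -
    have "K \<ge> 0" using dcK[of 0] by linarith
    then have "K-lipschitz_on A dc" using dcL by (auto simp: lipschitz_on_def dist_real_def)
    then show ?thesis by (rule lipschitz_on_continuous_on)
  qed
  \<comment> \<open>An oriented integral, so that \<open>r\<close> may also lie to the left of
    \<open>a0\<close>.\<close>
  define c where "c r = RH \<gamma> a0 powr ((\<gamma> + 1) / 2) + (LBINT y=a0..r. dc y)" for r
  have cd: "(c has_real_derivative dc r) (at r)" for r
  proof -
    let ?a = "min a0 r - 1" and ?b = "max a0 r + 1"
    have "((\<lambda>u. LBINT y=a0..u. dc y) has_vector_derivative dc r) (at r within {?a..?b})"
      by (rule interval_integral_FTC2) (auto intro: dc_cont)
    moreover have "at r within {?a..?b} = at r" by (rule at_within_interior) auto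
    ultimately have "((\<lambda>u. LBINT y=a0..u. dc y) has_real_derivative dc r) (at r)"
      by (simp add: has_real_derivative_iff_has_vector_derivative)
    then show ?thesis unfolding c_def by (auto intro!: derivative_eq_intros)
  qed
  have "\<exists>k. \<forall>r\<in>{a0..a1}. c r - RH \<gamma> r powr ((\<gamma> + 1) / 2) = k"
  proof (rule has_field_derivative_zero_constant)
    fix r assume r: "r \<in> {a0..a1}"
    have ra: "r \<ge> a0" using r by simp
    have "((\<lambda>r. RH \<gamma> r powr ((\<gamma> + 1) / 2)) has_real_derivative ((\<gamma> + 1) / 2 * RH \<gamma> r powr ((\<gamma> + 1) / 2 - 1)) * RH \<gamma> r powr ((3 - \<gamma>) / 2)) (at r)"
      by (rule DERIV_chain2[where g = "RH \<gamma>", OF has_real_derivative_powr[OF p[OF ra]] d[OF ra]])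
    moreover have "((\<gamma> + 1) / 2 * RH \<gamma> r powr ((\<gamma> + 1) / 2 - 1)) * RH \<gamma> r powr ((3 - \<gamma>) / 2) = dc r"
    proof -
      have "(\<gamma> + 1) / 2 - 1 + (3 - \<gamma>) / 2 = 1" by (simp add: field_simps)
      then have "RH \<gamma> r powr ((\<gamma> + 1) / 2 - 1) * RH \<gamma> r powr ((3 - \<gamma>) / 2) = RH \<gamma> r"
        using p[OF ra] by (simp only: powr_add[symmetric] powr_one)
      moreover have "clamp r = r" using r by (auto simp: clamp_def)
      ultimately show ?thesis by (simp add: dc_def mult.assoc)
    qed
    ultimately have "((\<lambda>r. RH \<gamma> r powr ((\<gamma> + 1) / 2)) has_real_derivative dc r) (at r)" by (simp only:)
    from DERIV_diff[OF cd this] have "((\<lambda>r. c r - RH \<gamma> r powr ((\<gamma> + 1) / 2)) has_real_derivative 0) (at r)" by simp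
    then show "((\<lambda>r. c r - RH \<gamma> r powr ((\<gamma> + 1) / 2)) has_real_derivative 0) (at r within {a0..a1})"
      by (rule DERIV_subset) simp
  qed simp
  then obtain k where k: "\<And>r. r \<in> {a0..a1} \<Longrightarrow> c r - RH \<gamma> r powr ((\<gamma> + 1) / 2) = k" by blast
  have "k = 0" using k[of a0] a01 by (simp add: c_def)
  then have "\<forall>r\<in>{a0..a1}. c r = RH \<gamma> r powr ((\<gamma> + 1) / 2)" using k by auto
  then show ?thesis using cd dcK dcL by blast
qed

lemma uniformly_continuous_compact_support:
  fixes f :: "real \<Rightarrow> real"
  assumes f: "continuous_on UNIV f" and R: "\<And>x. \<bar>x\<bar> > R \<Longrightarrow> f x = 0" and e: "e > 0"
  shows "\<exists>\<rho>>0. \<forall>x y. \<bar>x - y\<bar> \<le> \<rho> \<longrightarrow> \<bar>f x - f y\<bar> \<le> e"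
proof -
  have "uniformly_continuous_on {- \<bar>R\<bar> - 2..\<bar>R\<bar> + 2} f"
    by (intro compact_uniformly_continuous continuous_on_subset[OF f]) auto
  then obtain d where d: "d > 0" "\<And>x y. x \<in> {- \<bar>R\<bar> - 2..\<bar>R\<bar> + 2} \<Longrightarrow> y \<in> {- \<bar>R\<bar> - 2..\<bar>R\<bar> + 2} \<Longrightarrow> dist x y < d \<Longrightarrow> dist (f x) (f y) < e"
    using e unfolding uniformly_continuous_on_def by metis
  have "\<bar>f x - f y\<bar> \<le> e" if "\<bar>x - y\<bar> \<le> min (d / 2) 1" for x y
  proof (cases "\<bar>x\<bar> \<le> \<bar>R\<bar> + 1")
    case True
    then have "x \<in> {- \<bar>R\<bar> - 2..\<bar>R\<bar> + 2}" "y \<in> {- \<bar>R\<bar> - 2..\<bar>R\<bar> + 2}" using that by auto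
    then have "\<bar>f x - f y\<bar> < e" using d(2)[of x y] d(1) that by (simp add: dist_real_def)
    then show ?thesis by simp
  next
    case False
    then have "\<bar>y\<bar> > R" "\<bar>x\<bar> > R" using that by auto
    then show ?thesis using R e by simp
  qed
  then show ?thesis using d(1) by (intro exI[of _ "min (d / 2) 1"]) auto
qed

lemma powr_between:
  fixes b B h p :: real assumes "0 < b" "b \<le> h" "h \<le> B" shows "h powr p \<le> b powr p + B powr p"
proof (cases "p \<ge> 0")
  case True
  then have "h powr p \<le> B powr p" using assms by (intro powr_mono2) auto
  then show ?thesis by (simp add: add_increasing)
next
  case False
  then have "h powr p \<le> b powr p" using assms by (intro powr_mono2') auto
  then show ?thesis by (simp add: add_increasing2)
qed

text \<open>The derivative of \<open>RH\<close> is \<open>h powr ((3 - \<gamma>) / 2)\<close>.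
  Multiplied by the speed it is \<open>h^2\<close>, which gives the density equation; multiplied by
  \<open>h powr (\<gamma> - 1)\<close> it is the speed, which gives the velocity equation.\<close>

lemma classical_solution_of_riemann:
  fixes U W :: "comp \<Rightarrow> real \<times> real \<Rightarrow> real"
  assumes \<gamma>: "\<gamma> \<ge> 1"
    and U: "\<And>i. continuous_on ({0..\<delta>} \<times> UNIV) (U i)" and W: "\<And>i. continuous_on ({0..\<delta>} \<times> UNIV) (W i)"
    and Ux: "\<And>i t x. t \<in> {0..\<delta>} \<Longrightarrow> ((\<lambda>y. U i (t, y)) has_real_derivative W i (t, x)) (at x)"
    and Ut: "\<And>i t x. t \<in> {0..\<delta>} \<Longrightarrow> ((\<lambda>s. U i (s, x)) has_real_derivative (src i (\<lambda>j. U j (t, x)) - sg i * c (mid (\<lambda>j. U j (t, x))) * W i (t, x))) (at t within {0..\<delta>})"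
    and ok: "\<And>t x. t \<in> {0..\<delta>} \<Longrightarrow> 1 + (\<gamma> - 1) / 2 * mid (\<lambda>j. U j (t, x)) > 0"
    and c: "\<And>t x. t \<in> {0..\<delta>} \<Longrightarrow> c (mid (\<lambda>j. U j (t, x))) = RH \<gamma> (mid (\<lambda>j. U j (t, x))) powr ((\<gamma> + 1) / 2)"
  shows "classical_solution \<gamma> {0..\<delta>} (\<lambda>t x. RH \<gamma> (mid (\<lambda>j. U j (t, x)))) (\<lambda>t x. (U Rp (t, x) + U Rm (t, x)) / 2) (\<lambda>t x. U Vc (t, x))"
proof -
  let ?m = "\<lambda>t x. mid (\<lambda>j. U j (t, x))"
  let ?h = "\<lambda>t x. RH \<gamma> (?m t x)" and ?u = "\<lambda>t x. (U Rp (t, x) + U Rm (t, x)) / 2" and ?v = "\<lambda>t x. U Vc (t, x)"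
  have hpos: "?h t x > 0" if "t \<in> {0..\<delta>}" for t x by (rule RH_pos[OF ok[OF that]])
  have mx: "((\<lambda>y. ?m t y) has_real_derivative mid (\<lambda>j. W j (t, x))) (at x)" if "t \<in> {0..\<delta>}" for t x
    unfolding mid_def using Ux[OF that, of Rp x] Ux[OF that, of Rm x] by (auto intro!: derivative_eq_intros)
  have hx: "((\<lambda>y. ?h t y) has_real_derivative ?h t x powr ((3 - \<gamma>) / 2) * mid (\<lambda>j. W j (t, x))) (at x)" if "t \<in> {0..\<delta>}" for t x
    by (rule DERIV_chain2[where g = "?m t", OF RH_deriv[OF \<gamma> ok[OF that]] mx[OF that]])
  have ux: "((\<lambda>y. ?u t y) has_real_derivative (W Rp (t, x) + W Rm (t, x)) / 2) (at x)" if "t \<in> {0..\<delta>}" for t x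
    using Ux[OF that, of Rp x] Ux[OF that, of Rm x] by (auto intro!: derivative_eq_intros)
  have dh: "dxi ?h t x = ?h t x powr ((3 - \<gamma>) / 2) * mid (\<lambda>j. W j (t, x))"
    and du: "dxi ?u t x = (W Rp (t, x) + W Rm (t, x)) / 2" and dv: "dxi ?v t x = W Vc (t, x)" if "t \<in> {0..\<delta>}" for t x
    unfolding dxi_def using DERIV_imp_deriv[OF hx[OF that]] DERIV_imp_deriv[OF ux[OF that]] DERIV_imp_deriv[OF Ux[OF that, of Vc]] by auto
  have cm: "continuous_on ({0..\<delta>} \<times> UNIV) (\<lambda>p. mid (\<lambda>j. U j p))" by (intro continuous_intros U)
  have RHc: "continuous_on {r. 1 + (\<gamma> - 1) / 2 * r > 0} (RH \<gamma>)"
    using RH_deriv[OF \<gamma>] by (intro continuous_at_imp_continuous_on) (auto dest: DERIV_isCont)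
  have ch: "continuous_on ({0..\<delta>} \<times> UNIV) (\<lambda>(t, x). ?h t x)"
    unfolding case_prod_beta using ok by (intro continuous_on_compose2[OF RHc]) (auto intro: cm)
  have chx: "continuous_on ({0..\<delta>} \<times> UNIV) (\<lambda>(t, x). dxi ?h t x)"
  proof -
    have "continuous_on ({0..\<delta>} \<times> UNIV) (\<lambda>p. (\<lambda>(t, x). ?h t x) p powr ((3 - \<gamma>) / 2) * mid (\<lambda>j. W j p))"
      using hpos by (intro continuous_intros ch W) (force simp: less_imp_neq[symmetric])
    then show ?thesis by (rule continuous_on_eq) (auto simp: dh)
  qed
  have cux: "continuous_on ({0..\<delta>} \<times> UNIV) (\<lambda>(t, x). dxi ?u t x)"
  proof -
    have "continuous_on ({0..\<delta>} \<times> UNIV) (\<lambda>p. (W Rp p + W Rm p) / 2)" by (intro continuous_intros W) auto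
    then show ?thesis by (rule continuous_on_eq) (auto simp: du)
  qed
  have cvx: "continuous_on ({0..\<delta>} \<times> UNIV) (\<lambda>(t, x). dxi ?v t x)"
    using W[of Vc] by (rule continuous_on_eq) (auto simp: dv)
  have ht: "((\<lambda>s. ?h s x) has_real_derivative - (?h t x)\<^sup>2 * dxi ?u t x) (at t within {0..\<delta>})" if t: "t \<in> {0..\<delta>}" for t x
  proof -
    define k where "k = c (?m t x)"
    have "((\<lambda>s. (U Rp (s, x) - U Rm (s, x)) / 2) has_real_derivative - (k * ((W Rp (t, x) + W Rm (t, x)) / 2))) (at t within {0..\<delta>})"
      using Ut[OF t, of Rp x, folded k_def] Ut[OF t, of Rm x, folded k_def] by (auto intro!: derivative_eq_intros simp: field_simps)
    then have m: "((\<lambda>s. ?m s x) has_real_derivative - (c (?m t x) * ((W Rp (t, x) + W Rm (t, x)) / 2))) (at t within {0..\<delta>})"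
      unfolding k_def[symmetric] by (simp only: mid_def)
    have "((\<lambda>s. ?h s x) has_real_derivative ?h t x powr ((3 - \<gamma>) / 2) * - (c (?m t x) * ((W Rp (t, x) + W Rm (t, x)) / 2))) (at t within {0..\<delta>})"
      by (rule DERIV_chain2[where g = "\<lambda>s. ?m s x", OF RH_deriv[OF \<gamma> ok[OF t]] m])
    moreover have "?h t x powr ((3 - \<gamma>) / 2) * ?h t x powr ((\<gamma> + 1) / 2) = (?h t x)\<^sup>2"
    proof -
      have "(3 - \<gamma>) / 2 + (\<gamma> + 1) / 2 = 2" by (simp add: field_simps)
      then show ?thesis using hpos[OF t, of x] by (simp add: powr_add[symmetric])
    qed
    ultimately show ?thesis unfolding du[OF t] c[OF t] by (simp only: mult_minus_right mult_minus_left mult.assoc[symmetric])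
  qed
  have ut: "((\<lambda>s. ?u s x) has_real_derivative ?v t x - ?h t x powr (\<gamma> - 1) * dxi ?h t x) (at t within {0..\<delta>})" if t: "t \<in> {0..\<delta>}" for t x
  proof -
    have "((\<lambda>s. ?u s x) has_real_derivative ?v t x - c (?m t x) * mid (\<lambda>j. W j (t, x))) (at t within {0..\<delta>})"
      using Ut[OF t, of Rp x] Ut[OF t, of Rm x] by (auto intro!: derivative_eq_intros simp: mid_def[of "\<lambda>j. W j _"] field_simps)
    moreover have "?h t x powr (\<gamma> - 1) * ?h t x powr ((3 - \<gamma>) / 2) = ?h t x powr ((\<gamma> + 1) / 2)"
      unfolding powr_add[symmetric] by (rule arg_cong[of _ _ "\<lambda>a. ?h t x powr a"]) (simp add: field_simps)
    ultimately show ?thesis unfolding dh[OF t] c[OF t] by (simp only: mult.assoc[symmetric])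
  qed
  have vt: "((\<lambda>s. ?v s x) has_real_derivative - ?u t x) (at t within {0..\<delta>})" if t: "t \<in> {0..\<delta>}" for t x
  proof -
    have "src Vc (\<lambda>j. U j (t, x)) - sg Vc * c (?m t x) * W Vc (t, x) = - ?u t x" by (simp add: field_simps)
    with Ut[OF t, of Vc x] show ?thesis by (simp only:)
  qed
  have cuv: "continuous_on ({0..\<delta>} \<times> UNIV) (\<lambda>(t, x). ?u t x)" "continuous_on ({0..\<delta>} \<times> UNIV) (\<lambda>(t, x). ?v t x)"
    unfolding case_prod_beta using U by (auto intro!: continuous_intros)
  have dif: "(\<lambda>y. ?h t y) differentiable (at x)" "(\<lambda>y. ?u t y) differentiable (at x)" "(\<lambda>y. ?v t y) differentiable (at x)" if "t \<in> {0..\<delta>}" for t x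
    using hx[OF that] ux[OF that] Ux[OF that, of Vc] by (auto simp: real_differentiable_def)
  show ?thesis unfolding classical_solution_def
    using hpos ch chx cux cvx cuv dif ht ut vt by (intro conjI ballI allI) auto
qed

text \<open>The order of quantifiers is the point: \<open>\<delta>\<close> is fixed before the data
  and depends only on their bounds, not on the size of their support. This uniformity drives the
  continuation argument.\<close>

lemma local_existence:
  fixes \<gamma> b B L :: real
  assumes \<gamma>: "\<gamma> \<ge> 1" and b: "b > 0"
  shows "\<exists>\<delta>>0. \<forall>h0 u0 v0 hx ux vx :: real \<Rightarrow> real.
    (\<forall>x. (h0 has_real_derivative hx x) (at x) \<and> (u0 has_real_derivative ux x) (at x) \<and> (v0 has_real_derivative vx x) (at x)) \<longrightarrow>
    continuous_on UNIV hx \<longrightarrow> continuous_on UNIV ux \<longrightarrow> continuous_on UNIV vx \<longrightarrow>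
    (\<exists>R. \<forall>x. \<bar>x\<bar> > R \<longrightarrow> hx x = 0 \<and> ux x = 0 \<and> vx x = 0) \<longrightarrow>
    (\<forall>x. b \<le> h0 x \<and> h0 x \<le> B \<and> \<bar>u0 x\<bar> \<le> B \<and> \<bar>v0 x\<bar> \<le> B \<and> \<bar>hx x\<bar> \<le> L \<and> \<bar>ux x\<bar> \<le> L \<and> \<bar>vx x\<bar> \<le> L) \<longrightarrow>
    (\<exists>h u v. classical_solution \<gamma> {0..\<delta>} h u v \<and> (\<forall>x. h 0 x = h0 x \<and> u 0 x = u0 x \<and> v 0 x = v0 x))"
proof (cases "b \<le> B \<and> L \<ge> 0")
  case False
  \<comment> \<open>If \<open>b > B\<close> or \<open>L < 0\<close>, no data meet the bounds, so any
    positive number will do.\<close>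
  then show ?thesis by (intro exI[of _ 1]) (force intro: order_trans)
next
  case True
  then have bB: "b \<le> B" and L: "L \<ge> 0" by auto
  \<comment> \<open>The speed is kept exact on a range strictly larger than that of the data;
    \<open>\<rho>\<close> below is the margin that the solution may use up.\<close>
  define a0 where "a0 = RK \<gamma> (b / 2)"
  define a1 where "a1 = RK \<gamma> (B + 1)"
  have a01: "a0 < RK \<gamma> b" "RK \<gamma> b \<le> RK \<gamma> B" "RK \<gamma> B < a1"
    unfolding a0_def a1_def using b bB by (auto intro!: RK_strict_mono simp: RK_le_iff)
  have a0: "1 + (\<gamma> - 1) / 2 * a0 > 0" unfolding a0_def using b by (intro RK_range \<gamma>) auto
  have "a0 \<le> a1" using a01 by linarith
  from speed_extension[OF \<gamma> this a0]
  obtain c dc K where c: "\<And>r. (c has_real_derivative dc r) (at r)" "\<And>r. \<bar>dc r\<bar> \<le> K"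
    "\<And>r r'. \<bar>dc r - dc r'\<bar> \<le> K * \<bar>r - r'\<bar>" "\<And>r. r \<in> {a0..a1} \<Longrightarrow> c r = RH \<gamma> r powr ((\<gamma> + 1) / 2)" by blast
  have K: "K \<ge> 0" using c(2)[of 0] by linarith
  define \<rho> where "\<rho> = min (RK \<gamma> b - a0) (a1 - RK \<gamma> B)"
  have \<rho>: "\<rho> > 0" using a01 by (simp add: \<rho>_def)
  define BB where "BB = B + (\<bar>a0\<bar> + \<bar>a1\<bar>)"
  have BB: "BB \<ge> 0" using b bB by (simp add: BB_def)
  define qb where "qb = b powr ((\<gamma> - 3) / 2) + B powr ((\<gamma> - 3) / 2)"
  have qb: "qb \<ge> 0" by (simp add: qb_def)
  define L0 where "L0 = L + qb * L + 1"
  have L0: "L0 > 0" using L qb by (simp add: L0_def add_nonneg_pos)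
  define Lam where "Lam = \<bar>c 0\<bar> + K * (BB + 1)"
  have Lam: "Lam \<ge> 0" using K BB by (simp add: Lam_def)
  define G where "G = L0 * Lam + BB + 1"
  have G: "G > 0" using L0 Lam BB by (simp add: G_def add_nonneg_pos)
  \<comment> \<open>The first three terms are the conditions of \<open>riemann_system\<close>; the
    last one keeps the drift from \<open>U_close\<close>, at most \<open>G * \<delta>\<close>,
    within the margin \<open>\<rho>\<close>.\<close>
  define \<delta> where "\<delta> = min (min (1 / 12) (1 / (24 * L0 * (K + 1)))) (min (1 / (BB + 1)) (\<rho> / G))"
  have \<delta>: "\<delta> > 0" using L0 K BB \<rho> G by (simp add: \<delta>_def)
  have \<delta>1: "\<delta> \<le> 1 / 12" unfolding \<delta>_def by (rule min.coboundedI1, rule min.cobounded1)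
  have \<delta>2: "24 * L0 * K * \<delta> \<le> 1"
  proof -
    have "\<delta> \<le> 1 / (24 * L0 * (K + 1))" by (simp add: \<delta>_def)
    moreover have "24 * L0 * (K + 1) > 0" using L0 K by simp
    ultimately have "24 * L0 * (K + 1) * \<delta> \<le> 1" by (simp only: pos_le_divide_eq mult.commute)
    moreover have "24 * L0 * K * \<delta> \<le> 24 * L0 * (K + 1) * \<delta>" using L0 K \<delta> by (intro mult_right_mono mult_left_mono) auto
    ultimately show ?thesis by linarith
  qed
  have \<delta>3: "\<delta> * (BB + 1) \<le> 1"
  proof -
    have "\<delta> \<le> 1 / (BB + 1)" by (simp add: \<delta>_def)
    then show ?thesis using BB by (simp add: field_simps)
  qed
  have \<delta>4: "G * \<delta> \<le> \<rho>"
  proof -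
    have "\<delta> \<le> \<rho> / G" by (simp add: \<delta>_def)
    then show ?thesis using G by (simp add: field_simps)
  qed
  show ?thesis
  proof (intro exI[of _ \<delta>] conjI \<delta> allI impI)
    fix h0 u0 v0 hx ux vx :: "real \<Rightarrow> real"
    assume D: "\<forall>x. (h0 has_real_derivative hx x) (at x) \<and> (u0 has_real_derivative ux x) (at x) \<and> (v0 has_real_derivative vx x) (at x)"
      and chx: "continuous_on UNIV hx" and cux: "continuous_on UNIV ux" and cvx: "continuous_on UNIV vx"
      and R: "\<exists>R. \<forall>x. \<bar>x\<bar> > R \<longrightarrow> hx x = 0 \<and> ux x = 0 \<and> vx x = 0"
      and bds: "\<forall>x. b \<le> h0 x \<and> h0 x \<le> B \<and> \<bar>u0 x\<bar> \<le> B \<and> \<bar>v0 x\<bar> \<le> B \<and> \<bar>hx x\<bar> \<le> L \<and> \<bar>ux x\<bar> \<le> L \<and> \<bar>vx x\<bar> \<le> L"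
    obtain R where R: "\<And>x. \<bar>x\<bar> > R \<Longrightarrow> hx x = 0 \<and> ux x = 0 \<and> vx x = 0" using R by blast
    have h0: "h0 x > 0" "b \<le> h0 x" "h0 x \<le> B" for x using bds b by (auto intro: less_le_trans)
    define U0 where "U0 i x = (case i of Rp \<Rightarrow> u0 x + RK \<gamma> (h0 x) | Rm \<Rightarrow> u0 x - RK \<gamma> (h0 x) | Vc \<Rightarrow> v0 x)" for i x
    define DU0 where "DU0 i x = (case i of Rp \<Rightarrow> ux x + h0 x powr ((\<gamma> - 3) / 2) * hx x | Rm \<Rightarrow> ux x - h0 x powr ((\<gamma> - 3) / 2) * hx x | Vc \<Rightarrow> vx x)" for i x
    have Kx: "((\<lambda>x. RK \<gamma> (h0 x)) has_real_derivative h0 x powr ((\<gamma> - 3) / 2) * hx x) (at x)" for x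
      by (rule DERIV_chain2[where g = h0, OF RK_deriv[OF h0(1)]]) (use D in auto)
    have dU: "(U0 i has_real_derivative DU0 i x) (at x)" for i x
      using D Kx unfolding U0_def[abs_def] DU0_def by (cases i) (auto intro!: derivative_eq_intros)
    have RKb: "a0 + \<rho> \<le> RK \<gamma> (h0 x)" "RK \<gamma> (h0 x) \<le> a1 - \<rho>" for x
    proof -
      have "RK \<gamma> b \<le> RK \<gamma> (h0 x)" "RK \<gamma> (h0 x) \<le> RK \<gamma> B" using h0[of x] b bB by (auto simp: RK_le_iff)
      then show "a0 + \<rho> \<le> RK \<gamma> (h0 x)" "RK \<gamma> (h0 x) \<le> a1 - \<rho>" by (auto simp: \<rho>_def)
    qed
    have U0B: "\<bar>U0 i x\<bar> \<le> BB" for i x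
      using RKb[of x] bds[rule_format, of x] \<rho> by (cases i) (auto simp: U0_def BB_def)
    have qh: "\<bar>h0 x powr ((\<gamma> - 3) / 2) * hx x\<bar> \<le> qb * L" for x
      unfolding abs_mult using powr_between[OF b h0(2,3)[of x], of "(\<gamma> - 3) / 2"] bds qb by (intro mult_mono) (auto simp: qb_def)
    have qL: "qb * L \<ge> 0" using qb L by simp
    have DU0L: "\<bar>DU0 i x\<bar> \<le> L0" for i x
      using qh[of x] bds[rule_format, of x] qL by (cases i) (auto simp: DU0_def L0_def)
    have h0c: "continuous_on UNIV h0" using D by (meson DERIV_isCont continuous_at_imp_continuous_on)
    have DU0c: "continuous_on UNIV (DU0 i)" for i
      using h0(1) unfolding DU0_def[abs_def]
      by (cases i) (auto intro!: continuous_intros chx cux cvx h0c simp: less_imp_neq[symmetric])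
    have DU0R: "DU0 i x = 0" if "\<bar>x\<bar> > R" for i x using R[OF that] by (cases i) (auto simp: DU0_def)
    interpret riemann_system c dc K BB L0 \<delta> U0 DU0
    proof
      show "\<bar>U0 i x - U0 i y\<bar> \<le> L0 * \<bar>x - y\<bar>" for i x y
        using field_differentiable_bound[of UNIV "U0 i" "DU0 i" L0 x y] dU DU0L by simp
      show "\<exists>\<rho>>0. \<forall>x d. \<bar>d\<bar> \<le> \<rho> \<longrightarrow> \<bar>U0 i (x + d) - U0 i x - d * DU0 i x\<bar> \<le> e * \<bar>d\<bar>" if e: "e > 0" for i e
      proof -
        obtain r where r: "r > 0" "\<And>x y. \<bar>x - y\<bar> \<le> r \<Longrightarrow> \<bar>DU0 i x - DU0 i y\<bar> \<le> e"
          using uniformly_continuous_compact_support[OF DU0c DU0R e] by blast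
        have "\<bar>U0 i (x + d) - U0 i x - d * DU0 i x\<bar> \<le> e * \<bar>d\<bar>" if d: "\<bar>d\<bar> \<le> r" for x d
        proof -
          obtain \<theta> where \<theta>: "\<bar>\<theta>\<bar> \<le> \<bar>d\<bar>" "U0 i (x + d) - U0 i x = d * DU0 i (x + \<theta>)"
            using MVT_increment[of "U0 i" "DU0 i" d x] dU by blast
          have "\<bar>d\<bar> * \<bar>DU0 i (x + \<theta>) - DU0 i x\<bar> \<le> \<bar>d\<bar> * e" using \<theta>(1) d by (intro mult_left_mono r(2)) auto
          then show ?thesis unfolding \<theta>(2) right_diff_distrib[symmetric] abs_mult by (simp add: mult.commute)
        qed
        then show ?thesis using r(1) by blast
      qed
    qed (use c U0B DU0L DU0c L0 BB \<delta> \<delta>1 \<delta>2 \<delta>3 in auto)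
    obtain U W where UW: "\<And>i. continuous_on strip (U i)" "\<And>i. continuous_on strip (W i)" "\<And>i x. U i (0, x) = U0 i x"
      "\<And>i t x. (t, x) \<in> strip \<Longrightarrow> ((\<lambda>y. U i (t, y)) has_real_derivative W i (t, x)) (at x)"
      "\<And>i t x. (t, x) \<in> strip \<Longrightarrow> ((\<lambda>s. U i (s, x)) has_real_derivative (src i (\<lambda>j. U j (t, x)) - sg i * c (mid (\<lambda>j. U j (t, x))) * W i (t, x))) (at t within {0..\<delta>})"
      "\<And>i t x. (t, x) \<in> strip \<Longrightarrow> \<bar>U i (t, x) - U0 i x\<bar> \<le> (L0 * \<Lambda> + BB + 1) * \<delta>"
      using C1_solution by blast
    have st: "(t, x) \<in> strip \<longleftrightarrow> t \<in> {0..\<delta>}" for t x by (simp add: strip_def)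
    have mid0: "mid (\<lambda>j. U0 j x) = RK \<gamma> (h0 x)" for x by (simp add: mid_def U0_def)
    have LG: "(L0 * \<Lambda> + BB + 1) * \<delta> \<le> \<rho>" using \<delta>4 by (simp add: G_def Lam_def \<Lambda>_def)
    have mr: "mid (\<lambda>j. U j (t, x)) \<in> {a0..a1}" if t: "t \<in> {0..\<delta>}" for t x
    proof -
      have "\<bar>mid (\<lambda>j. U j (t, x)) - mid (\<lambda>j. U0 j x)\<bar> \<le> \<rho>"
        using UW(6)[unfolded st, OF t] LG by (intro mid_lip) (blast intro: order_trans)
      then show ?thesis using RKb[of x] mid0[of x] by auto
    qed
    have ok: "1 + (\<gamma> - 1) / 2 * r > 0" if "r \<in> {a0..a1}" for r
    proof -
      have "(\<gamma> - 1) / 2 * a0 \<le> (\<gamma> - 1) / 2 * r" using that \<gamma> by (intro mult_left_mono) auto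
      with a0 show ?thesis by linarith
    qed
    have "classical_solution \<gamma> {0..\<delta>} (\<lambda>t x. RH \<gamma> (mid (\<lambda>j. U j (t, x)))) (\<lambda>t x. (U Rp (t, x) + U Rm (t, x)) / 2) (\<lambda>t x. U Vc (t, x))"
      by (rule classical_solution_of_riemann[OF \<gamma> UW(1,2)[unfolded strip_def] UW(4,5)[unfolded st] ok[OF mr] c(4)[OF mr]])
    moreover have "RH \<gamma> (mid (\<lambda>j. U j (0, x))) = h0 x \<and> (U Rp (0, x) + U Rm (0, x)) / 2 = u0 x \<and> U Vc (0, x) = v0 x" for x
      using RH_RK[OF \<gamma> h0(1)[of x]] by (simp add: UW(3) mid0) (simp add: U0_def)
    ultimately show "\<exists>h u v. classical_solution \<gamma> {0..\<delta>} h u v \<and> (\<forall>x. h 0 x = h0 x \<and> u 0 x = u0 x \<and> v 0 x = v0 x)"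
      by blast
  qed
qed

section \<open>Restriction, concatenation and union of classical solutions in time\<close>

lemma classical_solution_subset:
  assumes "classical_solution \<gamma> I h u v" "J \<subseteq> I" shows "classical_solution \<gamma> J h u v"
proof -
  have "J \<times> (UNIV :: real set) \<subseteq> I \<times> UNIV" using assms(2) by auto
  then show ?thesis using assms unfolding classical_solution_def
    by (blast intro: continuous_on_subset DERIV_subset)
qed

lemma dxi_cong: "f t = g t \<Longrightarrow> dxi f t x = dxi g t x"
  by (simp add: dxi_def)

lemma classical_solution_cong:
  assumes sol: "classical_solution \<gamma> I h u v"
    and eq: "\<And>t. t \<in> I \<Longrightarrow> H t = h t \<and> U t = u t \<and> V t = v t"
  shows "classical_solution \<gamma> I H U V"
proof -
  have cc: "continuous_on (I \<times> UNIV) (\<lambda>(t, x). F t x) \<and> (\<forall>t\<in>I. \<forall>x. (\<lambda>y. F t y) differentiable (at x)) \<and> continuous_on (I \<times> UNIV) (\<lambda>(t, x). dxi F t x)"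
    if f: "continuous_on (I \<times> UNIV) (\<lambda>(t, x). f t x)" "\<forall>t\<in>I. \<forall>x. (\<lambda>y. f t y) differentiable (at x)" "continuous_on (I \<times> UNIV) (\<lambda>(t, x). dxi f t x)"
      and e: "\<And>t. t \<in> I \<Longrightarrow> F t = f t" for f F :: "real \<Rightarrow> real \<Rightarrow> real"
    by (intro conjI continuous_on_eq[OF f(1)] continuous_on_eq[OF f(3)]) (use f(2) e dxi_cong[of F _ f] in auto)
  have tt: "((\<lambda>s. F s x) has_real_derivative D) (at t within I)"
    if "((\<lambda>s. f s x) has_real_derivative D) (at t within I)" "t \<in> I" "\<And>t. t \<in> I \<Longrightarrow> F t = f t" for f F :: "real \<Rightarrow> real \<Rightarrow> real" and x t D
    by (rule has_field_derivative_transform_within[OF that(1) zero_less_one that(2)]) (use that(3) in auto)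
  have e: "H t = h t" "U t = u t" "V t = v t" if "t \<in> I" for t using eq[OF that] by auto
  have ed: "dxi H t x = dxi h t x" "dxi U t x = dxi u t x" if "t \<in> I" for t x
    using e[OF that] by (auto intro: dxi_cong)
  show ?thesis
    unfolding classical_solution_def
  proof (intro conjI ballI allI)
    fix t x assume t: "t \<in> I"
    note s = sol[unfolded classical_solution_def]
    show "H t x > 0" using s t e by auto
    show "((\<lambda>s. H s x) has_real_derivative - (H t x)\<^sup>2 * dxi U t x) (at t within I)"
      unfolding e[OF t] ed[OF t] by (rule tt[of h]) (use s t e in auto)
    show "((\<lambda>s. U s x) has_real_derivative V t x - H t x powr (\<gamma> - 1) * dxi H t x) (at t within I)"
      unfolding e[OF t] ed[OF t] by (rule tt[of u]) (use s t e in auto)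
    show "((\<lambda>s. V s x) has_real_derivative - U t x) (at t within I)"
      unfolding e[OF t] ed[OF t] by (rule tt[of v]) (use s t e in auto)
  next
    fix F assume "F \<in> {H, U, V}"
    then consider "F = H" | "F = U" | "F = V" by blast
    then have *: "continuous_on (I \<times> UNIV) (\<lambda>(t, x). F t x) \<and> (\<forall>t\<in>I. \<forall>x. (\<lambda>y. F t y) differentiable (at x)) \<and> continuous_on (I \<times> UNIV) (\<lambda>(t, x). dxi F t x)"
    proof cases
      case 1 show ?thesis unfolding 1 by (rule cc[of h]) (use sol e in \<open>auto simp: classical_solution_def\<close>)
    next
      case 2 show ?thesis unfolding 2 by (rule cc[of u]) (use sol e in \<open>auto simp: classical_solution_def\<close>)
    next
      case 3 show ?thesis unfolding 3 by (rule cc[of v]) (use sol e in \<open>auto simp: classical_solution_def\<close>)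
    qed
    then show "continuous_on (I \<times> UNIV) (\<lambda>(t, x). F t x)" "continuous_on (I \<times> UNIV) (\<lambda>(t, x). dxi F t x)"
      by blast+
    show "(\<lambda>y. F t y) differentiable (at x)" if "t \<in> I" for t x using * that by blast
  qed
qed

definition glue :: "real \<Rightarrow> (real \<Rightarrow> real \<Rightarrow> real) \<Rightarrow> (real \<Rightarrow> real \<Rightarrow> real) \<Rightarrow> real \<Rightarrow> real \<Rightarrow> real" where
  "glue T f g t = (if t \<le> T then f t else g (t - T))"

lemma continuous_on_glue:
  fixes f g :: "real \<Rightarrow> real \<Rightarrow> real"
  assumes T: "T \<ge> 0" "\<delta> \<ge> 0" and f: "continuous_on ({0..T} \<times> UNIV) (\<lambda>(t, x). f t x)" and g: "continuous_on ({0..\<delta>} \<times> UNIV) (\<lambda>(t, x). g t x)"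
    and eq: "g 0 = f T"
  shows "continuous_on ({0..T + \<delta>} \<times> UNIV) (\<lambda>(t, x). glue T f g t x)"
proof -
  have g': "continuous_on ({T..T + \<delta>} \<times> UNIV) (\<lambda>p. (\<lambda>(t, x). g t x) (fst p - T, snd p))"
    by (rule continuous_on_compose2[OF g]) (auto intro!: continuous_intros)
  have "continuous_on ({0..T} \<times> UNIV \<union> {T..T + \<delta>} \<times> UNIV)
     (\<lambda>p. if fst p \<le> T then (\<lambda>(t, x). f t x) p else (\<lambda>(t, x). g t x) (fst p - T, snd p))"
    by (rule continuous_on_cases) (use f g' eq in \<open>auto intro!: closed_Times\<close>)
  moreover have "{0..T} \<times> UNIV \<union> {T..T + \<delta>} \<times> UNIV = {0..T + \<delta>} \<times> (UNIV :: real set)" using T by auto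
  moreover have "(\<lambda>p. if fst p \<le> T then (\<lambda>(t, x). f t x) p else (\<lambda>(t, x). g t x) (fst p - T, snd p)) = (\<lambda>(t, x). glue T f g t x)"
    by (auto simp: glue_def fun_eq_iff)
  ultimately show ?thesis by (simp only:)
qed

lemma dxi_glue: "dxi (glue T f g) t x = glue T (dxi f) (dxi g) t x"
  by (simp add: dxi_def glue_def)

lemma DERIV_glue:
  fixes f g Df Dg :: "real \<Rightarrow> real \<Rightarrow> real"
  assumes T: "T \<ge> 0" "\<delta> \<ge> 0"
    and f: "\<And>t. t \<in> {0..T} \<Longrightarrow> ((\<lambda>s. f s x) has_real_derivative Df t x) (at t within {0..T})"
    and g: "\<And>t. t \<in> {0..\<delta>} \<Longrightarrow> ((\<lambda>s. g s x) has_real_derivative Dg t x) (at t within {0..\<delta>})"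
    and eq: "g 0 = f T" and Deq: "Dg 0 x = Df T x" and t: "t \<in> {0..T + \<delta>}"
  shows "((\<lambda>s. glue T f g s x) has_real_derivative glue T Df Dg t x) (at t within {0..T + \<delta>})"
proof -
  have 1: "((\<lambda>s. glue T f g s x) has_real_derivative glue T Df Dg t x) (at t within {0..T})"
  proof (cases "t \<in> {0..T}")
    case True
    have "((\<lambda>s. glue T f g s x) has_real_derivative Df t x) (at t within {0..T})"
      by (rule has_field_derivative_transform_within[OF f[OF True] zero_less_one True]) (auto simp: glue_def)
    then show ?thesis using True by (simp add: glue_def)
  next
    case False
    \<comment> \<open>Away from the closed piece the filter is trivial, so the derivative statement
      holds for any value and the union of both pieces can be treated uniformly.\<close>
    then have "\<not> t islimpt {0..T}" using closed_limpt[of "{0..T}"] closed_atLeastAtMost by blast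
    then have "at t within {0..T} = bot" by (simp add: trivial_limit_within)
    then show ?thesis by (simp add: has_field_derivative_iff)
  qed
  have 2: "((\<lambda>s. glue T f g s x) has_real_derivative glue T Df Dg t x) (at t within {T..T + \<delta>})"
  proof (cases "t \<in> {T..T + \<delta>}")
    case True
    then have t': "t - T \<in> {0..\<delta>}" by auto
    have sh: "((\<lambda>s. s - T) has_real_derivative 1) (at t within {T..T + \<delta>})" by (auto intro!: derivative_eq_intros)
    have "(\<lambda>s. s - T) ` {T..T + \<delta>} \<subseteq> {0..\<delta>}" by auto
    then have "((\<lambda>s. g s x) has_real_derivative Dg (t - T) x) (at (t - T) within (\<lambda>s. s - T) ` {T..T + \<delta>})"
      by (rule DERIV_subset[OF g[OF t']])
    from DERIV_image_chain[OF this sh]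
    have d: "((\<lambda>s. g (s - T) x) has_real_derivative Dg (t - T) x) (at t within {T..T + \<delta>})" by (simp add: o_def)
    have "((\<lambda>s. glue T f g s x) has_real_derivative Dg (t - T) x) (at t within {T..T + \<delta>})"
      by (rule has_field_derivative_transform_within[OF d zero_less_one True]) (use eq in \<open>auto simp: glue_def\<close>)
    moreover have "Dg (t - T) x = glue T Df Dg t x" using True Deq by (auto simp: glue_def)
    ultimately show ?thesis by simp
  next
    case False
    then have "\<not> t islimpt {T..T + \<delta>}" using closed_limpt[of "{T..T + \<delta>}"] closed_atLeastAtMost by blast
    then have "at t within {T..T + \<delta>} = bot" by (simp add: trivial_limit_within)
    then show ?thesis by (simp add: has_field_derivative_iff)
  qed
  have "{0..T + \<delta>} = {0..T} \<union> {T..T + \<delta>}" using T by auto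
  then show ?thesis using 1 2 unfolding has_field_derivative_iff by (simp add: Lim_within_Un)
qed

text \<open>Equal profiles at the joint time have equal space derivatives, and the equations express
  the time derivatives through these; hence the one-sided time derivatives agree and the glued
  functions are again \<open>C^1\<close>.\<close>

lemma classical_solution_glue:
  assumes T: "T \<ge> 0" "\<delta> \<ge> 0" and s1: "classical_solution \<gamma> {0..T} h u v" and s2: "classical_solution \<gamma> {0..\<delta>} h' u' v'"
    and eq: "h' 0 = h T" "u' 0 = u T" "v' 0 = v T"
  shows "classical_solution \<gamma> {0..T + \<delta>} (glue T h h') (glue T u u') (glue T v v')"
proof -
  note a = s1[unfolded classical_solution_def] and b = s2[unfolded classical_solution_def]
  have de: "dxi h' 0 = dxi h T" "dxi u' 0 = dxi u T" "dxi v' 0 = dxi v T"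
    unfolding dxi_def[abs_def] eq by simp_all
  have c: "continuous_on ({0..T + \<delta>} \<times> UNIV) (\<lambda>(t, x). glue T f g t x) \<and> (\<forall>t\<in>{0..T + \<delta>}. \<forall>x. (\<lambda>y. glue T f g t y) differentiable (at x)) \<and>
     continuous_on ({0..T + \<delta>} \<times> UNIV) (\<lambda>(t, x). dxi (glue T f g) t x)"
    if "f \<in> {h, u, v}" "g \<in> {h', u', v'}" "g 0 = f T" "dxi g 0 = dxi f T" for f g
  proof (intro conjI)
    show "continuous_on ({0..T + \<delta>} \<times> UNIV) (\<lambda>(t, x). glue T f g t x)"
      using a b that by (intro continuous_on_glue T) blast+
    show "continuous_on ({0..T + \<delta>} \<times> UNIV) (\<lambda>(t, x). dxi (glue T f g) t x)"
      unfolding dxi_glue using a b that by (intro continuous_on_glue T) blast+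
    show "\<forall>t\<in>{0..T + \<delta>}. \<forall>x. (\<lambda>y. glue T f g t y) differentiable (at x)"
    proof (intro ballI allI)
      fix t x assume t: "t \<in> {0..T + \<delta>}"
      show "(\<lambda>y. glue T f g t y) differentiable (at x)"
      proof (cases "t \<le> T")
        case True
        then have "(\<lambda>y. f t y) differentiable (at x)" using a t that(1) by auto
        then show ?thesis using True by (simp add: glue_def)
      next
        case False
        then have "t - T \<in> {0..\<delta>}" using t by auto
        then have "(\<lambda>y. g (t - T) y) differentiable (at x)" using b that(2) by blast
        then show ?thesis using False by (simp add: glue_def)
      qed
    qed
  qed
  show ?thesis
    unfolding classical_solution_def
  proof (intro conjI ballI allI)
    fix t x assume t: "t \<in> {0..T + \<delta>}"
    show "glue T h h' t x > 0" using a b t by (auto simp: glue_def)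
    have "((\<lambda>s. glue T h h' s x) has_real_derivative glue T (\<lambda>t x. - (h t x)\<^sup>2 * dxi u t x) (\<lambda>t x. - (h' t x)\<^sup>2 * dxi u' t x) t x) (at t within {0..T + \<delta>})"
      using a b eq de by (intro DERIV_glue T t) auto
    then show "((\<lambda>s. glue T h h' s x) has_real_derivative - (glue T h h' t x)\<^sup>2 * dxi (glue T u u') t x) (at t within {0..T + \<delta>})"
      by (simp add: dxi_glue) (simp add: glue_def split: if_splits)
    have "((\<lambda>s. glue T u u' s x) has_real_derivative glue T (\<lambda>t x. v t x - h t x powr (\<gamma> - 1) * dxi h t x) (\<lambda>t x. v' t x - h' t x powr (\<gamma> - 1) * dxi h' t x) t x) (at t within {0..T + \<delta>})"
      using a b eq de by (intro DERIV_glue T t) auto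
    then show "((\<lambda>s. glue T u u' s x) has_real_derivative glue T v v' t x - glue T h h' t x powr (\<gamma> - 1) * dxi (glue T h h') t x) (at t within {0..T + \<delta>})"
      by (simp add: dxi_glue) (simp add: glue_def split: if_splits)
    have "((\<lambda>s. glue T v v' s x) has_real_derivative glue T (\<lambda>t x. - u t x) (\<lambda>t x. - u' t x) t x) (at t within {0..T + \<delta>})"
      using a b eq by (intro DERIV_glue T t) auto
    then show "((\<lambda>s. glue T v v' s x) has_real_derivative - glue T u u' t x) (at t within {0..T + \<delta>})"
      by (simp add: glue_def split: if_splits)
  next
    fix F assume "F \<in> {glue T h h', glue T u u', glue T v v'}"
    then have *: "continuous_on ({0..T + \<delta>} \<times> UNIV) (\<lambda>(t, x). F t x) \<and> (\<forall>t\<in>{0..T + \<delta>}. \<forall>x. (\<lambda>y. F t y) differentiable (at x)) \<and>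
     continuous_on ({0..T + \<delta>} \<times> UNIV) (\<lambda>(t, x). dxi F t x)"
      using c[of h h'] c[of u u'] c[of v v'] eq de by blast
    then show "continuous_on ({0..T + \<delta>} \<times> UNIV) (\<lambda>(t, x). F t x)" "continuous_on ({0..T + \<delta>} \<times> UNIV) (\<lambda>(t, x). dxi F t x)"
      by blast+
    show "(\<lambda>y. F t y) differentiable (at x)" if "t \<in> {0..T + \<delta>}" for t x using * that by blast
  qed
qed

text \<open>All conditions are local in time: for \<open>t < \<tau> n\<close> the neighbourhood
  filters within \<open>{0..<Ts}\<close> and \<open>{0..\<tau> n}\<close> coincide.\<close>

lemma classical_solution_union:
  assumes sol: "\<And>n::nat. classical_solution \<gamma> {0..\<tau> n} h u v" and inc: "\<And>t. 0 \<le> t \<Longrightarrow> t < Ts \<Longrightarrow> \<exists>n. t < \<tau> n"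
    and lt: "\<And>n. \<tau> n < Ts"
  shows "classical_solution \<gamma> {0..<Ts} h u v"
proof -
  note s = sol[unfolded classical_solution_def]
  have at: "at t within {0..<Ts} = at t within {0..\<tau> n}" if "t < \<tau> n" for t n
    by (rule at_within_nhd[of _ "{..<\<tau> n}"]) (use that lt[of n] in auto)
  have at2: "at (t, x) within {0..<Ts} \<times> UNIV = at (t, x) within {0..\<tau> n} \<times> UNIV" if "t < \<tau> n" for t n and x :: real
    by (rule at_within_nhd[of _ "{..<\<tau> n} \<times> UNIV"]) (use that lt[of n] in \<open>auto intro: open_Times\<close>)
  have c: "continuous_on ({0..<Ts} \<times> UNIV) F" if F: "\<And>n. continuous_on ({0..\<tau> n} \<times> UNIV) F" for F :: "real \<times> real \<Rightarrow> real"
    unfolding continuous_on_eq_continuous_within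
  proof
    fix p assume p: "p \<in> {0..<Ts} \<times> (UNIV :: real set)"
    obtain t x where tx: "p = (t, x)" "0 \<le> t" "t < Ts" using p by (cases p) auto
    obtain n where n: "t < \<tau> n" using inc tx by blast
    have "continuous (at (t, x) within {0..\<tau> n} \<times> UNIV) F"
      using F[of n] tx n unfolding continuous_on_eq_continuous_within by auto
    then show "continuous (at p within {0..<Ts} \<times> UNIV) F" by (simp add: at2[OF n] tx(1))
  qed
  show ?thesis
    unfolding classical_solution_def
  proof (intro conjI ballI allI)
    fix f assume f: "f \<in> {h, u, v}"
    show "continuous_on ({0..<Ts} \<times> UNIV) (\<lambda>(t, x). f t x)" using s f by (intro c) blast
    show "continuous_on ({0..<Ts} \<times> UNIV) (\<lambda>(t, x). dxi f t x)" using s f by (intro c) blast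
    fix t x assume "t \<in> {0..<Ts}"
    then have "\<exists>n. t \<in> {0..\<tau> n}" using inc[of t] by (auto intro: less_imp_le)
    then obtain n where "t \<in> {0..\<tau> n}" by blast
    then show "(\<lambda>y. f t y) differentiable (at x)" using s f by blast
  next
    fix t x assume "t \<in> {0..<Ts}"
    then have "\<exists>n. t < \<tau> n \<and> t \<in> {0..\<tau> n}" using inc[of t] by (auto intro: less_imp_le)
    then obtain n where n: "t < \<tau> n" "t \<in> {0..\<tau> n}" by blast
    show "h t x > 0" "((\<lambda>s. h s x) has_real_derivative - (h t x)\<^sup>2 * dxi u t x) (at t within {0..<Ts})"
      "((\<lambda>s. u s x) has_real_derivative v t x - h t x powr (\<gamma> - 1) * dxi h t x) (at t within {0..<Ts})"
      "((\<lambda>s. v s x) has_real_derivative - u t x) (at t within {0..<Ts})"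
      unfolding at[OF n(1)] using s n(2) by blast+
  qed
qed

section \<open>Finite time blow-up\<close>

text \<open>A constant other than 0 is allowed outside, as for \<open>1/h\<close>, which is 1
  there.\<close>

lemma (in localized_solution) bounded_of_constant_outside:
  assumes F: "continuous_on ({0..T} \<times> UNIV) F" and k: "\<And>t x. t \<in> {0..T} \<Longrightarrow> \<bar>x\<bar> > M0 + 2 * T \<Longrightarrow> F (t, x) = (k :: real)"
  shows "\<exists>C. \<forall>t\<in>{0..T}. \<forall>x. \<bar>F (t, x)\<bar> \<le> C"
proof -
  have "bounded (F ` slab)"
    by (intro compact_imp_bounded compact_continuous_image continuous_on_subset[OF F slab_sub] slab_compact)
  then obtain C where C: "\<forall>p\<in>slab. norm (F p) \<le> C" unfolding bounded_iff by blast
  have "\<bar>F (t, x)\<bar> \<le> max C \<bar>k\<bar>" if t: "t \<in> {0..T}" for t x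
  proof (cases "\<bar>x\<bar> > M0 + 2 * T")
    case True then show ?thesis using k[OF t True] by simp
  next
    case False
    then have "(t, x) \<in> slab" using t by (auto simp: slab_def)
    then have "norm (F (t, x)) \<le> C" using C by blast
    then show ?thesis by simp
  qed
  then show ?thesis by blast
qed

text \<open>\<open>W\<close> is an upper bound for the initial vorticity, and \<open>crit\<close>
  provides a point instead of an infimum; the final theorem supplies it by compactness.\<close>

locale blowup_data = localized_solution +
  fixes W :: real
  assumes W: "\<And>x. dxi v 0 x + 1 / h 0 x \<le> W" and W_pos: "W > 0"
    and crit: "\<exists>b x. Z b T x \<le> - sqrt (2 * W)"
begin

text \<open>The same quantity as \<open>solution.Z\<close>, written without \<open>V\<close> and for
  arbitrary \<open>H\<close> and \<open>U\<close>, so that statements can range over all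
  extensions.\<close>

definition zz :: "(real \<Rightarrow> real \<Rightarrow> real) \<Rightarrow> (real \<Rightarrow> real \<Rightarrow> real) \<Rightarrow> bool \<Rightarrow> real \<Rightarrow> real \<Rightarrow> real" where
  "zz H U b t x = Zw \<gamma> H U (if b then 2 else 1) t x"

definition ext :: "real \<Rightarrow> (real \<Rightarrow> real \<Rightarrow> real) \<Rightarrow> (real \<Rightarrow> real \<Rightarrow> real) \<Rightarrow> (real \<Rightarrow> real \<Rightarrow> real) \<Rightarrow> bool" where
  "ext T2 H U V \<longleftrightarrow> T \<le> T2 \<and> classical_solution \<gamma> {0..T2} H U V \<and> (\<forall>t\<in>{0..T}. H t = h t \<and> U t = u t \<and> V t = v t)"

lemma ext_localized: assumes "ext T2 H U V" shows "localized_solution \<gamma> T2 H U V M0"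
  using assms \<gamma> T M0 triv0 unfolding ext_def by unfold_locales auto

lemma ext0: "ext T2 H U V \<Longrightarrow> H 0 = h 0 \<and> U 0 = u 0 \<and> V 0 = v 0"
  using T by (auto simp: ext_def)

lemma ext_self: "ext T h u v" using sol by (simp add: ext_def)

lemma zz_cong: "H t = H' t \<Longrightarrow> U t = U' t \<Longrightarrow> zz H U b t x = zz H' U' b t x"
  using dxi_cong[of H t H' x] dxi_cong[of U t U' x] by (simp add: zz_def Zw_def)

lemma ext_Z: assumes "ext T2 H U V" shows "solution.Z \<gamma> H U V b t x = zz H U b t x"
proof -
  interpret s: localized_solution \<gamma> T2 H U V M0 by (rule ext_localized[OF assms])
  show ?thesis using s.Zw_eq by (cases b) (simp_all add: zz_def)
qed

lemma ext_W: assumes "ext T2 H U V" shows "dxi V 0 x + 1 / H 0 x \<le> W"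
  using W[of x] ext0[OF assms] dxi_cong[of V 0 v x] by simp

lemma zero_time: "0 \<in> {0..T}" using T by simp

text \<open>Both estimates start from time 0, where every extension has the same data; thus
  \<open>N\<close> and \<open>s0\<close> are common to all extensions, however long.\<close>

lemma ext_bounds:
  "\<exists>N s0. N \<ge> 1 \<and> s0 > 0 \<and> (\<forall>T2 H U V t x. ext T2 H U V \<longrightarrow> t \<in> {0..T2} \<longrightarrow>
     (\<forall>b. zz H U b t x \<le> N) \<and> 1 / sqrt (H t x) \<le> s0 + N / 2 * t)"
proof -
  have "\<exists>C. \<forall>t\<in>{0..T}. \<forall>x. \<bar>(\<lambda>(t, x). Z b t x) (t, x)\<bar> \<le> C" for b
    by (rule bounded_of_constant_outside[OF Z_cont, of _ 0]) (simp add: Z_outside)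
  then obtain C where C: "\<And>b x. \<bar>Z b 0 x\<bar> \<le> C b" using zero_time by (metis case_prod_conv)
  have "continuous_on ({0..T} \<times> UNIV) (\<lambda>p. 1 / sqrt (h (fst p) (snd p)))"
    using pos by (intro continuous_intros fields_cont) (auto simp: less_imp_neq[symmetric])
  from bounded_of_constant_outside[OF this, of 1]
  obtain s1 where s1: "\<And>x. \<bar>1 / sqrt (h 0 x)\<bar> \<le> s1" using zero_time outside by fastforce
  \<comment> \<open>At least the initial gradients and \<open>sqrt (2 * W)\<close>, as
    \<open>Z_upper\<close> requires, and at least 1 so that divisions by \<open>N\<close> are
    safe.\<close>
  define N where "N = max (max 1 (sqrt (2 * W))) (max (C True) (C False))"
  have N: "N \<ge> 1" "N \<ge> sqrt (2 * W)" "C b \<le> N" for b by (cases b; auto simp: N_def)+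
  have N2: "2 * W \<le> N\<^sup>2"
    using power_mono[OF N(2), of 2] W_pos by simp
  define s0 where "s0 = max s1 1"
  have "(\<forall>b. zz H U b t x \<le> N) \<and> 1 / sqrt (H t x) \<le> s0 + N / 2 * t" if e: "ext T2 H U V" and t: "t \<in> {0..T2}" for T2 H U V t x
  proof -
    interpret s: localized_solution \<gamma> T2 H U V M0 by (rule ext_localized[OF e])
    have z0: "s.Z b 0 x \<le> N" for b x
    proof -
      have "s.Z b 0 x = Z b 0 x" unfolding ext_Z[OF e] ext_Z[OF ext_self] using ext0[OF e] by (intro zz_cong) auto
      then show ?thesis using C[of b x] N(3)[of b] by (simp add: abs_le_iff)
    qed
    have up: "s.Z b t x \<le> N" if "t \<in> {0..T2}" for b t x
      by (rule s.Z_upper[OF ext_W[OF e] z0 _ N2 that]) (use N(1) in simp)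
    have "1 / sqrt (H t x) \<le> 1 / sqrt (H 0 x) + N / 2 * t" by (rule s.inv_sqrt_growth[OF up t])
    moreover have "1 / sqrt (h 0 x) \<le> s0" using abs_le_D1[OF s1[of x]] by (simp add: s0_def)
    then have "1 / sqrt (H 0 x) \<le> s0" using ext0[OF e] by simp
    ultimately have "1 / sqrt (H t x) \<le> s0 + N / 2 * t" by linarith
    then show ?thesis using up[OF t] by (simp add: ext_Z[OF e])
  qed
  then show ?thesis using N(1) by (intro exI[of _ N] exI[of _ s0]) (auto simp: s0_def)
qed

text \<open>The Riemann invariants bound \<open>H\<close>, \<open>U\<close> and \<open>V\<close>;
  conserved vorticity and the lower bound on \<open>H\<close> bound \<open>dxi V\<close>. The other
  two gradients are absent because they are what blows up.\<close>

lemma ext_sup_bounds: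
  "\<exists>B>0. \<forall>T2 H U V t x. ext T2 H U V \<longrightarrow> T2 \<le> Tb \<longrightarrow> t \<in> {0..T2} \<longrightarrow>
     H t x \<le> B \<and> \<bar>U t x\<bar> \<le> B \<and> \<bar>V t x\<bar> \<le> B \<and> \<bar>dxi V t x\<bar> \<le> B"
proof -
  obtain N s0 where N: "N \<ge> 1" "s0 > 0" "\<And>T2 H U V t x b. ext T2 H U V \<Longrightarrow> t \<in> {0..T2} \<Longrightarrow> zz H U b t x \<le> N"
    "\<And>T2 H U V t x. ext T2 H U V \<Longrightarrow> t \<in> {0..T2} \<Longrightarrow> 1 / sqrt (H t x) \<le> s0 + N / 2 * t"
    using ext_bounds by blast
  have "\<exists>C. \<forall>t\<in>{0..T}. \<forall>x. \<bar>(\<lambda>(t, x). rie i t x) (t, x)\<bar> \<le> C" for i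
    by (rule bounded_of_constant_outside[OF rie_cont, of _ 0]) (use outside in \<open>cases i; simp\<close>)
  then obtain C where C: "\<And>i x. \<bar>rie i 0 x\<bar> \<le> C i" using zero_time by (metis case_prod_conv)
  define N0 where "N0 = max (C Rp) (max (C Rm) (C Vc))"
  have N0: "\<bar>rie i 0 x\<bar> \<le> N0" for i x using C[of i x] by (cases i) (auto simp: N0_def)
  have N0': "N0 \<ge> 0" using N0[of Rp 0] by linarith
  have "continuous_on ({0..T} \<times> UNIV) (\<lambda>p. dxi v (fst p) (snd p) + 1 / h (fst p) (snd p))"
    using pos by (intro continuous_intros fields_cont) (auto simp: less_imp_neq[symmetric])
  from bounded_of_constant_outside[OF this, of 1]
  have "\<exists>C. \<forall>t\<in>{0..T}. \<forall>x. \<bar>dxi v t x + 1 / h t x\<bar> \<le> C" using outside outside_dx by simp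
  then obtain \<Omega> where \<Omega>: "\<And>x. \<bar>dxi v 0 x + 1 / h 0 x\<bar> \<le> \<Omega>" using zero_time by blast
  define Q where "Q = N0 * exp (2 * Tb)"
  obtain b1 where b1: "b1 > 0" "\<And>h. h > 0 \<Longrightarrow> RK \<gamma> h \<le> Q \<Longrightarrow> h \<le> b1" using RK_unbounded[OF \<gamma>, of Q] by blast
  define S where "S = s0 + N / 2 * Tb"
  define B where "B = b1 + \<bar>Q\<bar> + (\<bar>\<Omega>\<bar> + S\<^sup>2)"
  have "H t x \<le> B \<and> \<bar>U t x\<bar> \<le> B \<and> \<bar>V t x\<bar> \<le> B \<and> \<bar>dxi V t x\<bar> \<le> B"
    if e: "ext T2 H U V" and T2: "T2 \<le> Tb" and t: "t \<in> {0..T2}" for T2 H U V t x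
  proof -
    interpret s: localized_solution \<gamma> T2 H U V M0 by (rule ext_localized[OF e])
    have "\<bar>s.rie i 0 x\<bar> \<le> N0" for i x
    proof -
      have "s.rie i 0 x = rie i 0 x" using ext0[OF e] by (cases i) simp_all
      then show ?thesis using N0[of i x] by simp
    qed
    then have r1: "\<bar>s.rie i t x\<bar> \<le> N0 * exp (2 * t)" for i by (rule s.rie_bound[OF _ t])
    have "N0 * exp (2 * t) \<le> Q" unfolding Q_def using t T2 N0' by (intro mult_left_mono) auto
    with r1 have r: "\<bar>s.rie i t x\<bar> \<le> Q" for i by (meson order_trans)
    have p: "H t x > 0" by (rule s.pos[OF t])
    have "RK \<gamma> (H t x) \<le> Q" using abs_mid_le[of "\<lambda>j. s.rie j t x", OF r] by (simp add: s.rie_mid)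
    then have 1: "H t x \<le> b1" using b1(2) p by blast
    have 2: "\<bar>U t x\<bar> \<le> Q" "\<bar>V t x\<bar> \<le> Q" using r[of Rp] r[of Rm] r[of Vc] by (auto simp: abs_le_iff)
    have "1 / sqrt (H t x) \<le> S"
    proof -
      have "N / 2 * t \<le> N / 2 * Tb" using t T2 N(1) by (intro mult_left_mono) auto
      then show ?thesis using N(4)[OF e t, of x] by (simp add: S_def)
    qed
    then have "(1 / sqrt (H t x))\<^sup>2 \<le> S\<^sup>2" using p by (intro power_mono) auto
    then have 3: "1 / H t x \<le> S\<^sup>2" using p by (simp add: power_divide)
    have "dxi V t x + 1 / H t x = dxi v 0 x + 1 / h 0 x"
      using s.vorticity[OF t, of x] ext0[OF e] dxi_cong[of V 0 v x] by simp
    moreover have "1 / H t x > 0" using p by simp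
    ultimately have 4: "\<bar>dxi V t x\<bar> \<le> \<Omega> + S\<^sup>2" using \<Omega>[of x] 3 by linarith
    show ?thesis using 1 2 4 b1(1) by (auto simp: B_def)
  qed
  moreover have "B > 0" using b1(1) by (auto simp: B_def intro: add_pos_nonneg)
  ultimately show ?thesis by blast
qed

text \<open>A constant barrier at or below \<open>- sqrt (2 * W)\<close> is strict thanks to
  \<open>- 1/h\<close>. This turns a low value at one time into low values at all later times, hence
  into a limit.\<close>

lemma negative_persists:
  assumes e: "ext T2 H U V" and t: "0 \<le> t1" "t1 \<le> t2" "t2 \<le> T2" and L: "L \<ge> sqrt (2 * W)" and z: "zz H U b t1 x \<le> - L"
  shows "\<exists>b x. zz H U b t2 x \<le> - L"
proof -
  interpret s: localized_solution \<gamma> T2 H U V M0 by (rule ext_localized[OF e])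
  have "sqrt (2 * W) > 0" using W_pos by simp
  with L have L0: "L > 0" by linarith
  have "2 * W \<le> L\<^sup>2" using power_mono[OF L, of 2] W_pos by simp
  have "\<exists>b x. s.Z b t2 x \<le> - L"
  proof (rule s.barrier_forward[OF ext_W[OF e] t, where y = "\<lambda>_. - L" and y' = "\<lambda>_. 0"])
    fix t x assume "t \<in> {t1..t2}"
    then have p: "H t x > 0" using t by (intro s.pos) auto
    have "1 / H t x > 0" using p by simp
    then have "W - 1 / H t x - (- L)\<^sup>2 / 2 < 0" using \<open>2 * W \<le> L\<^sup>2\<close> unfolding power2_minus by linarith
    then show "sqrt (H t x) * (W - 1 / H t x - (- L)\<^sup>2 / 2) < 0" using p by (intro mult_pos_neg) auto
  qed (use L0 z t in \<open>auto simp: ext_Z[OF e]\<close>)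
  then show ?thesis by (simp add: ext_Z[OF e])
qed

text \<open>First the strict inequality is gained from the term \<open>- 1 / h\<close>; afterwards the minimum obeys
  \<open>z' \<le> - \<theta> z\<^sup>2 / s\<close> with \<open>s\<close> growing linearly, and \<open>1 / s\<close> has infinite integral.\<close>
lemma lifespan_bounded: "\<exists>Tm. \<forall>T2 H U V. ext T2 H U V \<longrightarrow> T2 < Tm"
proof -
  obtain N s0 where N: "N \<ge> 1" "s0 > 0" "\<And>T2 H U V t x b. ext T2 H U V \<Longrightarrow> t \<in> {0..T2} \<Longrightarrow> zz H U b t x \<le> N"
    "\<And>T2 H U V t x. ext T2 H U V \<Longrightarrow> t \<in> {0..T2} \<Longrightarrow> 1 / sqrt (H t x) \<le> s0 + N / 2 * t"
    using ext_bounds by blast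
  obtain B where B: "B > 0" "\<And>T2 H U V t x. ext T2 H U V \<Longrightarrow> T2 \<le> T + 1 \<Longrightarrow> t \<in> {0..T2} \<Longrightarrow> H t x \<le> B"
    using ext_sup_bounds[of "T + 1"] by blast
  define \<sigma> where "\<sigma> = sqrt (2 * W)"
  have \<sigma>: "\<sigma> > 0" "\<sigma>\<^sup>2 = 2 * W" using W_pos by (simp_all add: \<sigma>_def)
  \<comment> \<open>On the threshold the decay rate is at least
    \<open>1 / sqrt h \<ge> 1 / sqrt B\<close>; half of it makes the linear barrier of the first
    stage strict. After one unit of time that barrier stands at \<open>- \<rho>\<close>.\<close>
  define \<kappa> where "\<kappa> = 1 / (2 * sqrt B)"
  have \<kappa>: "\<kappa> > 0" "\<kappa> < 1 / sqrt B" using B(1) by (simp_all add: \<kappa>_def field_simps)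
  define \<rho> where "\<rho> = \<sigma> + \<kappa>"
  have \<rho>: "\<rho> > 0" "\<rho> > \<sigma>" using \<sigma> \<kappa> by (simp_all add: \<rho>_def)
  have "2 * W < \<rho>\<^sup>2" unfolding \<sigma>(2)[symmetric] using \<rho> \<sigma> by (intro power_strict_mono) auto
  \<comment> \<open>For \<open>y \<ge> \<rho>\<close> one has
    \<open>W \<le> (W / \<rho>\<^sup>2) * y\<^sup>2\<close>, so
    \<open>W - y\<^sup>2 / 2 \<le> - \<theta> * y\<^sup>2\<close>.\<close>
  define \<theta> where "\<theta> = 1 / 2 - W / \<rho>\<^sup>2"
  have \<theta>: "\<theta> > 0" using \<open>2 * W < \<rho>\<^sup>2\<close> \<rho> by (simp add: \<theta>_def field_simps)
  define s where "s t = s0 + N / 2 * t" for t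
  define t1 where "t1 = T + 1"
  have t1: "t1 > 0" using T by (simp add: t1_def)
  have spos: "s t > 0" if "t \<ge> 0" for t using that N(1,2) by (simp add: s_def add_pos_nonneg)
  define a where "a = 2 * \<theta> / N"
  have a: "a > 0" using \<theta> N(1,2) by (simp add: a_def)
  \<comment> \<open>The time at which the barrier \<open>- 1 / D\<close> used below has
    \<open>D = z\<close>; \<open>time 0\<close> is when it reaches minus infinity.\<close>
  define time where "time z = (s t1 * exp ((1 / \<rho> - z) / a) - s0) * (2 / N)" for z
  have stime: "s (time z) = s t1 * exp ((1 / \<rho> - z) / a)" for z
  proof -
    have "N / 2 * (w * (2 / N)) = w" for w using N(1) by simp
    then show ?thesis by (simp only: s_def time_def)
  qed
  have time_mono: "time z < time z'" if "z' < z" for z z'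
  proof -
    have "exp ((1 / \<rho> - z) / a) < exp ((1 / \<rho> - z') / a)" using that a by (simp add: divide_strict_right_mono)
    then have "s t1 * exp ((1 / \<rho> - z) / a) < s t1 * exp ((1 / \<rho> - z') / a)"
      using spos[of t1] t1 by (intro mult_strict_left_mono) auto
    then show ?thesis unfolding time_def using N(1,2) by (intro mult_strict_right_mono) auto
  qed
  have time1: "time (1 / \<rho>) = t1" using N(1) by (simp add: time_def s_def)
  have "T2 < time 0" if e: "ext T2 H U V" for T2 H U V
  proof (rule ccontr)
    assume "\<not> T2 < time 0"
    then have T2: "time 0 \<le> T2" by simp
    interpret so: localized_solution \<gamma> T2 H U V M0 by (rule ext_localized[OF e])
    have "time (1 / \<rho>) < time 0" using \<rho> by (intro time_mono) auto
    then have t1T2: "t1 < T2" using T2 time1 by linarith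
    \<comment> \<open>Restricting to \<open>{0..t1}\<close> makes the bound \<open>B\<close>, which
      holds for extensions up to \<open>T + 1\<close>, available for an extension of any
      length.\<close>
    have eT1: "ext t1 H U V"
      using e classical_solution_subset[of \<gamma> "{0..T2}" H U V "{0..t1}"] t1T2 by (auto simp: ext_def t1_def)
    have st0: "\<exists>b x. so.Z b T x \<le> - \<sigma>"
    proof -
      obtain b x where "Z b T x \<le> - \<sigma>" using crit by (auto simp: \<sigma>_def)
      moreover have "so.Z b T x = Z b T x" unfolding ext_Z[OF e] ext_Z[OF ext_self]
        using e T by (intro zz_cong) (auto simp: ext_def)
      ultimately show ?thesis by metis
    qed
    have stage1: "\<exists>b x. so.Z b t1 x \<le> - \<sigma> - \<kappa> * (t1 - T)"
    proof (rule so.barrier_forward[OF ext_W[OF e], where y = "\<lambda>t. - \<sigma> - \<kappa> * (t - T)" and y' = "\<lambda>_. - \<kappa>" and ?t1.0 = T and ?t2.0 = t1])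
      show "((\<lambda>t. - \<sigma> - \<kappa> * (t - T)) has_real_derivative - \<kappa>) (at t within {T..t1})" for t
        by (auto intro!: derivative_eq_intros)
      fix t x assume t: "t \<in> {T..t1}"
      have k0: "\<kappa> * (t - T) \<ge> 0" using t \<kappa> by simp
      show "- \<sigma> - \<kappa> * (t - T) < 0" using k0 \<sigma> by linarith
      have t': "t \<in> {0..t1}" using t T by auto
      have p: "H t x > 0" using t' t1T2 by (intro so.pos) auto
      have "\<sigma>\<^sup>2 \<le> (\<sigma> + \<kappa> * (t - T))\<^sup>2" using k0 \<sigma> by (intro power_mono) auto
      moreover have "(- \<sigma> - \<kappa> * (t - T))\<^sup>2 = (\<sigma> + \<kappa> * (t - T))\<^sup>2" by (simp add: power2_eq_square algebra_simps)
      ultimately have "W - 1 / H t x - (- \<sigma> - \<kappa> * (t - T))\<^sup>2 / 2 \<le> - (1 / H t x)" using \<sigma>(2) by linarith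
      then have "sqrt (H t x) * (W - 1 / H t x - (- \<sigma> - \<kappa> * (t - T))\<^sup>2 / 2) \<le> sqrt (H t x) * (- (1 / H t x))"
        using p by (intro mult_left_mono) auto
      also have "\<dots> = - (1 / sqrt (H t x))" using p by (simp add: real_div_sqrt field_simps)
      also have "\<dots> \<le> - (1 / sqrt B)"
      proof -
        have "H t x \<le> B" using B(2)[OF eT1 _ t'] by (simp add: t1_def)
        then show ?thesis using p by (simp add: frac_le)
      qed
      also have "\<dots> < - \<kappa>" using \<kappa> by simp
      finally show "sqrt (H t x) * (W - 1 / H t x - (- \<sigma> - \<kappa> * (t - T))\<^sup>2 / 2) < - \<kappa>" .
    qed (use T st0 t1T2 in \<open>auto simp: t1_def\<close>)
    then have start: "\<exists>b x. so.Z b t1 x \<le> - \<rho>" by (simp add: t1_def \<rho>_def)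
    have "\<exists>C. \<forall>t\<in>{0..T2}. \<forall>x. \<bar>(\<lambda>(t, x). so.Z b t x) (t, x)\<bar> \<le> C" for b
      by (rule so.bounded_of_constant_outside[OF so.Z_cont, of _ 0]) (simp add: so.Z_outside)
    then obtain C where C: "\<And>b t x. t \<in> {0..T2} \<Longrightarrow> \<bar>so.Z b t x\<bar> \<le> C b" by (metis case_prod_conv)
    \<comment> \<open>Small enough that \<open>1 / \<epsilon>\<close> exceeds every value of
      \<open>\<bar>Z\<bar>\<close> on the compact time interval, yet positive, so that
      \<open>time \<epsilon>\<close> comes before \<open>time 0\<close>.\<close>
    define \<epsilon> where "\<epsilon> = min (1 / \<rho>) (1 / (\<bar>C True\<bar> + \<bar>C False\<bar> + 1))"
    have \<epsilon>: "\<epsilon> > 0" "\<epsilon> \<le> 1 / \<rho>" "\<epsilon> \<le> 1 / (\<bar>C True\<bar> + \<bar>C False\<bar> + 1)" using \<rho> by (auto simp: \<epsilon>_def)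
    define t2 where "t2 = time \<epsilon>"
    have t12: "t1 \<le> t2"
      using time_mono[of \<epsilon> "1 / \<rho>"] \<epsilon>(2) time1 by (cases "\<epsilon> = 1 / \<rho>") (auto simp: t2_def dest: time_mono[of _ \<epsilon>])
    have t2T: "t2 \<le> T2" using time_mono[OF \<epsilon>(1)] T2 by (simp add: t2_def)
    \<comment> \<open>Solution of \<open>D' = - \<theta> / s\<close> with
      \<open>D t1 = 1 / \<rho>\<close>; then \<open>- 1 / D\<close> solves
      \<open>y' = - \<theta> * y^2 / s\<close>.\<close>
    define D where "D t = 1 / \<rho> - a * (ln (s t) - ln (s t1))" for t
    have D2: "D t2 = \<epsilon>"
      unfolding D_def t2_def stime using spos[of t1] t1 a by (simp add: ln_mult)
    have sm: "s t \<le> s t'" if "t \<le> t'" for t t' using that N(1,2) by (simp add: s_def)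
    have Dle: "D t \<le> 1 / \<rho>" and Dge: "\<epsilon> \<le> D t" if t: "t \<in> {t1..t2}" for t
    proof -
      have t0: "t > 0" using t t1 by auto
      have "ln (s t1) \<le> ln (s t)" "ln (s t) \<le> ln (s t2)"
        using spos[of t1] spos[of t] spos[of t2] t1 t0 t sm[of t1 t] sm[of t t2] by auto
      then have "a * ln (s t1) \<le> a * ln (s t)" "a * ln (s t) \<le> a * ln (s t2)" using a by (auto intro: mult_left_mono)
      then show "D t \<le> 1 / \<rho>" "\<epsilon> \<le> D t" using D2 unfolding D_def by (auto simp: right_diff_distrib)
    qed
    have "\<exists>b x. so.Z b t2 x \<le> - (1 / D t2)"
    proof (rule so.barrier_forward[OF ext_W[OF e], where y = "\<lambda>t. - (1 / D t)" and y' = "\<lambda>t. - \<theta> * (1 / D t)\<^sup>2 / s t" and ?t1.0 = t1 and ?t2.0 = t2])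
      fix t x assume t: "t \<in> {t1..t2}"
      have t0: "t > 0" using t t1 by auto
      have Dp: "D t > 0" using Dge[OF t] \<epsilon>(1) by linarith
      show "- (1 / D t) < 0" using Dp by simp
      have ds: "(s has_real_derivative N / 2) (at t within {t1..t2})" unfolding s_def[abs_def] by (auto intro!: derivative_eq_intros)
      have dD: "(D has_real_derivative - (a * (N / 2 / s t))) (at t within {t1..t2})"
        unfolding D_def[abs_def] using spos[of t] t0 by (auto intro!: derivative_eq_intros ds simp: mult_ac)
      have aN: "a * (N / 2 / s t) = \<theta> / s t" using N(1,2) by (simp add: a_def)
      show "((\<lambda>t. - (1 / D t)) has_real_derivative - \<theta> * (1 / D t)\<^sup>2 / s t) (at t within {t1..t2})"
        using Dp by (auto intro!: derivative_eq_intros dD[unfolded aN] simp: power2_eq_square divide_simps)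
      have t': "t \<in> {0..T2}" using t t2T t1 by auto
      have p: "H t x > 0" by (rule so.pos[OF t'])
      define y where "y = 1 / D t"
      have y\<rho>: "\<rho> \<le> y" using Dle[OF t] Dp \<rho> by (simp add: y_def field_simps)
      have "W \<le> W / \<rho>\<^sup>2 * y\<^sup>2"
      proof -
        have "\<rho>\<^sup>2 \<le> y\<^sup>2" using y\<rho> \<rho> by (intro power_mono) auto
        then have "W * \<rho>\<^sup>2 \<le> W * y\<^sup>2" using W_pos by (intro mult_left_mono) auto
        then show ?thesis using \<rho> by (simp add: field_simps)
      qed
      then have "W - y\<^sup>2 / 2 \<le> - \<theta> * y\<^sup>2" by (simp add: \<theta>_def algebra_simps)
      moreover have "1 / H t x > 0" using p by simp
      ultimately have "W - 1 / H t x - y\<^sup>2 / 2 < - \<theta> * y\<^sup>2" by linarith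
      then have "sqrt (H t x) * (W - 1 / H t x - y\<^sup>2 / 2) < sqrt (H t x) * (- \<theta> * y\<^sup>2)"
        using p by (intro mult_strict_left_mono) auto
      also have "\<dots> \<le> 1 / s t * (- \<theta> * y\<^sup>2)"
      proof (rule mult_right_mono_neg)
        have "1 / sqrt (H t x) \<le> s t" using N(4)[OF e t'] by (simp add: s_def)
        then show "1 / s t \<le> sqrt (H t x)" using p spos[of t] t0 by (simp add: field_simps)
        show "- \<theta> * y\<^sup>2 \<le> 0" using \<theta> by simp
      qed
      finally show "sqrt (H t x) * (W - 1 / H t x - (- (1 / D t))\<^sup>2 / 2) < - \<theta> * (1 / D t)\<^sup>2 / s t"
        by (simp add: y_def)
    next
      have "D t1 = 1 / \<rho>" by (simp add: D_def)
      then show "\<exists>b x. so.Z b t1 x \<le> - (1 / D t1)" using start by simp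
    qed (use t1 t12 t2T in auto)
    then obtain b x where bx: "so.Z b t2 x \<le> - (1 / \<epsilon>)" unfolding D2 by blast
    have "\<bar>C True\<bar> + \<bar>C False\<bar> + 1 \<le> 1 / \<epsilon>" using \<epsilon>(1,3) by (simp add: field_simps)
    moreover have "\<bar>so.Z b t2 x\<bar> \<le> C b" using t1 t12 t2T by (intro C) auto
    ultimately show False using bx by (cases b) auto
  qed
  then show ?thesis by blast
qed

text \<open>Two-sided bounds on the weighted gradients and the lower bound on the density control
  \<open>u_x\<close> and \<open>h_x\<close>; with \<open>ext_sup_bounds\<close> this puts all data
  at time \<open>T2\<close> into one class for \<open>local_existence\<close>, whose
  \<open>\<delta>\<close> therefore depends only on \<open>Tb\<close> and \<open>L\<close>.\<close>

lemma uniform_continuation: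
  "\<exists>\<delta>>0. \<forall>T2 H U V. ext T2 H U V \<longrightarrow> T2 \<le> Tb \<longrightarrow> (\<forall>b x. zz H U b T2 x \<ge> - L) \<longrightarrow>
    (\<exists>H' U' V'. ext (T2 + \<delta>) H' U' V' \<and> (\<forall>t\<in>{0..T2}. H' t = H t \<and> U' t = U t \<and> V' t = V t))"
proof -
  obtain N s0 where N: "N \<ge> 1" "s0 > 0" "\<And>T2 H U V t x b. ext T2 H U V \<Longrightarrow> t \<in> {0..T2} \<Longrightarrow> zz H U b t x \<le> N"
    "\<And>T2 H U V t x. ext T2 H U V \<Longrightarrow> t \<in> {0..T2} \<Longrightarrow> 1 / sqrt (H t x) \<le> s0 + N / 2 * t"
    using ext_bounds by blast
  obtain B where B: "B > 0" "\<And>T2 H U V t x. ext T2 H U V \<Longrightarrow> T2 \<le> Tb \<Longrightarrow> t \<in> {0..T2} \<Longrightarrow>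
     H t x \<le> B \<and> \<bar>U t x\<bar> \<le> B \<and> \<bar>V t x\<bar> \<le> B \<and> \<bar>dxi V t x\<bar> \<le> B"
    using ext_sup_bounds[of Tb] by blast
  define S where "S = s0 + N / 2 * \<bar>Tb\<bar>"
  have S: "S > 0" using N(1,2) by (simp add: S_def add_pos_nonneg)
  define bm where "bm = 1 / S\<^sup>2"
  have bm: "bm > 0" using S by (simp add: bm_def)
  define \<zeta> where "\<zeta> = max N \<bar>L\<bar>"
  have \<zeta>: "\<zeta> \<ge> 0" using N(1,2) by (simp add: \<zeta>_def)
  define p where "p = (3 - \<gamma>) / 2"
  \<comment> \<open>The summands bound \<open>h_x\<close>, \<open>u_x\<close> and
    \<open>v_x\<close>. Half the sum and half the difference of the two gradients are
    \<open>u_x\<close> and \<open>q * h_x\<close>, each at most \<open>\<zeta> * S\<close>, and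
    \<open>h_x\<close> is \<open>h powr p\<close> times the latter.\<close>
  define M where "M = (bm powr p + B powr p) * (\<zeta> * S) + \<zeta> * S + B"
  have \<zeta>S: "0 \<le> \<zeta> * S" using \<zeta> S by simp
  have pS: "0 \<le> (bm powr p + B powr p) * (\<zeta> * S)" using \<zeta>S by (intro mult_nonneg_nonneg[OF _ \<zeta>S]) auto
  obtain \<delta> where \<delta>: "\<delta> > 0" and ex: "\<And>h0 u0 v0 hx ux vx :: real \<Rightarrow> real.
    (\<forall>x. (h0 has_real_derivative hx x) (at x) \<and> (u0 has_real_derivative ux x) (at x) \<and> (v0 has_real_derivative vx x) (at x)) \<Longrightarrow>
    continuous_on UNIV hx \<Longrightarrow> continuous_on UNIV ux \<Longrightarrow> continuous_on UNIV vx \<Longrightarrow>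
    (\<exists>R. \<forall>x. \<bar>x\<bar> > R \<longrightarrow> hx x = 0 \<and> ux x = 0 \<and> vx x = 0) \<Longrightarrow>
    (\<forall>x. bm \<le> h0 x \<and> h0 x \<le> B \<and> \<bar>u0 x\<bar> \<le> B \<and> \<bar>v0 x\<bar> \<le> B \<and> \<bar>hx x\<bar> \<le> M \<and> \<bar>ux x\<bar> \<le> M \<and> \<bar>vx x\<bar> \<le> M) \<Longrightarrow>
    (\<exists>h u v. classical_solution \<gamma> {0..\<delta>} h u v \<and> (\<forall>x. h 0 x = h0 x \<and> u 0 x = u0 x \<and> v 0 x = v0 x))"
    using local_existence[OF \<gamma> bm, of B M] by blast
  have "\<exists>H' U' V'. ext (T2 + \<delta>) H' U' V' \<and> (\<forall>t\<in>{0..T2}. H' t = H t \<and> U' t = U t \<and> V' t = V t)"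
    if e: "ext T2 H U V" and T2: "T2 \<le> Tb" and low: "\<And>b x. zz H U b T2 x \<ge> - L" for T2 H U V
  proof -
    interpret s: localized_solution \<gamma> T2 H U V M0 by (rule ext_localized[OF e])
    have t: "T2 \<in> {0..T2}" using s.T by simp
    have "\<exists>h' u' v'. classical_solution \<gamma> {0..\<delta>} h' u' v' \<and> (\<forall>x. h' 0 x = H T2 x \<and> u' 0 x = U T2 x \<and> v' 0 x = V T2 x)"
    proof (rule ex[of "H T2" "dxi H T2" "U T2" "dxi U T2" "V T2" "dxi V T2"])
      show "\<forall>x. (H T2 has_real_derivative dxi H T2 x) (at x) \<and> (U T2 has_real_derivative dxi U T2 x) (at x) \<and> (V T2 has_real_derivative dxi V T2 x) (at x)"
        using s.dx[OF _ t] by auto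
      have c: "continuous_on UNIV (dxi f T2)" if "f \<in> {H, U, V}" for f
      proof -
        have "continuous_on UNIV (\<lambda>x. (\<lambda>(t, x). dxi f t x) (T2, x))"
          by (rule continuous_on_compose2[OF s.contx[OF that]]) (use t in \<open>auto intro!: continuous_intros\<close>)
        then show ?thesis by simp
      qed
      then show "continuous_on UNIV (dxi H T2)" "continuous_on UNIV (dxi U T2)" "continuous_on UNIV (dxi V T2)" by auto
      show "\<exists>R. \<forall>x. \<bar>x\<bar> > R \<longrightarrow> dxi H T2 x = 0 \<and> dxi U T2 x = 0 \<and> dxi V T2 x = 0"
        using s.outside_dx[OF t] by (intro exI[of _ "M0 + 2 * T2"]) auto
      show "\<forall>x. bm \<le> H T2 x \<and> H T2 x \<le> B \<and> \<bar>U T2 x\<bar> \<le> B \<and> \<bar>V T2 x\<bar> \<le> B \<and> \<bar>dxi H T2 x\<bar> \<le> M \<and> \<bar>dxi U T2 x\<bar> \<le> M \<and> \<bar>dxi V T2 x\<bar> \<le> M"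
      proof
        fix x
        have Bx: "H T2 x \<le> B" "\<bar>U T2 x\<bar> \<le> B" "\<bar>V T2 x\<bar> \<le> B" "\<bar>dxi V T2 x\<bar> \<le> B" using B(2)[OF e T2 t] by auto
        have pH: "H T2 x > 0" by (rule s.pos[OF t])
        define r where "r = sqrt (H T2 x)"
        have r: "r > 0" "H T2 x = r\<^sup>2" using pH by (simp_all add: r_def)
        have "N / 2 * T2 \<le> N / 2 * \<bar>Tb\<bar>" using T2 N(1,2) by (intro mult_left_mono) auto
        then have rS: "1 / r \<le> S" using N(4)[OF e t, of x] by (simp add: r_def S_def)
        then have "1 / S \<le> r" using r S by (simp add: field_simps)
        then have "(1 / S)\<^sup>2 \<le> r\<^sup>2" using S by (intro power_mono) auto
        then have bH: "bm \<le> H T2 x" by (simp add: bm_def r(2) power_divide)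
        have zle: "\<bar>zz H U b T2 x\<bar> \<le> \<zeta>" for b using N(3)[OF e t, of b x] low[of b x] by (auto simp: \<zeta>_def)
        define g where "g = s.q T2 x * dxi H T2 x"
        have zt: "zz H U True T2 x = r * (dxi U T2 x + g)" and zf: "zz H U False T2 x = r * (dxi U T2 x - g)"
          unfolding ext_Z[OF e, symmetric] by (simp_all add: s.Z_def s.cb_def r_def g_def)
        have "\<bar>r * dxi U T2 x\<bar> \<le> \<zeta>" "\<bar>r * g\<bar> \<le> \<zeta>"
          using zle[of True] zle[of False] unfolding zt zf by (auto simp: abs_le_iff algebra_simps)
        then have "r * \<bar>dxi U T2 x\<bar> \<le> \<zeta>" "r * \<bar>g\<bar> \<le> \<zeta>" using r by (simp_all add: abs_mult)
        then have "\<bar>dxi U T2 x\<bar> \<le> \<zeta> * (1 / r)" "\<bar>g\<bar> \<le> \<zeta> * (1 / r)" using r by (simp_all add: field_simps)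
        moreover have "\<zeta> * (1 / r) \<le> \<zeta> * S" using rS \<zeta> by (intro mult_left_mono)
        ultimately have U1: "\<bar>dxi U T2 x\<bar> \<le> \<zeta> * S" and g1: "\<bar>g\<bar> \<le> \<zeta> * S" by linarith+
        have "dxi H T2 x = H T2 x powr p * g"
        proof -
          have "H T2 x powr p * s.q T2 x = H T2 x powr (p + (\<gamma> - 3) / 2)" by (simp add: s.q_def powr_add)
          also have "p + (\<gamma> - 3) / 2 = 0" by (simp add: p_def field_simps)
          finally show ?thesis using pH by (simp add: g_def flip: mult.assoc)
        qed
        then have "\<bar>dxi H T2 x\<bar> = H T2 x powr p * \<bar>g\<bar>" by (simp add: abs_mult)
        also have "\<dots> \<le> (bm powr p + B powr p) * (\<zeta> * S)"
          using powr_between[OF bm bH Bx(1), of p] g1 by (intro mult_mono) auto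
        finally have "\<bar>dxi H T2 x\<bar> \<le> (bm powr p + B powr p) * (\<zeta> * S)" .
        then show "bm \<le> H T2 x \<and> H T2 x \<le> B \<and> \<bar>U T2 x\<bar> \<le> B \<and> \<bar>V T2 x\<bar> \<le> B \<and> \<bar>dxi H T2 x\<bar> \<le> M \<and> \<bar>dxi U T2 x\<bar> \<le> M \<and> \<bar>dxi V T2 x\<bar> \<le> M"
          using bH Bx U1 \<zeta>S pS B(1) unfolding M_def by auto
      qed
    qed
    then obtain h' u' v' where s2: "classical_solution \<gamma> {0..\<delta>} h' u' v'" "h' 0 = H T2" "u' 0 = U T2" "v' 0 = V T2"
      by (auto simp: fun_eq_iff)
    have "classical_solution \<gamma> {0..T2 + \<delta>} (glue T2 H h') (glue T2 U u') (glue T2 V v')"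
      by (rule classical_solution_glue[OF s.T less_imp_le[OF \<delta>] s.sol s2])
    then have "ext (T2 + \<delta>) (glue T2 H h') (glue T2 U u') (glue T2 V v')"
      using e \<delta> by (auto simp: ext_def glue_def)
    then show ?thesis by (intro exI[of _ "glue T2 H h'"] exI[of _ "glue T2 U u'"] exI[of _ "glue T2 V v'"]) (auto simp: glue_def)
  qed
  then show ?thesis using \<delta> by blast
qed

text \<open>A chain of extensions is chosen greedily, and agreement with the preceding stage is part
  of each choice. The lifespan bound makes the times converge. If the gradients stayed bounded
  below, \<open>uniform_continuation\<close> would offer a fixed gain at every stage, and greediness
  would turn this into unbounded times.\<close>

theorem finite_time_blowup:
  "\<exists>Ts>T. \<exists>H U V. classical_solution \<gamma> {0..<Ts} H U V \<and> (\<forall>t\<in>{0..T}. H t = h t \<and> U t = u t \<and> V t = v t) \<and>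
     (\<exists>c>0. \<forall>t\<in>{0..<Ts}. \<forall>x. c \<le> H t x) \<and>
     (\<exists>C. \<forall>t\<in>{0..<Ts}. \<forall>x. H t x \<le> C \<and> \<bar>U t x\<bar> \<le> C \<and> \<bar>V t x\<bar> \<le> C) \<and>
     (\<exists>C. \<forall>t\<in>{0..<Ts}. \<forall>b x. zz H U b t x \<le> C) \<and>
     (\<forall>L. \<exists>t0<Ts. \<forall>t\<in>{t0..<Ts}. \<exists>b x. zz H U b t x \<le> - L)"
proof -
  obtain Tm where Tm: "\<And>T2 H U V. ext T2 H U V \<Longrightarrow> T2 < Tm" using lifespan_bounded by blast
  define agree where "agree T2 f g \<longleftrightarrow> (\<forall>t\<in>{0..T2}. fst f t = fst g t \<and> fst (snd f) t = fst (snd g) t \<and> snd (snd f) t = snd (snd g) t)"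
    for T2 and f g :: "(real \<Rightarrow> real \<Rightarrow> real) \<times> (real \<Rightarrow> real \<Rightarrow> real) \<times> (real \<Rightarrow> real \<Rightarrow> real)"
  define E where "E T2 f \<longleftrightarrow> ext T2 (fst f) (fst (snd f)) (snd (snd f))"
    for T2 and f :: "(real \<Rightarrow> real \<Rightarrow> real) \<times> (real \<Rightarrow> real \<Rightarrow> real) \<times> (real \<Rightarrow> real \<Rightarrow> real)"
  have step: "\<exists>y. E (fst y) (snd y) \<and> (fst x < fst y \<and> agree (fst x) (snd y) (snd x) \<and>
      (\<forall>T3 g. E T3 g \<longrightarrow> agree (fst x) g (snd x) \<longrightarrow> T3 \<le> 2 * fst y - fst x))" if x: "E (fst x) (snd x)" for x
  proof -
    define T2 where "T2 = fst x"
    define f where "f = snd x"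
    have e: "ext T2 (fst f) (fst (snd f)) (snd (snd f))" using x by (simp add: E_def T2_def f_def)
    interpret s: localized_solution \<gamma> T2 "fst f" "fst (snd f)" "snd (snd f)" M0 by (rule ext_localized[OF e])
    have t: "T2 \<in> {0..T2}" using s.T by simp
    \<comment> \<open>The lifespans of all extensions of the current stage, with supremum at most
      \<open>Tm\<close>.\<close>
    define A where "A = {T3. \<exists>g. E T3 g \<and> agree T2 g f}"
    have bd: "bdd_above A" using Tm by (auto simp: A_def E_def bdd_above_def intro!: exI[of _ Tm] less_imp_le)
    have "\<exists>C. \<forall>t\<in>{0..T2}. \<forall>x. \<bar>(\<lambda>(t, x). s.Z b t x) (t, x)\<bar> \<le> C" for b
      by (rule s.bounded_of_constant_outside[OF s.Z_cont, of _ 0]) (simp add: s.Z_outside)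
    then obtain C where C: "\<And>b t x. t \<in> {0..T2} \<Longrightarrow> \<bar>s.Z b t x\<bar> \<le> C b" by (metis case_prod_conv)
    define L where "L = max (C True) (C False)"
    have low: "zz (fst f) (fst (snd f)) b T2 x \<ge> - L" for b x
      using C[OF t, of b x] unfolding ext_Z[OF e] by (cases b) (auto simp: L_def)
    obtain \<delta> where \<delta>: "\<delta> > 0" "\<exists>H' U' V'. ext (T2 + \<delta>) H' U' V' \<and> (\<forall>t\<in>{0..T2}. H' t = fst f t \<and> U' t = fst (snd f) t \<and> V' t = snd (snd f) t)"
      using uniform_continuation[of T2 L] e low by blast
    then have "T2 + \<delta> \<in> A" by (force simp: A_def E_def agree_def)
    then have "T2 < Sup A" using cSup_upper[OF _ bd, of "T2 + \<delta>"] \<delta>(1) by linarith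
    then have "(T2 + Sup A) / 2 < Sup A" by simp
    moreover have "A \<noteq> {}" using \<open>T2 + \<delta> \<in> A\<close> by blast
    \<comment> \<open>Past the midpoint between \<open>T2\<close> and the supremum. The consequence
      \<open>T4 \<le> 2 * T3 - T2\<close> for every competing extension is the form handed to the
      chain.\<close>
    ultimately obtain T3 where T3: "T3 \<in> A" "(T2 + Sup A) / 2 < T3" using less_cSupD by blast
    then obtain g where g: "E T3 g" "agree T2 g f" by (auto simp: A_def)
    have "T4 \<le> 2 * T3 - T2" if "E T4 g'" "agree T2 g' f" for T4 g'
    proof -
      have "T4 \<in> A" using that unfolding A_def by blast
      then have "T4 \<le> Sup A" using bd by (rule cSup_upper)
      then show ?thesis using T3(2) by (simp add: field_simps)
    qed
    moreover have "T2 < T3" using T3(2) \<open>T2 < Sup A\<close> by (simp add: field_simps)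
    ultimately show ?thesis using g by (intro exI[of _ "(T3, g)"]) (auto simp: T2_def f_def)
  qed
  have "\<exists>F. \<forall>n::nat. E (fst (F n)) (snd (F n)) \<and> (fst (F n) < fst (F (Suc n)) \<and> agree (fst (F n)) (snd (F (Suc n))) (snd (F n)) \<and>
      (\<forall>T3 g. E T3 g \<longrightarrow> agree (fst (F n)) g (snd (F n)) \<longrightarrow> T3 \<le> 2 * fst (F (Suc n)) - fst (F n)))"
    by (rule dependent_nat_choice[where P = "\<lambda>_ x. E (fst x) (snd x)"])
      (use ext_self step in \<open>auto simp: E_def intro!: exI[of _ "(T, h, u, v)"]\<close>)
  then obtain F where F: "\<And>n. E (fst (F n)) (snd (F n))" "\<And>n. fst (F n) < fst (F (Suc n))" "\<And>n. agree (fst (F n)) (snd (F (Suc n))) (snd (F n))"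
    "\<And>n T3 g. E T3 g \<Longrightarrow> agree (fst (F n)) g (snd (F n)) \<Longrightarrow> T3 \<le> 2 * fst (F (Suc n)) - fst (F n)" by blast
  define \<tau> where "\<tau> n = fst (F n)" for n
  define f where "f n = snd (F n)" for n
  have \<tau>_mono: "strict_mono \<tau>" using F(2) by (simp add: strict_mono_Suc_iff \<tau>_def)
  have \<tau>T: "T \<le> \<tau> n" for n using F(1)[of n] by (simp add: E_def ext_def \<tau>_def)
  have \<tau>Tm: "\<tau> n < Tm" for n using F(1)[of n] Tm by (simp add: E_def \<tau>_def)
  have bd: "bdd_above (range \<tau>)" using \<tau>Tm by (auto simp: bdd_above_def intro!: exI[of _ Tm] less_imp_le)
  define Ts where "Ts = Sup (range \<tau>)"
  have \<tau>Ts: "\<tau> n < Ts" for n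
  proof -
    have "\<tau> n < \<tau> (Suc n)" using \<tau>_mono by (simp add: strict_mono_def)
    also have "\<tau> (Suc n) \<le> Ts" unfolding Ts_def by (rule cSup_upper[OF _ bd]) simp
    finally show ?thesis .
  qed
  have reach: "\<exists>n. t < \<tau> n" if "t < Ts" for t
    using less_cSupD[of "range \<tau>" t] that by (auto simp: Ts_def)
  have agr: "agree (\<tau> n) (f (n + k)) (f n)" for n k
  proof (induction k)
    case 0 show ?case by (simp add: agree_def)
  next
    case (Suc k)
    have "\<tau> n \<le> \<tau> (n + k)" using strict_mono_mono[OF \<tau>_mono] by (simp add: monoD)
    then have "agree (\<tau> n) (f (Suc (n + k))) (f (n + k))" using F(3)[of "n + k"] by (auto simp: agree_def \<tau>_def f_def)
    with Suc show ?case by (auto simp: agree_def)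
  qed
  \<comment> \<open>Any stage beyond \<open>t\<close> gives the same values by \<open>agr\<close>;
    the least index merely fixes one.\<close>
  define m where "m t = (LEAST n. t < \<tau> n)" for t
  define H where "H t = fst (f (m t)) t" for t
  define U where "U t = fst (snd (f (m t))) t" for t
  define V where "V t = snd (snd (f (m t))) t" for t
  have HUV: "H t = fst (f n) t \<and> U t = fst (snd (f n)) t \<and> V t = snd (snd (f n)) t" if t: "t \<in> {0..\<tau> n}" for t n
  proof -
    have "\<exists>k. t < \<tau> k" using t \<tau>Ts[of n] by (intro reach) auto
    then have mt: "t < \<tau> (m t)" unfolding m_def by (rule LeastI_ex)
    show ?thesis
    proof (cases "m t \<le> n")
      case True
      then show ?thesis using agr[of "m t" "n - m t"] mt t by (auto simp: agree_def H_def U_def V_def)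
    next
      case False
      then show ?thesis using agr[of n "m t - n"] t by (auto simp: agree_def H_def U_def V_def)
    qed
  qed
  have En: "ext (\<tau> n) H U V" for n
  proof -
    have e: "ext (\<tau> n) (fst (f n)) (fst (snd (f n))) (snd (snd (f n)))" using F(1)[of n] by (simp add: E_def \<tau>_def f_def)
    have "classical_solution \<gamma> {0..\<tau> n} H U V"
      by (rule classical_solution_cong[of _ _ "fst (f n)" "fst (snd (f n))" "snd (snd (f n))"]) (use e HUV in \<open>auto simp: ext_def\<close>)
    moreover have "H t = h t \<and> U t = u t \<and> V t = v t" if "t \<in> {0..T}" for t
      using HUV[of t n] that \<tau>T[of n] e by (auto simp: ext_def)
    ultimately show ?thesis using \<tau>T[of n] by (simp add: ext_def)
  qed
  have sol': "classical_solution \<gamma> {0..<Ts} H U V"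
    by (rule classical_solution_union[of _ \<tau>]) (use En reach \<tau>Ts in \<open>auto simp: ext_def\<close>)
  have TTs: "T < Ts" using \<tau>T[of 0] \<tau>Ts[of 0] by linarith
  obtain N s0 where N: "N \<ge> 1" "s0 > 0" "\<And>T2 H U V t x b. ext T2 H U V \<Longrightarrow> t \<in> {0..T2} \<Longrightarrow> zz H U b t x \<le> N"
    "\<And>T2 H U V t x. ext T2 H U V \<Longrightarrow> t \<in> {0..T2} \<Longrightarrow> 1 / sqrt (H t x) \<le> s0 + N / 2 * t"
    using ext_bounds by blast
  obtain B where B: "\<And>T2 H U V t x. ext T2 H U V \<Longrightarrow> T2 \<le> Ts \<Longrightarrow> t \<in> {0..T2} \<Longrightarrow>
     H t x \<le> B \<and> \<bar>U t x\<bar> \<le> B \<and> \<bar>V t x\<bar> \<le> B" using ext_sup_bounds[of Ts] by blast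
  have inn: "\<exists>n. t \<in> {0..\<tau> n}" if "t \<in> {0..<Ts}" for t using reach[of t] that by (auto intro: less_imp_le)
  have 1: "\<exists>c>0. \<forall>t\<in>{0..<Ts}. \<forall>x. c \<le> H t x"
  proof -
    define S where "S = s0 + N / 2 * Ts"
    have Ts0: "Ts > 0" using TTs T by linarith
    have S: "S > 0" using N(1,2) Ts0 by (simp add: S_def add_pos_pos)
    have "1 / S\<^sup>2 \<le> H t x" if t: "t \<in> {0..<Ts}" for t x
    proof -
      obtain n where n: "t \<in> {0..\<tau> n}" using inn[OF t] by blast
      have p: "H t x > 0" using En[of n] n by (auto simp: ext_def classical_solution_def)
      have "N / 2 * t \<le> N / 2 * Ts" using t N(1) by (intro mult_left_mono) auto
      then have "1 / sqrt (H t x) \<le> S" using N(4)[OF En n, of x] by (simp add: S_def)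
      then have "1 / S \<le> sqrt (H t x)" using S p by (simp add: field_simps)
      then have "(1 / S)\<^sup>2 \<le> (sqrt (H t x))\<^sup>2" using S by (intro power_mono) auto
      then show ?thesis using p by (simp add: power_divide)
    qed
    then show ?thesis using S by (intro exI[of _ "1 / S\<^sup>2"]) auto
  qed
  have 2: "\<exists>C. \<forall>t\<in>{0..<Ts}. \<forall>x. H t x \<le> C \<and> \<bar>U t x\<bar> \<le> C \<and> \<bar>V t x\<bar> \<le> C"
    using B[OF En less_imp_le[OF \<tau>Ts]] inn by blast
  have 3: "\<exists>C. \<forall>t\<in>{0..<Ts}. \<forall>b x. zz H U b t x \<le> C"
    using N(3)[OF En] inn by blast
  have 4: "\<exists>t0<Ts. \<forall>t\<in>{t0..<Ts}. \<exists>b x. zz H U b t x \<le> - L" for L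
  proof (rule ccontr)
    assume no: "\<not> ?thesis"
    \<comment> \<open>Lowering the level to the threshold or below makes
      \<open>negative_persists\<close> applicable: one value at or below \<open>- L'\<close> would
      keep the infimum at or below \<open>- L\<close> from then on, contrary to
      \<open>no\<close>.\<close>
    define L' where "L' = max L (sqrt (2 * W))"
    have low: "zz H U b t1 x \<ge> - L'" if t1: "t1 \<in> {0..<Ts}" for b t1 x
    proof (rule ccontr)
      assume "\<not> ?thesis"
      then have z: "zz H U b t1 x \<le> - L'" by simp
      have late: "\<exists>b x. zz H U b t x \<le> - L" if t: "t \<in> {t1..<Ts}" for t
      proof -
        have "t \<in> {0..<Ts}" using t t1 by simp
        then obtain n where n: "t \<in> {0..\<tau> n}" using inn by blast
        have "\<exists>b x. zz H U b t x \<le> - L'"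
          by (rule negative_persists[OF En[of n] _ _ _ _ z]) (use t1 t n in \<open>auto simp: L'_def\<close>)
        moreover have "- L' \<le> - L" by (simp add: L'_def)
        ultimately show ?thesis by (meson order_trans)
      qed
      have "t1 < Ts" using t1 by simp
      with late no show False by blast
    qed
    obtain \<delta> where \<delta>: "\<delta> > 0" "\<forall>T2 H U V. ext T2 H U V \<longrightarrow> T2 \<le> Ts \<longrightarrow> (\<forall>b x. zz H U b T2 x \<ge> - L') \<longrightarrow>
      (\<exists>H' U' V'. ext (T2 + \<delta>) H' U' V' \<and> (\<forall>t\<in>{0..T2}. H' t = H t \<and> U' t = U t \<and> V' t = V t))"
      using uniform_continuation[of Ts L'] by (elim exE conjE)
    \<comment> \<open>The continuation by \<open>\<delta>\<close> competes with the chosen next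
      stage, which reaches at least half as far.\<close>
    have grow: "\<tau> n + \<delta> / 2 \<le> \<tau> (Suc n)" for n
    proof -
      have "\<tau> n \<in> {0..<Ts}" using \<tau>T[of n] T \<tau>Ts[of n] by simp
      from low[OF this] have "\<forall>b x. zz H U b (\<tau> n) x \<ge> - L'" by blast
      from \<delta>(2)[rule_format, OF En[of n] less_imp_le[OF \<tau>Ts], OF this[rule_format]]
      obtain H' U' V' where e': "ext (\<tau> n + \<delta>) H' U' V'" "\<forall>t\<in>{0..\<tau> n}. H' t = H t \<and> U' t = U t \<and> V' t = V t"
        by blast
      have "agree (\<tau> n) (H', U', V') (f n)" using e'(2) HUV[of _ n] by (auto simp: agree_def)
      then have "\<tau> n + \<delta> \<le> 2 * \<tau> (Suc n) - \<tau> n"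
        using F(4)[of "\<tau> n + \<delta>" "(H', U', V')" n] e'(1) by (simp add: E_def \<tau>_def f_def)
      then show ?thesis by (simp add: field_simps)
    qed
    have lin: "\<tau> 0 + real n * (\<delta> / 2) \<le> \<tau> n" for n
    proof (induction n)
      case (Suc n)
      then show ?case using grow[of n] by (simp add: algebra_simps add_divide_distrib)
    qed simp
    have "\<delta> / 2 > 0" using \<delta>(1) by simp
    from reals_Archimedean3[OF this, rule_format, of "Ts - \<tau> 0"]
    obtain n where "Ts - \<tau> 0 < real n * (\<delta> / 2)" by blast
    then show False using lin[of n] \<tau>Ts[of n] by linarith
  qed
  have 5: "\<forall>t\<in>{0..T}. H t = h t \<and> U t = u t \<and> V t = v t" using En[of 0] by (simp add: ext_def)
  show ?thesis
    by (intro exI[of _ Ts] exI[of _ H] exI[of _ U] exI[of _ V] conjI TTs sol' 1 2 3 5 allI 4)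
qed

end

section \<open>Passage to extended-real infima, suprema and limits\<close>

theorem theorem1p1:
  fixes \<gamma> T' :: real and h u v :: "real \<Rightarrow> real \<Rightarrow> real" and h0 u0 v0 :: "real \<Rightarrow> real"
  assumes "\<gamma> \<ge> 1" and "T' \<ge> 0"
    and sol: "classical_solution \<gamma> {0..T'} h u v"
    and init: "\<forall>x. h 0 x = h0 x \<and> u 0 x = u0 x \<and> v 0 x = v0 x"
    and h0pos: "\<exists>c>0. \<forall>x. h0 x \<ge> c"
    and "C01 (\<lambda>x. h0 x - 1)" and "C01 u0" and "C01 v0"
    and crit: "(INF x. ereal (min (Zw \<gamma> h u 1 T' x) (Zw \<gamma> h u 2 T' x)))
                 \<le> ereal (- sqrt (2 * omega0_sharp h0 v0))"
  shows "\<exists>Ts > T'. \<exists>H U V.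
           classical_solution \<gamma> {0..<Ts} H U V \<and>
           (\<forall>t\<in>{0..T'}. \<forall>x. H t x = h t x \<and> U t x = u t x \<and> V t x = v t x) \<and>
           (INF p\<in>{0..<Ts} \<times> UNIV. ereal (H (fst p) (snd p))) > 0 \<and>
           (SUP p\<in>{0..<Ts} \<times> UNIV.
              ereal (max (H (fst p) (snd p)) (max \<bar>U (fst p) (snd p)\<bar> \<bar>V (fst p) (snd p)\<bar>))) < \<infinity> \<and>
           (SUP p\<in>{0..<Ts} \<times> UNIV.
              ereal (max (Zw \<gamma> H U 1 (fst p) (snd p)) (Zw \<gamma> H U 2 (fst p) (snd p)))) < \<infinity> \<and>
           ((\<lambda>t. INF x. ereal (min (Zw \<gamma> H U 1 t x) (Zw \<gamma> H U 2 t x))) \<longlongrightarrow> - \<infinity>) (at_left Ts)"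
proof -
  have h00: "h 0 = h0" "u 0 = u0" "v 0 = v0" using init by auto
  obtain R1 where R1: "\<And>x. h0 x \<noteq> 1 \<Longrightarrow> \<bar>x\<bar> \<le> R1" using assms(6) by (auto simp: C01_def bounded_iff)
  obtain R2 where R2: "\<And>x. u0 x \<noteq> 0 \<Longrightarrow> \<bar>x\<bar> \<le> R2" using assms(7) by (auto simp: C01_def bounded_iff)
  obtain R3 where R3: "\<And>x. v0 x \<noteq> 0 \<Longrightarrow> \<bar>x\<bar> \<le> R3" using assms(8) by (auto simp: C01_def bounded_iff)
  define M0 where "M0 = \<bar>R1\<bar> + \<bar>R2\<bar> + \<bar>R3\<bar> + 1"
  interpret loc: localized_solution \<gamma> T' h u v M0
  proof
    show "h 0 x = 1 \<and> u 0 x = 0 \<and> v 0 x = 0" if "M0 \<le> \<bar>x\<bar>" for x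
      using R1[of x] R2[of x] R3[of x] that unfolding h00 M0_def by linarith
  qed (use assms(1,2) sol in \<open>auto simp: M0_def\<close>)
  have \<omega>: "omega0 h0 v0 x = dxi v 0 x + 1 / h 0 x" for x
    by (simp add: omega0_def dxi_def h00)
  have zero_time: "0 \<in> {0..T'}" using assms(2) by simp
  have "continuous_on ({0..T'} \<times> UNIV) (\<lambda>p. dxi v (fst p) (snd p) + 1 / h (fst p) (snd p))"
    using loc.pos by (intro continuous_intros loc.fields_cont) (auto simp: less_imp_neq[symmetric])
  from loc.bounded_of_constant_outside[OF this, of 1]
  have "\<exists>C. \<forall>t\<in>{0..T'}. \<forall>x. \<bar>dxi v t x + 1 / h t x\<bar> \<le> C" using loc.outside loc.outside_dx by simp
  then obtain C where C: "\<And>x. \<bar>omega0 h0 v0 x\<bar> \<le> C" using zero_time unfolding \<omega> by blast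
  have bd: "bdd_above (range (omega0 h0 v0))" using C by (auto simp: bdd_above_def abs_le_iff)
  define W where "W = omega0_sharp h0 v0"
  have W: "dxi v 0 x + 1 / h 0 x \<le> W" for x
    unfolding W_def omega0_sharp_def \<omega>[symmetric] by (rule cSUP_upper[OF _ bd]) simp
  \<comment> \<open>Outside the support \<open>h = 1\<close> and \<open>v_x = 0\<close>, so the
    vorticity is 1 there; in particular the square root in the threshold is positive.\<close>
  have W1: "W \<ge> 1"
  proof -
    have x: "\<bar>M0 + 2 * T' + 1\<bar> > M0 + 2 * T'" using assms(2) loc.M0 by simp
    show ?thesis using W[of "M0 + 2 * T' + 1"] loc.outside[OF zero_time less_imp_le[OF x]] loc.outside_dx[OF zero_time x, of v] by simp
  qed
  define \<sigma> where "\<sigma> = sqrt (2 * W)"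
  have \<sigma>: "\<sigma> > 0" using W1 by (simp add: \<sigma>_def)
  have critZ: "\<exists>b x. loc.Z b T' x \<le> - \<sigma>"
  proof (rule ccontr)
    assume "\<not> ?thesis"
    then have gt: "loc.Z b T' x > - \<sigma>" for b x by (meson not_le)
    let ?I = "{- (M0 + 2 * T')..M0 + 2 * T'}"
    have "continuous_on UNIV (\<lambda>x. (\<lambda>(t, x). loc.Z b t x) (T', x))" for b
      by (rule continuous_on_compose2[OF loc.Z_cont]) (use assms(2) in \<open>auto intro!: continuous_intros\<close>)
    then have "continuous_on UNIV (\<lambda>x. loc.Z b T' x)" for b by simp
    then have c: "continuous_on ?I (\<lambda>x. min (loc.Z False T' x) (loc.Z True T' x))"
      by (intro continuous_intros) (auto intro: continuous_on_subset)
    have "?I \<noteq> {}" using loc.M0 assms(2) by simp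
    from continuous_attains_inf[OF compact_Icc this c]
    obtain x0 where x0: "\<And>x. x \<in> ?I \<Longrightarrow> min (loc.Z False T' x0) (loc.Z True T' x0) \<le> min (loc.Z False T' x) (loc.Z True T' x)" by blast
    \<comment> \<open>The minimum over the compact interval, together with the value 0 taken outside
      it. If every value were above \<open>- \<sigma>\<close>, so would be \<open>k\<close>, and the
      infimum could not reach the threshold.\<close>
    define k where "k = min 0 (min (loc.Z False T' x0) (loc.Z True T' x0))"
    have k: "k > - \<sigma>" using gt \<sigma> by (simp add: k_def)
    have "k \<le> min (loc.Z False T' x) (loc.Z True T' x)" for x
    proof (cases "x \<in> ?I")
      case True then show ?thesis unfolding k_def by (intro min.coboundedI2 x0)
    next
      case False
      then have "\<bar>x\<bar> > M0 + 2 * T'" by auto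
      then show ?thesis using loc.Z_outside[of T' x] assms(2) by (simp add: k_def)
    qed
    then have "ereal k \<le> (INF x. ereal (min (Zw \<gamma> h u 1 T' x) (Zw \<gamma> h u 2 T' x)))"
      unfolding loc.Zw_eq by (intro INF_greatest) (simp only: ereal_less_eq)
    then have "ereal k \<le> ereal (- \<sigma>)" unfolding \<sigma>_def W_def using crit by (rule order_trans)
    then show False using k by simp
  qed
  interpret bl: blowup_data \<gamma> T' h u v M0 W
    by unfold_locales (use W W1 critZ in \<open>auto simp: \<sigma>_def\<close>)
  obtain Ts H U V where Ts: "Ts > T'" and S: "classical_solution \<gamma> {0..<Ts} H U V" "\<forall>t\<in>{0..T'}. H t = h t \<and> U t = u t \<and> V t = v t"
    and c: "\<exists>c>0. \<forall>t\<in>{0..<Ts}. \<forall>x. c \<le> H t x"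
    and B: "\<exists>C. \<forall>t\<in>{0..<Ts}. \<forall>x. H t x \<le> C \<and> \<bar>U t x\<bar> \<le> C \<and> \<bar>V t x\<bar> \<le> C"
    and Z: "\<exists>C. \<forall>t\<in>{0..<Ts}. \<forall>b x. bl.zz H U b t x \<le> C"
    and L: "\<forall>L. \<exists>t0<Ts. \<forall>t\<in>{t0..<Ts}. \<exists>b x. bl.zz H U b t x \<le> - L"
    using bl.finite_time_blowup by blast
  have zz: "bl.zz H U True t x = Zw \<gamma> H U 2 t x" "bl.zz H U False t x = Zw \<gamma> H U 1 t x" for t x
    by (simp_all add: bl.zz_def)
  have 1: "(INF p\<in>{0..<Ts} \<times> UNIV. ereal (H (fst p) (snd p))) > 0"
  proof -
    obtain c where c: "c > 0" "\<And>t x. t \<in> {0..<Ts} \<Longrightarrow> c \<le> H t x" using c by blast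
    have "ereal c \<le> (INF p\<in>{0..<Ts} \<times> UNIV. ereal (H (fst p) (snd p)))" using c(2) by (intro INF_greatest) auto
    then show ?thesis using c(1) by (metis ereal_less(2) less_le_trans)
  qed
  have 2: "(SUP p\<in>{0..<Ts} \<times> UNIV. ereal (max (H (fst p) (snd p)) (max \<bar>U (fst p) (snd p)\<bar> \<bar>V (fst p) (snd p)\<bar>))) < \<infinity>"
  proof -
    obtain C where C: "\<And>t x. t \<in> {0..<Ts} \<Longrightarrow> H t x \<le> C \<and> \<bar>U t x\<bar> \<le> C \<and> \<bar>V t x\<bar> \<le> C" using B by blast
    have "(SUP p\<in>{0..<Ts} \<times> UNIV. ereal (max (H (fst p) (snd p)) (max \<bar>U (fst p) (snd p)\<bar> \<bar>V (fst p) (snd p)\<bar>))) \<le> ereal C"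
      using C by (intro SUP_least) auto
    then show ?thesis by (rule le_less_trans) simp
  qed
  have 3: "(SUP p\<in>{0..<Ts} \<times> UNIV. ereal (max (Zw \<gamma> H U 1 (fst p) (snd p)) (Zw \<gamma> H U 2 (fst p) (snd p)))) < \<infinity>"
  proof -
    obtain C where C: "\<And>t b x. t \<in> {0..<Ts} \<Longrightarrow> bl.zz H U b t x \<le> C" using Z by blast
    have "(SUP p\<in>{0..<Ts} \<times> UNIV. ereal (max (Zw \<gamma> H U 1 (fst p) (snd p)) (Zw \<gamma> H U 2 (fst p) (snd p)))) \<le> ereal C"
      using C[of _ True] C[of _ False] unfolding zz by (intro SUP_least) auto
    then show ?thesis by (rule le_less_trans) simp
  qed
  have 4: "((\<lambda>t. INF x. ereal (min (Zw \<gamma> H U 1 t x) (Zw \<gamma> H U 2 t x))) \<longlongrightarrow> - \<infinity>) (at_left Ts)"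
    unfolding tendsto_MInfty
  proof
    fix r :: real
    \<comment> \<open>The level is \<open>r - 1\<close>, so that the infimum is strictly below
      \<open>r\<close>.\<close>
    obtain t0 where t0: "t0 < Ts" "\<And>t. t \<in> {t0..<Ts} \<Longrightarrow> \<exists>b x. bl.zz H U b t x \<le> - (1 - r)" using L by blast
    have "(INF x. ereal (min (Zw \<gamma> H U 1 t x) (Zw \<gamma> H U 2 t x))) < ereal r" if t: "t \<in> {t0<..<Ts}" for t
    proof -
      obtain b x where bx: "bl.zz H U b t x \<le> - (1 - r)" using t0(2)[of t] t by auto
      have "min (Zw \<gamma> H U 1 t x) (Zw \<gamma> H U 2 t x) < r" using bx zz[of t x] by (cases b) auto
      then have "ereal (min (Zw \<gamma> H U 1 t x) (Zw \<gamma> H U 2 t x)) < ereal r" by (simp only: less_ereal.simps)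
      then show ?thesis by (rule le_less_trans[OF INF_lower, rotated]) simp
    qed
    then show "\<forall>\<^sub>F t in at_left Ts. (INF x. ereal (min (Zw \<gamma> H U 1 t x) (Zw \<gamma> H U 2 t x))) < ereal r"
      using eventually_at_left_real[OF t0(1)] by (rule eventually_mono[rotated]) 
  qed
  have 5: "\<forall>t\<in>{0..T'}. \<forall>x. H t x = h t x \<and> U t x = u t x \<and> V t x = v t x" using S(2) by simp
  show ?thesis
    by (intro exI[of _ Ts] exI[of _ H] exI[of _ U] exI[of _ V] conjI Ts S(1) 1 2 3 4 5)
qed

end
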